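(* Let $u$ be the torsion function in a triangle $\Omega=\triangle_{ABC}\subset\mathbb{R}^2$. Then on each side of $\triangle_{ABC}$ the critical point of the function $x\in\partial\Omega\mapsto|\nabla u|^2(x)$ is unique and nondegenerate. As a result, on each side of the triangle $\triangle_{ABC}$ there is at most one fail point.
   Context: $\triangle_{ABC}$ is the open (nondegenerate) triangle with vertices $A,B,C$. The torsion function $u$ of $\Omega$ is the unique solution of $-\Delta u=1$ in $\Omega$, $u=0$ on $\partial\Omega$; on a triangle it is $C^1$ up to the closure with vanishing gradient at the vertices, and it is smooth up to each open side. A critical point of $|\nabla u|^2$ on a side means a critical point of the restriction of $|\nabla u|^2$ to the open side (endpoints excluded), viewed as a function of one variable; "unique" means that there is exactly one such point, and "nondegenerate" means that the second derivative of this restriction along the side is nonzero there. A fail point is a point at which $|\nabla u|$ attains its maximum over $\overline\Omega$ (such points lie on $\partial\Omega$). *)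

theory Defs
  imports "HOL-Analysis.Analysis"
begin

definition open_triangle :: "real^2 \<Rightarrow> real^2 \<Rightarrow> real^2 \<Rightarrow> (real^2) set" where
  "open_triangle A B C = interior (convex hull {A, B, C})"

definition partial :: "'a::euclidean_space \<Rightarrow> ('a \<Rightarrow> real) \<Rightarrow> 'a \<Rightarrow> real" where
  "partial b f x = frechet_derivative f (at x) b"

definition grad :: "('a::euclidean_space \<Rightarrow> real) \<Rightarrow> 'a \<Rightarrow> 'a" where
  "grad f x = (\<Sum>b\<in>Basis. partial b f x *\<^sub>R b)"

definition laplacian :: "('a::euclidean_space \<Rightarrow> real) \<Rightarrow> 'a \<Rightarrow> real" where
  "laplacian f x = (\<Sum>b\<in>Basis. partial b (partial b f) x)"

(* Meaningful for open S only, since partial uses the unrestricted filter (at x). *)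
definition C2_on :: "'a::euclidean_space set \<Rightarrow> ('a \<Rightarrow> real) \<Rightarrow> bool" where
  "C2_on S f \<longleftrightarrow> f differentiable_on S \<and>
     (\<forall>b\<in>Basis. partial b f differentiable_on S) \<and>
     (\<forall>b\<in>Basis. \<forall>c\<in>Basis. continuous_on S (partial c (partial b f)))"

(* Classical solution of - \<Delta>u = 1 in S, u = 0 on the boundary. Only the values of u
   on the closure of S matter, and there they are unique for bounded S. *)
definition torsion_function :: "'a::euclidean_space set \<Rightarrow> ('a \<Rightarrow> real) \<Rightarrow> bool" where
  "torsion_function S u \<longleftrightarrow> C2_on S u \<and> continuous_on (closure S) u \<and>
     (\<forall>x\<in>S. - laplacian u x = 1) \<and> (\<forall>x\<in>frontier S. u x = 0)"

(* The gradient on the closure of S is the continuous extension of the gradient inside S: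
   derivatives of u at a boundary point would depend on the irrelevant values of u outside. *)
definition grad_closure :: "'a::euclidean_space set \<Rightarrow> ('a \<Rightarrow> real) \<Rightarrow> 'a \<Rightarrow> 'a" where
  "grad_closure S u x = Lim (at x within S) (grad u)"

definition grad_norm_sq :: "'a::euclidean_space set \<Rightarrow> ('a \<Rightarrow> real) \<Rightarrow> 'a \<Rightarrow> real" where
  "grad_norm_sq S u x = (norm (grad_closure S u x))\<^sup>2"

(* F along the line through x with direction v, as a function of one real variable.
   Criticality and nondegeneracy at x do not depend on the length of v \<noteq> 0. *)
definition along :: "'a::real_vector \<Rightarrow> 'a \<Rightarrow> ('a \<Rightarrow> real) \<Rightarrow> real \<Rightarrow> real" where
  "along v x F s = F (x + s *\<^sub>R v)"

definition side_critical_point :: "('a::real_vector \<Rightarrow> real) \<Rightarrow> 'a \<Rightarrow> 'a \<Rightarrow> 'a \<Rightarrow> bool" where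
  "side_critical_point F P Q x \<longleftrightarrow> x \<in> open_segment P Q \<and>
     (along (Q - P) x F has_real_derivative 0) (at 0)"

(* The second derivative along the segment exists at x and is nonzero; the first conjunct
   ensures that deriv is the genuine first derivative near x. *)
definition side_nondegenerate :: "('a::real_vector \<Rightarrow> real) \<Rightarrow> 'a \<Rightarrow> 'a \<Rightarrow> 'a \<Rightarrow> bool" where
  "side_nondegenerate F P Q x \<longleftrightarrow>
     (\<forall>\<^sub>F s in nhds 0. along (Q - P) x F field_differentiable at s) \<and>
     (\<exists>d. d \<noteq> 0 \<and> (deriv (along (Q - P) x F) has_real_derivative d) (at 0))"

definition fail_point :: "'a::euclidean_space set \<Rightarrow> ('a \<Rightarrow> real) \<Rightarrow> 'a \<Rightarrow> bool" where
  "fail_point S u x \<longleftrightarrow> x \<in> closure S \<and>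
     (\<forall>y\<in>closure S. norm (grad_closure S u y) \<le> norm (grad_closure S u x))"

end

theory Submission
  imports Defs "HOL-Complex_Analysis.Complex_Analysis"
begin

text \<open>Place the side on the real axis with the triangle above it. Then $u + y^2/2 = \mathrm{Im} f$ with
  $f$ holomorphic, and $\Phi = f' = (u_y + y) + \mathrm{i}\,u_x$ extends by reflection across the side, where
  $|\nabla u| = u_y > 0$; so the critical points are the zeros of $\Phi'$ on the side.
  The harmonic function $H = u_x$ vanishes on the base and is positive on the left and negative on the
  right side. By the maximum principle every point of $\{H > 0\}$ can be joined within this set
  to the left side, and every point of $\{H < 0\}$ to the right side. At a zero of $\Phi'$ with
  $u_{xxy} \ge 0$ a positive nodal sector of $H$ lies to the right of a negative one, so two such paths
  would have to cross. Hence every critical point of $u_y$ on the side is a strict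
  nondegenerate maximum, which leaves room for only one; it exists by Rolle's theorem, since
  $\nabla u$ tends to $0$ at the vertices.\<close>

subsection \<open>Pointwise Laplacian and the weak maximum principle\<close>

text \<open>The hypotheses give \<open>u\<close> two derivatives inside the triangle and mere
  continuity on its closure. Every boundary fact about the gradient therefore has to be earned: its
  limits on the open sides, its limit \<open>0\<close> at the vertices, the positivity of the normal
  derivative. One instrument serves for all of them, the weak maximum principle: it compares
  \<open>u\<close> with explicit barriers, and it turns approximation on the boundary of a disc or
  half disc by imaginary parts of entire functions into approximation inside.

  The vertices matter beyond Rolle's theorem: the nodal argument needs \<open>H\<close> continuous
  on the whole closed triangle. An obtuse angle is harmless there, since any opening below
  \<open>pi\<close> leaves room for a growth exponent above \<open>1\<close>.

  On the base \<open>\<Phi>\<close> is real, so \<open>u_xxy\<close> is \<open>Re \<Phi>''\<close>.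
  Its vanishing, that is a zero of \<open>\<Phi>'\<close> of higher order, needs no separate theory:
  counting nodal sectors excludes it together with the positive case, and this is where
  nondegeneracy comes from.\<close>

definition has_deriv2 :: "(real \<Rightarrow> real) \<Rightarrow> real \<Rightarrow> bool" where
  "has_deriv2 f a \<longleftrightarrow> (\<exists>p. (\<forall>\<^sub>F s in nhds 0. (f has_real_derivative p s) (at s)) \<and>
     (p has_real_derivative a) (at 0))"

text \<open>Only the two pure second derivatives at one point enter, which is all that the maximum
  principle sees. Being a relation, it also asserts that they exist, so no default value of a
  derivative can slip in.\<close>

definition has_lap :: "(complex \<Rightarrow> real) \<Rightarrow> complex \<Rightarrow> real \<Rightarrow> bool" where
  "has_lap v z l \<longleftrightarrow> (\<exists>a b. has_deriv2 (\<lambda>s. v (z + of_real s)) a \<and>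
     has_deriv2 (\<lambda>s. v (z + \<i> * of_real s)) b \<and> l = a + b)"

lemma has_lapI:
  assumes "has_deriv2 (\<lambda>s. v (z + of_real s)) a" "has_deriv2 (\<lambda>s. v (z + \<i> * of_real s)) b"
  shows "has_lap v z (a + b)"
  using assms unfolding has_lap_def by blast

lemma has_deriv2I:
  assumes "\<And>s. (f has_real_derivative p s) (at s)" "(p has_real_derivative a) (at 0)"
  shows "has_deriv2 f a"
  using assms unfolding has_deriv2_def by (intro exI[of _ p]) auto

lemma has_deriv2_lincomb:
  assumes "has_deriv2 f a" "has_deriv2 g b"
  shows "has_deriv2 (\<lambda>s. c * f s + d * g s) (c * a + d * b)"
proof -
  obtain p q where
    "\<forall>\<^sub>F s in nhds 0. (f has_real_derivative p s) (at s)" "(p has_real_derivative a) (at 0)"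
    "\<forall>\<^sub>F s in nhds 0. (g has_real_derivative q s) (at s)" "(q has_real_derivative b) (at 0)"
    using assms unfolding has_deriv2_def by blast
  note * = this
  have "\<forall>\<^sub>F s in nhds 0. ((\<lambda>s. c * f s + d * g s) has_real_derivative c * p s + d * q s) (at s)"
    using *(1,3) by eventually_elim (auto intro!: derivative_eq_intros)
  moreover have "((\<lambda>s. c * p s + d * q s) has_real_derivative c * a + d * b) (at 0)"
    using *(2,4) by (auto intro!: derivative_eq_intros)
  ultimately show ?thesis
    unfolding has_deriv2_def by (intro exI[of _ "\<lambda>s. c * p s + d * q s"]) simp
qed

lemma has_deriv2_cong:
  assumes "has_deriv2 f a" "\<forall>\<^sub>F s in nhds 0. f s = g s"
  shows "has_deriv2 g a"
proof -
  obtain p where p: "\<forall>\<^sub>F s in nhds 0. (f has_real_derivative p s) (at s)"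
    "(p has_real_derivative a) (at 0)"
    using assms(1) unfolding has_deriv2_def by blast
  have ev: "\<forall>\<^sub>F s in nhds (0::real). \<forall>\<^sub>F t in nhds s. f t = g t"
    using assms(2) by (simp add: eventually_eventually)
  have "\<forall>\<^sub>F s in nhds 0. (g has_real_derivative p s) (at s)"
    using p(1) ev
    by eventually_elim (metis DERIV_cong_ev)
  with p(2) show ?thesis unfolding has_deriv2_def by blast
qed

text \<open>If \<open>a > 0\<close>, then \<open>p\<close> is positive just to the right of
  \<open>0\<close>, and the mean value theorem lifts \<open>f\<close> above \<open>f 0\<close>
  there.\<close>

lemma has_deriv2_local_max:
  assumes "has_deriv2 f a" "\<forall>\<^sub>F s in nhds 0. f s \<le> f 0"
  shows "a \<le> 0"
proof (rule ccontr)
  assume "\<not> a \<le> 0"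
  then have "a > 0" by simp
  obtain p where p: "\<forall>\<^sub>F s in nhds 0. (f has_real_derivative p s) (at s)"
    "(p has_real_derivative a) (at 0)"
    using assms(1) unfolding has_deriv2_def by blast
  obtain d where d: "d > 0" "\<And>s. \<bar>s\<bar> < d \<Longrightarrow> (f has_real_derivative p s) (at s) \<and> f s \<le> f 0"
    using eventually_conj[OF p(1) assms(2)] unfolding eventually_nhds_metric by (auto simp: dist_real_def)
  have "p 0 = 0"
    using d by (intro DERIV_local_max[of f "p 0" 0 d]) auto
  obtain e where e: "e > 0" "\<And>h. 0 < h \<Longrightarrow> h < e \<Longrightarrow> p 0 < p (0 + h)"
    using DERIV_pos_inc_right[OF p(2) \<open>a > 0\<close>] by blast
  define t where "t = min d e / 2"
  have t: "0 < t" "t < d" "t < e" using d e by (auto simp: t_def)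
  obtain s where s: "0 < s" "s < t" "f t - f 0 = (t - 0) * p s"
    using MVT2[of 0 t f p] t d(2) by (metis abs_of_nonneg le_less_trans)
  have "p s > 0" using e(2)[of s] s t \<open>p 0 = 0\<close> by auto
  then have "f t > f 0" using s t by (simp add: algebra_simps)
  then show False using d(2)[of t] t by auto
qed

lemma has_lap_lincomb:
  assumes "has_lap f z a" "has_lap g z b"
  shows "has_lap (\<lambda>w. c * f w + d * g w) z (c * a + d * b)"
proof -
  from assms obtain a1 a2 b1 b2 where
    "has_deriv2 (\<lambda>s. f (z + of_real s)) a1" "has_deriv2 (\<lambda>s. g (z + of_real s)) b1"
    "has_deriv2 (\<lambda>s. f (z + \<i> * of_real s)) a2" "has_deriv2 (\<lambda>s. g (z + \<i> * of_real s)) b2"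
    "a = a1 + a2" "b = b1 + b2"
    unfolding has_lap_def by blast
  then show ?thesis
    unfolding has_lap_def
    by (intro exI[of _ "c * a1 + d * b1"] exI[of _ "c * a2 + d * b2"])
      (simp add: has_deriv2_lincomb distrib_left)
qed

lemma has_lap_cmult: "has_lap f z a \<Longrightarrow> has_lap (\<lambda>w. c * f w) z (c * a)"
  using has_lap_lincomb[of f z a f a c 0] by simp

lemma has_lap_add: "has_lap f z a \<Longrightarrow> has_lap g z b \<Longrightarrow> has_lap (\<lambda>w. f w + g w) z (a + b)"
  using has_lap_lincomb[of f z a g b 1 1] by simp

lemma has_lap_diff: "has_lap f z a \<Longrightarrow> has_lap g z b \<Longrightarrow> has_lap (\<lambda>w. f w - g w) z (a - b)"
  using has_lap_lincomb[of f z a g b 1 "-1"] by simp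

lemma has_lap_cong:
  assumes "has_lap f z a" "\<forall>\<^sub>F w in nhds z. f w = g w"
  shows "has_lap g z a"
proof -
  have "\<forall>\<^sub>F s in nhds 0. f (z + c * of_real s) = g (z + c * of_real s)" for c
    using assms(2) by (rule eventually_compose_filterlim) (auto intro!: tendsto_eq_intros filterlim_ident)
  note ev = this[of 1, simplified] this[of \<i>]
  from assms(1) obtain b c where "has_deriv2 (\<lambda>s. f (z + of_real s)) b"
    "has_deriv2 (\<lambda>s. f (z + \<i> * of_real s)) c" "a = b + c"
    unfolding has_lap_def by blast
  then show ?thesis using ev by (auto intro!: has_lapI intro: has_deriv2_cong)
qed

text \<open>In direction \<open>c\<close> the second derivative is \<open>Im (c * c * f'')\<close>;
  the directions \<open>1\<close> and \<open>\<i>\<close> give opposite values.\<close>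

lemma has_lap_Im:
  assumes "f holomorphic_on S" "open S" "z \<in> S"
  shows "has_lap (\<lambda>w. Im (f w)) z 0"
proof -
  have *: "has_deriv2 (\<lambda>s. Im (f (z + c * of_real s))) (Im (c * c * deriv (deriv f) z))" for c
  proof -
    have ev: "\<forall>\<^sub>F s in nhds (0::real). z + c * of_real s \<in> S"
      using assms by (intro topological_tendstoD[where S = S]) (auto intro!: tendsto_eq_intros filterlim_ident)
    have line: "((\<lambda>s. z + c * of_real s) has_vector_derivative c) (at s)" for s :: real
      by (auto intro!: derivative_eq_intros simp: has_vector_derivative_def scaleR_conv_of_real mult.commute)
    have "\<forall>\<^sub>F s in nhds 0. ((\<lambda>s. Im (f (z + c * of_real s))) has_real_derivative
       Im (c * deriv f (z + c * of_real s))) (at s)"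
      using ev
    proof eventually_elim
      case (elim s)
      have "((f \<circ> (\<lambda>s. z + c * of_real s)) has_vector_derivative
          c * deriv f (z + c * of_real s)) (at s)"
        using holomorphic_derivI[OF assms(1,2) elim] line
        by (intro field_vector_diff_chain_at) auto
      then show ?case by (auto dest: has_field_derivative_Im simp: o_def)
    qed
    moreover have "((\<lambda>s. Im (c * deriv f (z + c * of_real s))) has_real_derivative
       Im (c * c * deriv (deriv f) z)) (at 0)"
    proof -
      have "((\<lambda>w. c * deriv f w) has_field_derivative c * deriv (deriv f) z) (at z)"
        using holomorphic_derivI[OF holomorphic_deriv[OF assms(1,2)] assms(2,3)]
        by (intro DERIV_cmult)
      then have "(((\<lambda>w. c * deriv f w) \<circ> (\<lambda>s. z + c * of_real s)) has_vector_derivative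
          c * (c * deriv (deriv f) z)) (at 0)"
        using line by (intro field_vector_diff_chain_at) auto
      then show ?thesis by (auto dest: has_field_derivative_Im simp: o_def mult.assoc)
    qed
    ultimately show ?thesis
      unfolding has_deriv2_def by (intro exI[of _ "\<lambda>s. Im (c * deriv f (z + c * of_real s))"]) simp
  qed
  show ?thesis
    using has_lapI[of "\<lambda>w. Im (f w)" z, OF *[of 1, simplified] *[of \<i>]] by simp
qed

text \<open>Adding a small multiple of \<open>|w|^2\<close> makes the Laplacian strictly positive,
  which is incompatible with an interior maximum, where both pure second derivatives are at most
  \<open>0\<close>.\<close>

lemma max_principle:
  assumes "bounded S" "open S" "continuous_on (closure S) v"
    and lap: "\<And>z. z \<in> S \<Longrightarrow> \<exists>l\<ge>0. has_lap v z l"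
    and fr: "\<And>z. z \<in> frontier S \<Longrightarrow> v z \<le> 0"
    and "z \<in> closure S"
  shows "v z \<le> 0"
proof (rule ccontr)
  assume "\<not> v z \<le> 0"
  then have vz: "v z > 0" by simp
  obtain D where D: "D > 0" "\<And>w. w \<in> closure S \<Longrightarrow> norm w \<le> D"
    using assms(1) bounded_closure bounded_pos by metis
  \<comment> \<open>So small that the added term stays below \<open>v z\<close> on all of
    \<open>closure S\<close>; hence the perturbed function cannot attain its maximum on the
    frontier.\<close>
  define e where "e = v z / (2 * D\<^sup>2)"
  have e: "e > 0" "e * D\<^sup>2 < v z" using vz D by (auto simp: e_def)
  define ve where "ve = (\<lambda>w. v w + e * ((Re w)\<^sup>2 + (Im w)\<^sup>2))"
  have "continuous_on (closure S) ve"
    unfolding ve_def using assms(3) by (intro continuous_intros)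
  then obtain m where m: "m \<in> closure S" "\<And>w. w \<in> closure S \<Longrightarrow> ve w \<le> ve m"
    using continuous_attains_sup[of "closure S" ve] assms(1,6) by (metis compact_closure empty_iff)
  have "ve z \<ge> v z" using e by (auto simp: ve_def)
  have nm: "(Re m)\<^sup>2 + (Im m)\<^sup>2 \<le> D\<^sup>2"
    using D(2)[OF m(1)] by (metis cmod_power2 norm_ge_zero power_mono)
  have "m \<in> S"
  proof (rule ccontr)
    assume "m \<notin> S"
    then have "v m \<le> 0" using m(1) fr \<open>open S\<close> by (auto simp: frontier_def interior_open)
    then have "ve m \<le> e * D\<^sup>2" using nm e(1) by (auto simp: ve_def intro: order_trans[OF add_mono, of _ 0])
    then show False using m(2)[OF assms(6)] \<open>ve z \<ge> v z\<close> e by linarith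
  qed
  then obtain l where l: "l \<ge> 0" "has_lap v m l" using lap by blast
  have "has_lap (\<lambda>w. (Re w)\<^sup>2 + (Im w)\<^sup>2) m 4"
  proof -
    have "has_deriv2 (\<lambda>s. (Re (m + of_real s))\<^sup>2 + (Im (m + of_real s))\<^sup>2) 2"
      by (rule has_deriv2I[where p = "\<lambda>s. 2 * (Re m + s)"]) (auto intro!: derivative_eq_intros)
    moreover have "has_deriv2 (\<lambda>s. (Re (m + \<i> * of_real s))\<^sup>2 + (Im (m + \<i> * of_real s))\<^sup>2) 2"
      by (rule has_deriv2I[where p = "\<lambda>s. 2 * (Im m + s)"]) (auto intro!: derivative_eq_intros)
    ultimately show ?thesis unfolding has_lap_def by force
  qed
  from has_lap_add[OF l(2) has_lap_cmult[OF this, of e]]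
  have lapm: "has_lap ve m (l + e * 4)" by (simp add: ve_def)
  then obtain a b where ab: "has_deriv2 (\<lambda>s. ve (m + of_real s)) a"
    "has_deriv2 (\<lambda>s. ve (m + \<i> * of_real s)) b" "l + e * 4 = a + b"
    unfolding has_lap_def by blast
  have ev: "\<forall>\<^sub>F s in nhds (0::real). ve (m + c * of_real s) \<le> ve m" for c
  proof -
    have "\<forall>\<^sub>F s in nhds (0::real). m + c * of_real s \<in> S"
      using assms(2) \<open>m \<in> S\<close>
      by (intro topological_tendstoD[where S = S]) (auto intro!: tendsto_eq_intros filterlim_ident)
    then show ?thesis
      by eventually_elim (use m(2) closure_subset in blast)
  qed
  have "a \<le> 0" by (rule has_deriv2_local_max[OF ab(1)]) (use ev[of 1] in simp)
  moreover have "b \<le> 0" by (rule has_deriv2_local_max[OF ab(2)]) (use ev[of \<i>] in simp)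
  ultimately show False using ab(3) l e by linarith
qed

subsection \<open>Harmonic functions on discs and half discs\<close>

text \<open>On the unit circle \<open>z * cnj z = 1\<close>, so a product of a power of
  \<open>z\<close> and a power of \<open>cnj z\<close> collapses to a power of one of them, and the
  real part does not see conjugation. The induction peels off the constant terms of both polynomials
  and cancels one factor \<open>z * cnj z\<close>.\<close>

lemma Re_poly_mult_cnj_on_circle:
  "\<exists>r. \<forall>z. norm z = 1 \<longrightarrow> Re (poly p z * cnj (poly q z)) = Re (poly r z)"
proof (induction q arbitrary: p)
  case 0
  show ?case by (rule exI[of _ 0]) simp
next
  case (pCons c q)
  obtain d p' where p: "p = pCons d p'" by (metis pCons_cases)
  obtain r where r: "\<And>z. norm z = 1 \<Longrightarrow> Re (poly p' z * cnj (poly q z)) = Re (poly r z)"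
    using pCons.IH by blast
  have "Re (poly p z * cnj (poly (pCons c q) z)) =
      Re (poly (smult (cnj c) p + smult (cnj d) (pCons 0 q) + r) z)" if "norm z = 1" for z
  proof -
    have zz: "z * cnj z = 1" using that by (simp add: complex_norm_square[symmetric])
    have "poly p z * cnj (poly (pCons c q) z) = poly p z * cnj c + d * cnj (z * poly q z) +
        (z * cnj z) * (poly p' z * cnj (poly q z))"
      by (simp add: p algebra_simps)
    then have "Re (poly p z * cnj (poly (pCons c q) z)) = Re (poly p z * cnj c) +
        Re (d * cnj (z * poly q z)) + Re (poly r z)"
      using r[OF that] unfolding zz by simp
    moreover have "Re (d * cnj w) = Re (cnj d * w)" for w by simp
    ultimately show ?thesis
      by (simp only: poly_add poly_smult poly_pCons plus_complex.sel add_0 mult.commute[of "cnj c"])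
  qed
  then show ?case by blast
qed

text \<open>From \<open>2 * Re a * Re b = Re (a * b) + Re (a * cnj b)\<close>. Thus real parts of
  complex polynomials form an algebra on the circle.\<close>

lemma Re_poly_mult_Re_poly_on_circle:
  "\<exists>r. \<forall>z. norm z = 1 \<longrightarrow> Re (poly p z) * Re (poly q z) = Re (poly r z)"
proof -
  obtain r where r: "\<And>z. norm z = 1 \<Longrightarrow> Re (poly p z * cnj (poly q z)) = Re (poly r z)"
    using Re_poly_mult_cnj_on_circle by blast
  have "Re (poly p z) * Re (poly q z) = Re (poly (smult (1/2) (p * q + r)) z)" if "norm z = 1" for z
    using r[OF that] by (simp add: field_simps)
  then show ?thesis by blast
qed

lemma real_polynomial_function_on_circle:
  fixes f :: "complex \<Rightarrow> real"
  assumes "real_polynomial_function f"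
  shows "\<exists>p. \<forall>z. norm z = 1 \<longrightarrow> f z = Re (poly p z)"
  using assms
proof induction
  case (linear f)
  interpret bounded_linear f by fact
  \<comment> \<open>A real-linear \<open>f\<close> is the real part of multiplication by
    \<open>f 1 - \<i> * f \<i>\<close>.\<close>
  have "f z = Re (poly [:0, Complex (f 1) (- f \<i>):] z)" for z
  proof -
    have "f z = f (Re z *\<^sub>R 1 + Im z *\<^sub>R \<i>)"
      by (rule arg_cong[of _ _ f]) (simp add: complex_eq_iff)
    also have "\<dots> = Re z * f 1 + Im z * f \<i>"
      by (simp add: add scale)
    finally show ?thesis by simp
  qed
  then show ?case by blast
next
  case (const c)
  show ?case by (rule exI[of _ "[:of_real c:]"]) simp
next
  case (add f g)
  then obtain p q where "\<forall>z. norm z = 1 \<longrightarrow> f z = Re (poly p z)" "\<forall>z. norm z = 1 \<longrightarrow> g z = Re (poly q z)"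
    by blast
  then show ?case by (intro exI[of _ "p + q"]) simp
next
  case (mult f g)
  then show ?case using Re_poly_mult_Re_poly_on_circle by metis
qed

text \<open>This takes the place of the Poisson integral: Stone-Weierstrass supplies a real
  polynomial, which on the circle is the real part of a complex one, and a factor
  \<open>\<i>\<close> turns real into imaginary parts.\<close>

lemma circle_approx_Im_entire:
  fixes v :: "complex \<Rightarrow> real"
  assumes "continuous_on (sphere c r) v" "r > 0" "e > 0"
  shows "\<exists>P. P holomorphic_on UNIV \<and> (\<forall>z\<in>sphere c r. \<bar>Im (P z) - v z\<bar> < e)"
proof -
  have "continuous_on (sphere 0 1) (\<lambda>z. v (c + of_real r * z))"
    by (rule continuous_on_compose2[OF assms(1)])
      (use assms(2) in \<open>auto intro!: continuous_intros simp: dist_norm norm_mult\<close>)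
  then obtain g where g: "real_polynomial_function g"
    "\<And>z. z \<in> sphere 0 1 \<Longrightarrow> \<bar>v (c + of_real r * z) - g z\<bar> < e"
    using Stone_Weierstrass_real_polynomial_function[OF compact_sphere _ assms(3)] by blast
  obtain p where p: "\<And>z. norm z = 1 \<Longrightarrow> g z = Re (poly p z)"
    using real_polynomial_function_on_circle[OF g(1)] by blast
  define P where "P = (\<lambda>z. \<i> * poly p ((z - c) / of_real r))"
  have "P holomorphic_on UNIV"
    unfolding P_def using assms(2) by (intro holomorphic_intros) auto
  moreover have "\<bar>Im (P z) - v z\<bar> < e" if "z \<in> sphere c r" for z
  proof -
    have "norm ((z - c) / of_real r) = 1"
      using that assms(2) by (simp add: norm_divide dist_norm norm_minus_commute)
    then show ?thesis
      using g(2)[of "(z - c) / of_real r"] p[of "(z - c) / of_real r"] assms(2)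
      by (simp add: P_def abs_minus_commute)
  qed
  ultimately show ?thesis by blast
qed

text \<open>Cauchy's inequality for $\exp(-\mathrm{i} f/M)$, whose modulus lies between $e^{-1}$ and $e$.\<close>

lemma deriv_bound_Im:
  assumes f: "f holomorphic_on ball z \<rho>" and "\<rho> > 0" "M > 0"
    and M: "\<And>w. w \<in> ball z \<rho> \<Longrightarrow> \<bar>Im (f w)\<bar> \<le> M"
  shows "norm (deriv f z) \<le> 18 * M / \<rho>"
proof -
  define E where "E = (\<lambda>w. exp (- \<i> * f w / of_real M))"
  have E: "E holomorphic_on ball z \<rho>"
    unfolding E_def using f \<open>M > 0\<close> by (intro holomorphic_intros) auto
  have nE: "norm (E w) = exp (Im (f w) / M)" for w
    by (simp add: E_def norm_exp_eq_Re)
  \<comment> \<open>The half radius costs a factor \<open>2\<close>, and the upper and lower bounds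
    of \<open>norm E\<close> cost a factor \<open>exp 1\<close> each;
    \<open>2 * (exp 1)^2 \<le> 18\<close> is the constant of the lemma.\<close>
  have "norm ((deriv ^^ 1) E z) \<le> fact 1 * exp 1 / (\<rho> / 2) ^ 1"
  proof (rule Cauchy_inequality)
    show "E holomorphic_on ball z (\<rho> / 2)"
      using E \<open>\<rho> > 0\<close> by (auto elim!: holomorphic_on_subset)
    show "continuous_on (cball z (\<rho> / 2)) E"
      using E \<open>\<rho> > 0\<close> by (auto intro!: holomorphic_on_imp_continuous_on elim!: holomorphic_on_subset)
    show "norm (E w) \<le> exp 1" if "norm (z - w) = \<rho> / 2" for w
    proof -
      have "w \<in> ball z \<rho>" using that \<open>\<rho> > 0\<close> by (simp add: dist_norm)
      from M[OF this] show ?thesis using \<open>M > 0\<close> unfolding nE by (simp add: divide_simps)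
    qed
  qed (use \<open>\<rho> > 0\<close> in auto)
  then have 1: "norm (deriv E z) \<le> 2 * exp 1 / \<rho>" by (simp add: mult.commute)
  have z: "z \<in> ball z \<rho>" using \<open>\<rho> > 0\<close> by simp
  have "(E has_field_derivative E z * (- \<i> * deriv f z / of_real M)) (at z)"
    unfolding E_def using holomorphic_derivI[OF f _ z] \<open>M > 0\<close>
    by (auto intro!: derivative_eq_intros)
  then have "deriv E z = E z * (- \<i> * deriv f z / of_real M)" by (rule DERIV_imp_deriv)
  then have 2: "norm (deriv E z) = norm (E z) * norm (deriv f z) / M"
    using \<open>M > 0\<close> by (simp add: norm_mult norm_divide)
  have 3: "norm (E z) \<ge> exp (-1)"
    using M[OF z] \<open>M > 0\<close> unfolding nE by (simp add: divide_simps)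
  have "exp (-1) * norm (deriv f z) / M \<le> norm (deriv E z)"
    unfolding 2 using 3 \<open>M > 0\<close> by (intro divide_right_mono mult_right_mono) auto
  with 1 have "exp (-1) * norm (deriv f z) / M \<le> 2 * exp 1 / \<rho>" by linarith
  then have "norm (deriv f z) \<le> 2 * (exp 1)\<^sup>2 * M / \<rho>"
    using \<open>M > 0\<close> \<open>\<rho> > 0\<close> by (simp add: exp_minus field_simps power2_eq_square)
  moreover have "(exp 1)\<^sup>2 \<le> (9::real)"
    using power_mono[OF exp_le, of 2] by simp
  ultimately show ?thesis
    using \<open>M > 0\<close> \<open>\<rho> > 0\<close> mult_right_mono[of "(exp 1)\<^sup>2" 9 "2 * M / \<rho>"]
    by (simp add: mult_ac)
qed

text \<open>Uniform closeness of the imaginary parts bounds the derivatives of the differences on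
  smaller discs. Integrating from the centre then controls the real parts too, so the normalised
  sequence is uniformly Cauchy on each smaller disc.\<close>

lemma Im_holomorphic_limit:
  fixes P :: "nat \<Rightarrow> complex \<Rightarrow> complex"
  assumes P: "\<And>n. P n holomorphic_on ball c r" and "r > 0"
    and v: "\<And>n z. z \<in> ball c r \<Longrightarrow> \<bar>Im (P n z) - v z\<bar> \<le> inverse (Suc n)"
  shows "\<exists>f. f holomorphic_on ball c r \<and> (\<forall>z\<in>ball c r. Im (f z) = v z)"
proof -
  \<comment> \<open>The imaginary part determines a holomorphic function only up to a real constant;
    fixing the real part at \<open>c\<close> removes this freedom.\<close>
  define q where "q = (\<lambda>n z. P n z - of_real (Re (P n c)))"
  have qh: "q n holomorphic_on ball c r" for n
    unfolding q_def using P by (intro holomorphic_intros)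
  have dq: "deriv (\<lambda>w. q m w - q n w) z = deriv (\<lambda>w. P m w - P n w) z" for m n z
  proof -
    have "(\<lambda>w. q m w - q n w) = (\<lambda>w. (P m w - P n w) - of_real (Re (P m c) - Re (P n c)))"
      by (auto simp: q_def)
    then show ?thesis
      by (simp add: deriv_def has_field_derivative_iff algebra_simps)
  qed
  \<comment> \<open>The term \<open>2\<close> bounds the difference at the centre. The other one is
    the derivative bound \<open>18 * 2 / (r - s)\<close>, valid because discs of radius
    \<open>r - s\<close> around points of \<open>cball c s\<close> stay in the domain, times the
    distance \<open>s\<close>.\<close>
  have diff: "norm (q m z - q n z) \<le> (2 + 36 * s / (r - s)) * inverse (Suc N)"
    if "N \<le> m" "N \<le> n" "0 < s" "s < r" "z \<in> cball c s" for m n N s z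
  proof -
    let ?M = "2 * inverse (real (Suc N))"
    have le: "inverse (real (Suc m)) \<le> inverse (real (Suc N))" "inverse (real (Suc n)) \<le> inverse (real (Suc N))"
      using that by auto
    have im: "\<bar>Im (P m w - P n w)\<bar> \<le> ?M" if "w \<in> ball c r" for w
      unfolding minus_complex.sel
      using v[OF that, of m] v[OF that, of n] le by linarith
    have hol: "(\<lambda>w. q m w - q n w) holomorphic_on ball c r"
      using qh by (intro holomorphic_intros)
    have "norm ((q m z - q n z) - (q m c - q n c)) \<le> (18 * ?M / (r - s)) * norm (z - c)"
    proof (rule field_differentiable_bound[of "cball c s"])
      fix w assume w: "w \<in> cball c s"
      then have wb: "w \<in> ball c r" using that by auto
      show "((\<lambda>w. q m w - q n w) has_field_derivative deriv (\<lambda>w. q m w - q n w) w) (at w within cball c s)"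
        using holomorphic_derivI[OF hol open_ball wb] has_field_derivative_at_within by blast
      have sub: "ball w (r - s) \<subseteq> ball c r"
      proof
        fix x assume "x \<in> ball w (r - s)"
        then show "x \<in> ball c r" using w dist_triangle[of c x w] by simp
      qed
      have "(\<lambda>w. P m w - P n w) holomorphic_on ball w (r - s)"
        using holomorphic_on_subset[OF _ sub] P by (intro holomorphic_intros) auto
      then have "norm (deriv (\<lambda>w. P m w - P n w) w) \<le> 18 * ?M / (r - s)"
        by (rule deriv_bound_Im) (use that im sub in \<open>simp_all add: subset_iff del: of_nat_Suc\<close>)
      then show "norm (deriv (\<lambda>w. q m w - q n w) w) \<le> 18 * ?M / (r - s)" by (simp add: dq)
    qed (use that in auto)
    also have "\<dots> \<le> (18 * ?M / (r - s)) * s"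
      using that by (intro mult_left_mono) (auto simp: dist_norm norm_minus_commute)
    finally have 1: "norm ((q m z - q n z) - (q m c - q n c)) \<le> (18 * ?M / (r - s)) * s" .
    have "q m c - q n c = \<i> * of_real (Im (P m c - P n c))"
      by (simp add: q_def complex_eq_iff)
    then have "norm (q m c - q n c) = \<bar>Im (P m c - P n c)\<bar>"
      by (metis norm_ii norm_mult norm_of_real mult_1)
    also have "\<dots> \<le> ?M" using im \<open>r > 0\<close> by simp
    finally have 2: "norm (q m c - q n c) \<le> ?M" .
    have "norm (q m z - q n z) \<le> norm ((q m z - q n z) - (q m c - q n c)) + norm (q m c - q n c)"
      by (metis norm_triangle_ineq diff_add_cancel)
    also have "\<dots> \<le> (18 * ?M / (r - s)) * s + ?M" using 1 2 by linarith
    also have "\<dots> = (2 + 36 * s / (r - s)) * inverse (Suc N)"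
      by (simp add: distrib_right del: of_nat_Suc)
    finally show ?thesis .
  qed
  have conv: "uniformly_convergent_on (cball c s) q" if s: "0 < s" "s < r" for s
  proof (rule Cauchy_uniformly_convergent, rule uniformly_Cauchy_onI)
    fix e :: real assume "e > 0"
    let ?K = "2 + 36 * s / (r - s)"
    have K: "?K > 0" using s by (simp add: add_pos_nonneg)
    obtain N where N: "inverse (real (Suc N)) < e / ?K"
      using reals_Archimedean[of "e / ?K"] \<open>e > 0\<close> K by auto
    have "dist (q m z) (q n z) < e" if "z \<in> cball c s" "m \<ge> N" "n \<ge> N" for z m n
    proof -
      have "norm (q m z - q n z) \<le> ?K * inverse (Suc N)" by (rule diff[OF that(2,3) s that(1)])
      also have "\<dots> < e" using N K by (simp add: pos_less_divide_eq mult.commute)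
      finally show ?thesis by (simp add: dist_norm)
    qed
    then show "\<exists>N. \<forall>x\<in>cball c s. \<forall>m\<ge>N. \<forall>n\<ge>N. dist (q m x) (q n x) < e" by blast
  qed
  define f where "f = (\<lambda>z. lim (\<lambda>n. q n z))"
  have ul: "uniform_limit (cball c s) q f sequentially" if s: "0 < s" "s < r" for s
    using conv[OF s] unfolding f_def by (simp add: uniformly_convergent_uniform_limit_iff)
  have "f holomorphic_on ball c r"
  proof (rule holomorphic_uniform_sequence[OF open_ball qh])
    fix x assume x: "x \<in> ball c r"
    define s where "s = (dist c x + r) / 2"
    have s: "0 < s" "s < r" "dist c x < s" using x \<open>r > 0\<close> by (auto simp: s_def add_nonneg_pos)
    have sub: "cball x (s - dist c x) \<subseteq> cball c s"
    proof
      fix y assume "y \<in> cball x (s - dist c x)"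
      then show "y \<in> cball c s" using dist_triangle[of c y x] by simp
    qed
    show "\<exists>d>0. cball x d \<subseteq> ball c r \<and> uniform_limit (cball x d) q f sequentially"
      using s sub uniform_limit_on_subset[OF ul[OF s(1,2)] sub]
      by (intro exI[of _ "s - dist c x"]) auto
  qed
  moreover have "Im (f z) = v z" if z: "z \<in> ball c r" for z
  proof -
    define s where "s = (dist c z + r) / 2"
    have s: "0 < s" "s < r" "z \<in> cball c s" using z \<open>r > 0\<close> by (auto simp: s_def add_nonneg_pos)
    have "(\<lambda>n. q n z) \<longlonglongrightarrow> f z" using tendsto_uniform_limitI[OF ul[OF s(1,2)] s(3)] .
    from tendsto_Im[OF this] have 1: "(\<lambda>n. Im (P n z)) \<longlonglongrightarrow> Im (f z)" by (simp add: q_def)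
    have "(\<lambda>n. Im (P n z) - v z) \<longlonglongrightarrow> 0"
      by (rule Lim_null_comparison[OF _ LIMSEQ_inverse_real_of_nat])
        (use v[OF z] in \<open>auto intro!: always_eventually\<close>)
    then have "(\<lambda>n. Im (P n z)) \<longlonglongrightarrow> v z" by (simp add: LIM_zero_iff)
    with 1 show ?thesis using LIMSEQ_unique by blast
  qed
  ultimately show ?thesis by blast
qed

text \<open>The maximum principle for \<open>Im P - v - e\<close> and
  \<open>v - Im P - e\<close>.\<close>

lemma harmonic_approx_by_boundary:
  fixes S :: "complex set"
  assumes "bounded S" "open S" "continuous_on (closure S) v"
    and "\<And>z. z \<in> S \<Longrightarrow> has_lap v z 0"
    and P: "P holomorphic_on UNIV"
    and fr: "\<And>z. z \<in> frontier S \<Longrightarrow> \<bar>Im (P z) - v z\<bar> \<le> e"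
    and z: "z \<in> closure S"
  shows "\<bar>Im (P z) - v z\<bar> \<le> e"
proof -
  have cP: "continuous_on (closure S) P"
    using P by (meson holomorphic_on_imp_continuous_on continuous_on_subset subset_UNIV)
  have lP: "has_lap (\<lambda>w. Im (P w)) w 0" for w
    using has_lap_Im[OF P] by simp
  have c: "has_lap (\<lambda>w. e) w 0" for w
    by (rule has_lapI[where a=0 and b=0, simplified]; rule has_deriv2I[where p = "\<lambda>_. 0"]) auto
  have "Im (P z) - v z - e \<le> 0"
    by (rule max_principle[OF assms(1,2) _ _ _ z])
      (use assms(3,4) fr cP has_lap_diff[OF has_lap_diff[OF lP] c] in
        \<open>force intro!: continuous_intros simp: abs_le_iff\<close>)+
  moreover have "v z - Im (P z) - e \<le> 0"
    by (rule max_principle[OF assms(1,2) _ _ _ z])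
      (use assms(3,4) fr cP has_lap_diff[OF has_lap_diff[OF _ lP] c] in
        \<open>force intro!: continuous_intros simp: abs_le_iff\<close>)+
  ultimately show ?thesis by linarith
qed

text \<open>Weyl's lemma in pointwise form: from a vanishing \<open>has_lap\<close> and continuity
  alone, \<open>v\<close> becomes smooth. The boundary values are approximated, and the maximum
  principle carries the approximation inside.\<close>

lemma harmonic_disc_Im_holomorphic:
  assumes "continuous_on (cball c r) v" "r > 0" "\<And>z. z \<in> ball c r \<Longrightarrow> has_lap v z 0"
  shows "\<exists>f. f holomorphic_on ball c r \<and> (\<forall>z\<in>ball c r. Im (f z) = v z)"
proof -
  have "\<exists>P. P holomorphic_on UNIV \<and> (\<forall>z\<in>sphere c r. \<bar>Im (P z) - v z\<bar> < inverse (Suc n))" for n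
    by (intro circle_approx_Im_entire continuous_on_subset[OF assms(1)]) (use assms(2) in auto)
  then obtain P where P: "\<And>n. P n holomorphic_on UNIV"
    "\<And>n z. z \<in> sphere c r \<Longrightarrow> \<bar>Im (P n z) - v z\<bar> < inverse (Suc n)" by metis
  show ?thesis
  proof (rule Im_holomorphic_limit[OF _ assms(2)])
    show "P n holomorphic_on ball c r" for n using P(1) holomorphic_on_subset by blast
    show "\<bar>Im (P n z) - v z\<bar> \<le> inverse (Suc n)" if z: "z \<in> ball c r" for n z
    proof (rule harmonic_approx_by_boundary[OF bounded_ball open_ball _ _ P(1)])
      show "\<bar>Im (P n w) - v w\<bar> \<le> inverse (Suc n)" if "w \<in> frontier (ball c r)" for w
        using P(2)[of w n] that assms(2) by simp
    qed (use assms z in auto)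
  qed
qed

text \<open>Schwarz reflection. The odd extension \<open>V\<close> is not known to be harmonic
  across the diameter, so the disc lemma does not apply to it. Instead the approximants are made odd
  and vanish exactly on the diameter, so the maximum principle works on the upper half disc alone;
  oddness copies the estimate to the lower half.\<close>

lemma harmonic_half_disc_Im_holomorphic:
  fixes c r :: real
  defines "B \<equiv> {z \<in> ball (of_real c) r. Im z > 0}"
  assumes cont: "continuous_on {z \<in> cball (of_real c) r. Im z \<ge> 0} v" and "r > 0"
    and lap: "\<And>z. z \<in> B \<Longrightarrow> has_lap v z 0"
    and flat: "\<And>x. \<bar>x - c\<bar> \<le> r \<Longrightarrow> v (of_real x) = 0"
  shows "\<exists>f. f holomorphic_on ball (of_real c) r \<and>
    (\<forall>z\<in>ball (of_real c) r. Im z \<ge> 0 \<longrightarrow> Im (f z) = v z) \<and>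
    (\<forall>z\<in>ball (of_real c) r. Im z \<le> 0 \<longrightarrow> Im (f z) = - v (cnj z))"
proof -
  define V where "V = (\<lambda>z. if Im z \<ge> 0 then v z else - v (cnj z))"
  have nc: "norm (cnj z - of_real c) = norm (z - of_real c)" for z
    by (metis complex_cnj_complex_of_real complex_cnj_diff complex_mod_cnj)
  have v0: "v z = 0" if "Im z = 0" "norm (z - of_real c) \<le> r" for z
  proof -
    have "z = of_real (Re z)" using that by (simp add: complex_eq_iff)
    then have "\<bar>Re z - c\<bar> \<le> r" using that(2) by (metis norm_of_real of_real_diff)
    with flat[OF this] \<open>z = of_real (Re z)\<close> show ?thesis by simp
  qed
  have contV: "continuous_on (cball (of_real c) r) V"
  proof -
    have "continuous_on ({z \<in> cball (of_real c) r. Im z \<ge> 0} \<union> {z \<in> cball (of_real c) r. Im z \<le> 0}) V"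
      unfolding V_def
    proof (rule continuous_on_cases)
      show "closed {z \<in> cball (of_real c) r. Im z \<ge> 0}" "closed {z \<in> cball (of_real c) r. Im z \<le> 0}"
        by (auto intro!: closed_Collect_conj closed_Collect_le continuous_intros simp: closed_cball[unfolded cball_def] cball_def)
      show "continuous_on {z \<in> cball (of_real c) r. Im z \<ge> 0} v" by (fact cont)
      show "continuous_on {z \<in> cball (of_real c) r. Im z \<le> 0} (\<lambda>z. - v (cnj z))"
        by (intro continuous_intros continuous_on_compose2[OF cont])
          (auto simp: dist_norm norm_minus_commute[of "of_real c"] nc)
    qed (use v0 in \<open>auto simp: dist_norm norm_minus_commute nc complex_eq_iff\<close>)
    moreover have "{z \<in> cball (of_real c) r. Im z \<ge> 0} \<union> {z \<in> cball (of_real c) r. Im z \<le> 0} = cball (of_real c) r"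
      by auto
    ultimately show ?thesis by simp
  qed
  have Vodd: "V (cnj z) = - V z" if "norm (z - of_real c) \<le> r" for z
    using v0[OF _ that] that v0[of "cnj z"] by (auto simp: V_def nc)
  have "\<exists>P. P holomorphic_on UNIV \<and> (\<forall>z\<in>sphere (of_real c) r. \<bar>Im (P z) - V z\<bar> < inverse (Suc n))" for n
    by (intro circle_approx_Im_entire continuous_on_subset[OF contV]) (use assms(3) in auto)
  then obtain P0 where P0: "\<And>n. P0 n holomorphic_on UNIV"
    "\<And>n z. z \<in> sphere (of_real c) r \<Longrightarrow> \<bar>Im (P0 n z) - V z\<bar> < inverse (Suc n)" by metis
  \<comment> \<open>Averaging with the conjugate reflection makes the imaginary part odd under
    \<open>cnj\<close>, without loss of accuracy because \<open>V\<close> is odd.\<close>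
  define P where "P = (\<lambda>n z. (P0 n z + (cnj \<circ> P0 n \<circ> cnj) z) / 2)"
  have P: "P n holomorphic_on UNIV" for n
    unfolding P_def
    by (intro holomorphic_intros P0(1) holomorphic_on_compose_cnj_cnj
        holomorphic_on_subset[OF P0(1)]) auto
  have ImP: "Im (P n z) = (Im (P0 n z) - Im (P0 n (cnj z))) / 2" for n z
    by (simp add: P_def)
  have Podd: "Im (P n (cnj z)) = - Im (P n z)" for n z by (simp add: ImP field_simps)
  have Psphere: "\<bar>Im (P n z) - V z\<bar> \<le> inverse (Suc n)" if "z \<in> sphere (of_real c) r" for n z
  proof -
    have cz: "cnj z \<in> sphere (of_real c) r" using that by (simp add: dist_norm norm_minus_commute nc)
    have "V (cnj z) = - V z" by (rule Vodd) (use that in \<open>simp add: dist_norm norm_minus_commute\<close>)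
    then have "\<bar>Im (P0 n z) - V z\<bar> < inverse (Suc n)" "\<bar>Im (P0 n (cnj z)) + V z\<bar> < inverse (Suc n)"
      using P0(2)[OF that, of n] P0(2)[OF cz, of n] by simp_all
    moreover have "\<bar>(a - b) / 2 - v\<bar> \<le> e" if "\<bar>a - v\<bar> < e" "\<bar>b + v\<bar> < e" for a b v e :: real
    proof -
      have "(a - b) / 2 - v = ((a - v) - (b + v)) / 2" by (simp add: field_simps)
      also have "\<bar>\<dots>\<bar> = \<bar>(a - v) - (b + v)\<bar> / 2" by simp
      also have "\<dots> \<le> (\<bar>a - v\<bar> + \<bar>b + v\<bar>) / 2"
        by (intro divide_right_mono abs_triangle_ineq4) simp
      also have "\<dots> \<le> e" using that by simp
      finally show ?thesis .
    qed
    ultimately show ?thesis unfolding ImP by blast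
  qed
  have bB: "bounded B" unfolding B_def by (rule bounded_subset[OF bounded_ball]) auto
  have oB: "open B" unfolding B_def
    by (intro open_Collect_conj open_Collect_less continuous_intros) (auto simp: open_ball[unfolded ball_def] ball_def)
  have clB: "closure B \<subseteq> {z \<in> cball (of_real c) r. Im z \<ge> 0}"
    by (rule closure_minimal)
      (auto simp: B_def cball_def intro!: closed_Collect_conj closed_Collect_le continuous_intros)
  have upper: "\<bar>Im (P n z) - V z\<bar> \<le> inverse (Suc n)" if "z \<in> closure B" for n z
  proof (rule harmonic_approx_by_boundary[OF bB oB _ _ P _ that])
    show "continuous_on (closure B) V" using continuous_on_subset[OF contV] clB by blast
    show "has_lap V w 0" if "w \<in> B" for w
    proof (rule has_lap_cong[OF lap[OF that]])
      show "\<forall>\<^sub>F w in nhds w. v w = V w"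
        using eventually_nhds_in_open[OF oB that] by eventually_elim (auto simp: V_def B_def)
    qed
    show "\<bar>Im (P n w) - V w\<bar> \<le> inverse (Suc n)" if "w \<in> frontier B" for w
    proof -
      have w: "w \<in> cball (of_real c) r" "Im w \<ge> 0" "w \<notin> B"
        using that clB oB by (auto simp: frontier_def interior_open)
      show ?thesis
      proof (cases "Im w = 0")
        case True
        have "cnj w = w" using True by (simp add: complex_eq_iff)
        then have "Im (P n w) = 0" "V w = 0"
          using Podd[of n w] Vodd[of w] w(1) by (auto simp: dist_norm norm_minus_commute)
        then show ?thesis by simp
      next
        case False
        then have "w \<in> sphere (of_real c) r" using w by (auto simp: B_def)
        then show ?thesis by (rule Psphere)
      qed
    qed
  qed
  have all: "\<bar>Im (P n z) - V z\<bar> \<le> inverse (Suc n)" if z: "z \<in> ball (of_real c) r" for n z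
  proof -
    consider "Im z > 0" | "Im z = 0" | "Im z < 0" by linarith
    then show ?thesis
    proof cases
      case 1
      then have "z \<in> closure B" using z closure_subset[of B] by (auto simp: B_def)
      then show ?thesis by (rule upper)
    next
      case 2
      have "cnj z = z" using 2 by (simp add: complex_eq_iff)
      then have "Im (P n z) = 0" "V z = 0"
        using Podd[of n z] Vodd[of z] z by (auto simp: dist_norm norm_minus_commute)
      then show ?thesis by simp
    next
      case 3
      then have "cnj z \<in> closure B"
        using z closure_subset[of B] by (auto simp: B_def dist_norm norm_minus_commute nc)
      from upper[OF this, of n] show ?thesis
        using Podd[of n z] Vodd[of z] z by (auto simp: dist_norm norm_minus_commute)
    qed
  qed
  obtain f where f: "f holomorphic_on ball (of_real c) r" "\<And>z. z \<in> ball (of_real c) r \<Longrightarrow> Im (f z) = V z"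
    using Im_holomorphic_limit[of P "of_real c" r V] all P \<open>r > 0\<close> holomorphic_on_subset by blast
  have "Im (f z) = - v (cnj z)" if "z \<in> ball (of_real c) r" "Im z \<le> 0" for z
    using f(2)[OF that(1)] that v0[of z] v0[of "cnj z"]
    by (auto simp: V_def dist_norm norm_minus_commute nc)
  with f show ?thesis by (intro exI[of _ f]) (auto simp: V_def)
qed

subsection \<open>The torsion function in an orthonormal frame\<close>

definition frame :: "'a::real_vector \<Rightarrow> 'a \<Rightarrow> 'a \<Rightarrow> complex \<Rightarrow> 'a" where
  "frame P d e z = P + Re z *\<^sub>R d + Im z *\<^sub>R e"

lemma grad_inner:
  fixes u :: "'a::euclidean_space \<Rightarrow> real"
  assumes "u differentiable (at x)"
  shows "(u has_derivative (\<lambda>v. grad u x \<bullet> v)) (at x)"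
proof -
  have D: "(u has_derivative frechet_derivative u (at x)) (at x)"
    using assms by (simp add: frechet_derivative_works)
  interpret bounded_linear "frechet_derivative u (at x)"
    using D by (rule has_derivative_bounded_linear)
  have "frechet_derivative u (at x) v = grad u x \<bullet> v" for v
  proof -
    have "frechet_derivative u (at x) v = frechet_derivative u (at x) (\<Sum>b\<in>Basis. (v \<bullet> b) *\<^sub>R b)"
      by (simp add: euclidean_representation)
    also have "\<dots> = grad u x \<bullet> v"
      by (simp add: sum scale grad_def partial_def inner_sum_left inner_commute[of v] mult.commute)
    finally show ?thesis .
  qed
  then have "frechet_derivative u (at x) = (\<lambda>v. grad u x \<bullet> v)" by blast
  with D show ?thesis by simp
qed

lemma has_derivative_along_line:
  fixes u :: "'a::euclidean_space \<Rightarrow> real"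
  assumes "u differentiable (at (x + s *\<^sub>R d))"
  shows "((\<lambda>s. u (x + s *\<^sub>R d)) has_real_derivative grad u (x + s *\<^sub>R d) \<bullet> d) (at s)"
proof -
  have "((\<lambda>s. x + s *\<^sub>R d) has_derivative (\<lambda>t. t *\<^sub>R d)) (at s)"
    by (auto intro!: derivative_eq_intros)
  from diff_chain_at[OF this grad_inner[OF assms]]
  have "((\<lambda>s. u (x + s *\<^sub>R d)) has_derivative (\<lambda>t. t * (grad u (x + s *\<^sub>R d) \<bullet> d))) (at s)"
    by (simp add: o_def)
  moreover have "(\<lambda>t. t * (grad u (x + s *\<^sub>R d) \<bullet> d)) = (*) (grad u (x + s *\<^sub>R d) \<bullet> d)"
    by (simp add: fun_eq_iff)
  ultimately show ?thesis by (simp add: has_field_derivative_def)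
qed

lemma C2_on_differentiable:
  assumes "C2_on S u" "open S" "x \<in> S"
  shows "u differentiable (at x)" "b \<in> Basis \<Longrightarrow> partial b u differentiable (at x)"
  using assms by (auto simp: C2_on_def differentiable_on_eq_differentiable_at)

lemma C2_on_has_deriv2_line:
  fixes u :: "'a::euclidean_space \<Rightarrow> real"
  assumes "C2_on S u" "open S" "x \<in> S"
  shows "has_deriv2 (\<lambda>s. u (x + s *\<^sub>R d))
    (\<Sum>b\<in>Basis. \<Sum>c\<in>Basis. partial c (partial b u) x * (b \<bullet> d) * (c \<bullet> d))"
proof -
  have ev: "\<forall>\<^sub>F s in nhds (0::real). x + s *\<^sub>R d \<in> S"
    using assms(2,3) by (intro topological_tendstoD[where S = S])
      (auto intro!: tendsto_eq_intros filterlim_ident)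
  have "\<forall>\<^sub>F s in nhds 0. ((\<lambda>s. u (x + s *\<^sub>R d)) has_real_derivative
      (\<Sum>b\<in>Basis. partial b u (x + s *\<^sub>R d) * (b \<bullet> d))) (at s)"
    using ev
  proof eventually_elim
    case (elim s)
    then show ?case
      using has_derivative_along_line[OF C2_on_differentiable(1)[OF assms(1,2)]]
      by (simp add: grad_def inner_sum_left)
  qed
  moreover have "((\<lambda>s. \<Sum>b\<in>Basis. partial b u (x + s *\<^sub>R d) * (b \<bullet> d)) has_real_derivative
      (\<Sum>b\<in>Basis. \<Sum>c\<in>Basis. partial c (partial b u) x * (b \<bullet> d) * (c \<bullet> d))) (at 0)"
  proof (rule DERIV_sum)
    fix b :: 'a assume b: "b \<in> Basis"
    have "((\<lambda>s. partial b u (x + s *\<^sub>R d)) has_real_derivative grad (partial b u) x \<bullet> d) (at 0)"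
      using has_derivative_along_line[of "partial b u" x 0 d] C2_on_differentiable(2)[OF assms b] by simp
    from DERIV_cmult_right[OF this, of "b \<bullet> d"]
    show "((\<lambda>s. partial b u (x + s *\<^sub>R d) * (b \<bullet> d)) has_real_derivative
      (\<Sum>c\<in>Basis. partial c (partial b u) x * (b \<bullet> d) * (c \<bullet> d))) (at 0)"
      by (simp add: grad_def inner_sum_left sum_distrib_right sum_distrib_left mult_ac)
  qed
  ultimately show ?thesis
    unfolding has_deriv2_def by (intro exI conjI)
qed

lemma Im_holomorphic_line_deriv:
  assumes "f holomorphic_on A" "open A" "z \<in> A"
  shows "((\<lambda>s. Im (f (z + c * of_real s))) has_real_derivative Im (c * deriv f z)) (at 0)"
proof -
  have "((\<lambda>s::real. z + c * of_real s) has_vector_derivative c) (at 0)"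
    by (auto intro!: derivative_eq_intros simp: has_vector_derivative_def scaleR_conv_of_real mult.commute)
  then have "((f \<circ> (\<lambda>s. z + c * of_real s)) has_vector_derivative c * deriv f z) (at 0)"
    using holomorphic_derivI[OF assms] by (intro field_vector_diff_chain_at) auto
  then show ?thesis by (auto dest: has_field_derivative_Im simp: o_def)
qed

section \<open>Orthonormal coordinates and the passage from \<open>u\<close> to a holomorphic
  function\<close>

locale orthonormal_frame =
  fixes d e :: "real^2"
  assumes dd: "d \<bullet> d = 1" and ee: "e \<bullet> e = 1" and de: "d \<bullet> e = 0"
begin

lemma norms [simp]: "norm d = 1" "norm e = 1"
  using dd ee by (simp_all add: norm_eq_sqrt_inner)

lemma expand: "v = (v \<bullet> d) *\<^sub>R d + (v \<bullet> e) *\<^sub>R e"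
proof -
  have ne: "d \<noteq> e" using dd de by auto
  have po: "pairwise orthogonal {d, e}"
    using de by (auto simp: pairwise_def orthogonal_def inner_commute)
  have "independent {d, e}"
    using po dd ee by (intro pairwise_orthogonal_independent) auto
  then have "span {d, e} = UNIV"
    using ne by (intro card_ge_dim_independent[of _ UNIV, simplified, THEN antisym[OF subset_UNIV]]) auto
  then have "(\<Sum>b\<in>{d, e}. (v \<bullet> b) *\<^sub>R b) = v"
    using po by (intro orthonormal_basis_expand) auto
  then show ?thesis using ne by (simp add: inner_commute)
qed

lemma inner_expand: "(v \<bullet> d) * (w \<bullet> d) + (v \<bullet> e) * (w \<bullet> e) = v \<bullet> w"
proof -
  have "v \<bullet> w = ((v \<bullet> d) *\<^sub>R d + (v \<bullet> e) *\<^sub>R e) \<bullet> w" using expand[of v] by simp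
  then show ?thesis by (simp add: inner_left_distrib inner_commute[of w])
qed

lemma norm_sq_expand: "(norm v)\<^sup>2 = (v \<bullet> d)\<^sup>2 + (v \<bullet> e)\<^sup>2"
  using inner_expand[of v v] by (simp only: power2_norm_eq_inner) (simp add: power2_eq_square)

lemma frame_coords [simp]:
  "(frame P d e z - P) \<bullet> d = Re z" "(frame P d e z - P) \<bullet> e = Im z"
  using dd ee de by (simp_all add: frame_def inner_left_distrib inner_commute[of e d])

lemma frame_inverse: "frame P d e (Complex ((x - P) \<bullet> d) ((x - P) \<bullet> e)) = x"
  using expand[of "x - P"] by (simp add: frame_def algebra_simps)

lemma dist_frame: "dist (frame P d e z) (frame P d e w) = dist z w"
proof -
  have "frame P d e z - frame P d e w = Re (z - w) *\<^sub>R d + Im (z - w) *\<^sub>R e"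
    by (simp add: frame_def algebra_simps)
  then have "(norm (frame P d e z - frame P d e w))\<^sup>2 = (norm (z - w))\<^sup>2"
    using dd ee de
    by (simp only: norm_sq_expand inner_left_distrib inner_scaleR_left cmod_power2) (simp add: inner_commute)
  then show ?thesis by (simp add: dist_norm)
qed

lemma continuous_frame [continuous_intros]: "continuous_on A (frame P d e)"
  unfolding frame_def by (intro continuous_intros)

text \<open>Rotation invariance of the Laplacian: adding the Hessian forms on \<open>d\<close> and
  \<open>e\<close> gives the trace, since \<open>(b \<bullet> d) * (c \<bullet> d) + (b \<bullet> e)
  * (c \<bullet> e) = b \<bullet> c\<close>.\<close>

lemma has_lap_frame:
  assumes "C2_on S u" "open S" "frame P d e z \<in> S"
  shows "has_lap (\<lambda>w. u (frame P d e w)) z (laplacian u (frame P d e z))"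
proof -
  let ?x = "frame P d e z"
  let ?H = "\<lambda>b c. partial c (partial b u) ?x"
  have "has_lap (\<lambda>w. u (frame P d e w)) z
     ((\<Sum>b\<in>Basis. \<Sum>c\<in>Basis. ?H b c * (b \<bullet> d) * (c \<bullet> d)) + (\<Sum>b\<in>Basis. \<Sum>c\<in>Basis. ?H b c * (b \<bullet> e) * (c \<bullet> e)))"
    using C2_on_has_deriv2_line[OF assms, of d] C2_on_has_deriv2_line[OF assms, of e]
    by (intro has_lapI) (simp_all add: frame_def algebra_simps)
  also have "(\<Sum>b\<in>Basis. \<Sum>c\<in>Basis. ?H b c * (b \<bullet> d) * (c \<bullet> d)) + (\<Sum>b\<in>Basis. \<Sum>c\<in>Basis. ?H b c * (b \<bullet> e) * (c \<bullet> e))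
     = (\<Sum>b\<in>Basis. \<Sum>c\<in>Basis. ?H b c * (b \<bullet> c))"
    by (simp add: sum.distrib[symmetric] mult.assoc distrib_left[symmetric] inner_expand)
  also have "\<dots> = (\<Sum>b\<in>Basis. \<Sum>c\<in>Basis. if c = b then ?H b c else 0)"
    by (intro sum.cong refl) (auto simp: inner_Basis)
  also have "\<dots> = laplacian u ?x"
    by (simp add: laplacian_def)
  finally show ?thesis .
qed

text \<open>With $w = u + (y-k)^2/2$ harmonic, $f$ is determined up to a constant by $w = \mathrm{Im} f$,
  and the Cauchy--Riemann equations give $f' = w_y + \mathrm{i}\,w_x$.\<close>

lemma deriv_eq_grad:
  assumes u: "u differentiable (at (frame P d e z))"
    and f: "f holomorphic_on A" "open A" "z \<in> A"
    and eq: "\<And>w. w \<in> A \<Longrightarrow> u (frame P d e w) + (Im w - k)\<^sup>2 / 2 = Im (f w)"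
  shows "deriv f z = Complex (grad u (frame P d e z) \<bullet> e + (Im z - k)) (grad u (frame P d e z) \<bullet> d)"
proof -
  let ?x = "frame P d e z"
  note line = Im_holomorphic_line_deriv[OF f]
  have ev: "\<forall>\<^sub>F s in nhds (0::real). z + c * of_real s \<in> A" for c
    using f(2,3) by (intro topological_tendstoD[where S = A])
      (auto intro!: tendsto_eq_intros filterlim_ident)
  have lu: "((\<lambda>s. u (?x + s *\<^sub>R v)) has_real_derivative grad u ?x \<bullet> v) (at 0)" for v
    using has_derivative_along_line[of u ?x 0 v] u by simp
  have "((\<lambda>s. Im (f (z + 1 * of_real s))) has_real_derivative grad u ?x \<bullet> d) (at 0)"
  proof (rule DERIV_cong_ev[THEN iffD1])
    show "((\<lambda>s. u (?x + s *\<^sub>R d) + (Im z - k)\<^sup>2 / 2) has_real_derivative grad u ?x \<bullet> d) (at 0)"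
      using lu[of d] by (auto intro!: derivative_eq_intros)
    show "\<forall>\<^sub>F s in nhds 0. u (?x + s *\<^sub>R d) + (Im z - k)\<^sup>2 / 2 = Im (f (z + 1 * of_real s))"
      using ev[of 1]
    proof eventually_elim
      case (elim s)
      have "frame P d e (z + 1 * of_real s) = ?x + s *\<^sub>R d" by (simp add: frame_def algebra_simps)
      with eq[OF elim] show ?case by simp
    qed
  qed simp_all
  from DERIV_unique[OF this line] have 1: "Im (deriv f z) = grad u ?x \<bullet> d" by simp
  have "((\<lambda>s. Im (f (z + \<i> * of_real s))) has_real_derivative grad u ?x \<bullet> e + (Im z - k)) (at 0)"
  proof (rule DERIV_cong_ev[THEN iffD1])
    show "((\<lambda>s. u (?x + s *\<^sub>R e) + (Im z + s - k)\<^sup>2 / 2) has_real_derivative grad u ?x \<bullet> e + (Im z - k)) (at 0)"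
      using lu[of e] by (auto intro!: derivative_eq_intros)
    show "\<forall>\<^sub>F s in nhds 0. u (?x + s *\<^sub>R e) + (Im z + s - k)\<^sup>2 / 2 = Im (f (z + \<i> * of_real s))"
      using ev[of \<i>]
    proof eventually_elim
      case (elim s)
      have "frame P d e (z + \<i> * of_real s) = ?x + s *\<^sub>R e" by (simp add: frame_def algebra_simps)
      with eq[OF elim] show ?case by simp
    qed
  qed simp_all
  from DERIV_unique[OF this line] have 2: "Re (deriv f z) = grad u ?x \<bullet> e + (Im z - k)" by simp
  from 1 2 show ?thesis by (simp add: complex_eq_iff)
qed

end

text \<open>The shift \<open>k\<close> is \<open>0\<close> for the global function
  \<open>\<Phi>\<close>. In the interior gradient estimate it is the height of the centre, which
  keeps the correction below \<open>\<rho>^2 / 2\<close> on a disc of radius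
  \<open>\<rho>\<close>.\<close>

lemma has_lap_Im_power2: "has_lap (\<lambda>w. (Im w - k)\<^sup>2 / 2) z 1"
proof -
  have "has_deriv2 (\<lambda>s. (Im (z + of_real s) - k)\<^sup>2 / 2) 0"
    by (rule has_deriv2I[where p = "\<lambda>_. 0"]) (auto intro!: derivative_eq_intros)
  moreover have "has_deriv2 (\<lambda>s. (Im (z + \<i> * of_real s) - k)\<^sup>2 / 2) 1"
    by (rule has_deriv2I[where p = "\<lambda>s. Im z + s - k"]) (auto intro!: derivative_eq_intros)
  ultimately show ?thesis using has_lapI by fastforce
qed

text \<open>Positivity of the normal derivative (Hopf): the cubic $y(r^2-|z-c|^2)$ vanishes on the
  boundary of the half disc and has Laplacian $-8y$.\<close>

lemma torsion_half_disc:
  fixes c r :: real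
  defines "B \<equiv> {z \<in> ball (of_real c) r. Im z > 0}"
  assumes cont: "continuous_on {z \<in> cball (of_real c) r. Im z \<ge> 0} U" and "r > 0"
    and lap: "\<And>z. z \<in> B \<Longrightarrow> has_lap U z (-1)"
    and flat: "\<And>x. \<bar>x - c\<bar> \<le> r \<Longrightarrow> U (of_real x) = 0"
    and nonneg: "\<And>z. z \<in> cball (of_real c) r \<Longrightarrow> Im z \<ge> 0 \<Longrightarrow> U z \<ge> 0"
  obtains f where "f holomorphic_on ball (of_real c) r"
    "\<And>z. z \<in> ball (of_real c) r \<Longrightarrow> Im z \<ge> 0 \<Longrightarrow> U z + (Im z)\<^sup>2 / 2 = Im (f z)"
    "\<And>z. z \<in> ball (of_real c) r \<Longrightarrow> Im z = 0 \<Longrightarrow> Im (deriv f z) = 0"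
    "Re (deriv f (of_real c)) > 0"
proof -
  have "\<exists>f. f holomorphic_on ball (of_real c) r \<and>
    (\<forall>z\<in>ball (of_real c) r. Im z \<ge> 0 \<longrightarrow> Im (f z) = U z + (Im z)\<^sup>2 / 2) \<and>
    (\<forall>z\<in>ball (of_real c) r. Im z \<le> 0 \<longrightarrow> Im (f z) = - (U (cnj z) + (Im (cnj z))\<^sup>2 / 2))"
  proof (rule harmonic_half_disc_Im_holomorphic[OF _ \<open>r > 0\<close>])
    show "has_lap (\<lambda>z. U z + (Im z)\<^sup>2 / 2) z 0" if "z \<in> {z \<in> ball (of_real c) r. Im z > 0}" for z
      using has_lap_add[OF lap has_lap_Im_power2[of 0]] that by (simp add: B_def)
  qed (use cont flat in \<open>auto intro!: continuous_intros\<close>)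
  then obtain f where f: "f holomorphic_on ball (of_real c) r"
    "\<And>z. z \<in> ball (of_real c) r \<Longrightarrow> Im z \<ge> 0 \<Longrightarrow> Im (f z) = U z + (Im z)\<^sup>2 / 2" by metis
  note line = Im_holomorphic_line_deriv[OF f(1) open_ball]
  have real: "Im (deriv f z) = 0" if z: "z \<in> ball (of_real c) r" "Im z = 0" for z
  proof -
    have "\<forall>\<^sub>F s in nhds (0::real). z + of_real s \<in> ball (of_real c) r"
      using z(1) by (intro topological_tendstoD[where S = "ball (of_real c) r"])
        (auto intro!: tendsto_eq_intros filterlim_ident)
    then have "\<forall>\<^sub>F s in nhds (0::real). Im (f (z + 1 * of_real s)) = 0"
    proof eventually_elim
      case (elim s)
      have r: "z + of_real s = of_real (Re z + s)" using z(2) by (simp add: complex_eq_iff)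
      have "norm (of_real c - of_real (Re z + s) :: complex) < r"
        using elim unfolding r by (simp add: dist_norm)
      then have "\<bar>c - (Re z + s)\<bar> < r"
        by (metis norm_of_real of_real_diff)
      then have "U (of_real (Re z + s)) = 0" by (intro flat) linarith
      then show ?case using f(2)[OF elim] z(2) r by simp
    qed
    then have "((\<lambda>s. Im (f (z + 1 * of_real s))) has_real_derivative 0) (at 0)"
      by (subst DERIV_cong_ev[OF refl _ refl, where g = "\<lambda>_. 0"]) auto
    from DERIV_unique[OF this line[OF z(1)]] show ?thesis by simp
  qed
  \<comment> \<open>On the half disc \<open>Im z \<le> r\<close>, so with this factor the Laplacian
    of the barrier is at least \<open>-1\<close>, that of \<open>U\<close>.\<close>
  define \<epsilon> where "\<epsilon> = 1 / (8 * r)"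
  have \<epsilon>: "\<epsilon> > 0" using \<open>r > 0\<close> by (simp add: \<epsilon>_def)
  define b where "b = (\<lambda>z. \<epsilon> * (Im z * (r\<^sup>2 - ((Re z - c)\<^sup>2 + (Im z)\<^sup>2))))"
  have bB: "bounded B" unfolding B_def by (rule bounded_subset[OF bounded_ball]) auto
  have oB: "open B" unfolding B_def
    by (intro open_Collect_conj open_Collect_less continuous_intros) (auto simp: open_ball[unfolded ball_def] ball_def)
  have clB: "closure B \<subseteq> {z \<in> cball (of_real c) r. Im z \<ge> 0}"
    by (rule closure_minimal)
      (auto simp: B_def cball_def intro!: closed_Collect_conj closed_Collect_le continuous_intros)
  have nsq: "(dist (of_real c) z)\<^sup>2 = (Re z - c)\<^sup>2 + (Im z)\<^sup>2" for z
    by (simp add: dist_norm cmod_power2 power2_commute)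
  have lapb: "has_lap b z (\<epsilon> * (- 8 * Im z))" for z
    unfolding b_def
  proof (rule has_lap_cmult)
    have "has_deriv2 (\<lambda>s. Im (z + of_real s) * (r\<^sup>2 - ((Re (z + of_real s) - c)\<^sup>2 + (Im (z + of_real s))\<^sup>2))) (- 2 * Im z)"
      by (rule has_deriv2I[where p = "\<lambda>s. - 2 * Im z * (Re z + s - c)"])
        (auto intro!: derivative_eq_intros simp: algebra_simps)
    moreover have "has_deriv2 (\<lambda>s. Im (z + \<i> * of_real s) * (r\<^sup>2 - ((Re (z + \<i> * of_real s) - c)\<^sup>2 + (Im (z + \<i> * of_real s))\<^sup>2))) (- 6 * Im z)"
      by (rule has_deriv2I[where p = "\<lambda>s. r\<^sup>2 - (Re z - c)\<^sup>2 - 3 * (Im z + s)\<^sup>2"])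
        (auto intro!: derivative_eq_intros simp: algebra_simps power2_eq_square)
    ultimately show "has_lap (\<lambda>z. Im z * (r\<^sup>2 - ((Re z - c)\<^sup>2 + (Im z)\<^sup>2))) z (- 8 * Im z)"
      using has_lapI by fastforce
  qed
  have le: "b z - U z \<le> 0" if "z \<in> closure B" for z
  proof (rule max_principle[OF bB oB _ _ _ that])
    show "continuous_on (closure B) (\<lambda>z. b z - U z)"
      unfolding b_def using continuous_on_subset[OF cont clB] by (intro continuous_intros)
    show "\<exists>l\<ge>0. has_lap (\<lambda>z. b z - U z) w l" if w: "w \<in> B" for w
    proof (intro exI conjI)
      show "has_lap (\<lambda>z. b z - U z) w (\<epsilon> * (- 8 * Im w) - (- 1))"
        by (rule has_lap_diff[OF lapb lap[OF w]])
      have "Im w \<le> r"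
        using w abs_Im_le_cmod[of "w - of_real c"] by (auto simp: B_def dist_norm norm_minus_commute)
      then have "\<epsilon> * (8 * Im w) \<le> \<epsilon> * (8 * r)" using \<epsilon> by simp
      also have "\<dots> = 1" using \<open>r > 0\<close> by (simp add: \<epsilon>_def)
      finally show "0 \<le> \<epsilon> * (- 8 * Im w) - (- 1)" by simp
    qed
    show "b w - U w \<le> 0" if w: "w \<in> frontier B" for w
    proof -
      have w: "w \<in> cball (of_real c) r" "Im w \<ge> 0" "w \<notin> B"
        using w clB oB by (auto simp: frontier_def interior_open)
      then have "Im w = 0 \<or> dist (of_real c) w = r" by (auto simp: B_def)
      then have "b w = 0" by (auto simp: b_def nsq[symmetric])
      then show ?thesis using nonneg w by simp
    qed
  qed
  have "Re (deriv f (of_real c)) \<ge> \<epsilon> * r\<^sup>2"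
  proof (rule ccontr)
    assume "\<not> ?thesis"
    then have neg: "Re (deriv f (of_real c)) - \<epsilon> * r\<^sup>2 < 0" by simp
    have c: "of_real c \<in> ball (of_real c :: complex) r" using \<open>r > 0\<close> by simp
    \<comment> \<open>This is the barrier on the vertical through \<open>c\<close>, of slope
      \<open>\<epsilon> * r^2\<close> at the base. A smaller slope of \<open>Im f\<close> would push
      \<open>U\<close> below the barrier just above \<open>c\<close>.\<close>
    have "((\<lambda>s. \<epsilon> * (s * (r\<^sup>2 - s\<^sup>2))) has_real_derivative \<epsilon> * r\<^sup>2) (at 0)"
      by (auto intro!: derivative_eq_intros)
    from DERIV_diff[OF line[OF c, of \<i>] this]
    have "((\<lambda>s. Im (f (of_real c + \<i> * of_real s)) - \<epsilon> * (s * (r\<^sup>2 - s\<^sup>2))) has_real_derivative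
        Re (deriv f (of_real c)) - \<epsilon> * r\<^sup>2) (at 0)" by simp
    from DERIV_neg_dec_right[OF this neg] obtain \<delta> where \<delta>: "\<delta> > 0"
      "\<And>h. 0 < h \<Longrightarrow> h < \<delta> \<Longrightarrow> Im (f (of_real c + \<i> * of_real h)) - \<epsilon> * (h * (r\<^sup>2 - h\<^sup>2)) < Im (f (of_real c))"
      by auto
    define h where "h = min \<delta> r / 2"
    have h: "0 < h" "h < \<delta>" "h < r" using \<delta>(1) \<open>r > 0\<close> by (auto simp: h_def)
    let ?z = "of_real c + \<i> * of_real h :: complex"
    have z: "?z \<in> B" using h by (simp add: B_def dist_norm norm_mult)
    have "Im (f (of_real c)) = 0" using f(2)[OF c] flat[of c] \<open>r > 0\<close> by simp
    moreover have "b ?z \<le> U ?z" using le[of ?z] z closure_subset[of B] by auto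
    moreover have "Im (f ?z) = U ?z + h\<^sup>2 / 2" using f(2)[of ?z] z h by (simp add: B_def)
    ultimately show False using \<delta>(2)[OF h(1,2)] by (simp add: b_def) (use zero_le_power2[of h] in linarith)
  qed
  then have "Re (deriv f (of_real c)) > 0" using \<epsilon> \<open>r > 0\<close> by (smt (verit) mult_pos_pos zero_less_power)
  with f real show ?thesis by (intro that[of f]) auto
qed

subsection \<open>Growth of the torsion function at a vertex\<close>

text \<open>Concavity of \<open>sin\<close> on \<open>[0, pi]\<close>: the graph lies above its
  chord from \<open>0\<close> to \<open>\<beta>\<close>.\<close>

lemma sin_ge_chord:
  assumes "0 \<le> t" "t \<le> \<beta>" "\<beta> \<le> pi" "0 < \<beta>"
  shows "t / \<beta> * sin \<beta> \<le> sin t"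
proof -
  have "convex_on {0..pi} (\<lambda>x. - sin x :: real)"
    by (rule f''_ge0_imp_convex[where f' = "\<lambda>x. - cos x" and f'' = sin])
      (auto intro!: derivative_eq_intros sin_ge_zero)
  from convex_onD[OF this, of "t / \<beta>" 0 \<beta>] assms
  show ?thesis by (simp add: divide_simps)
qed

text \<open>The barrier is $M\,\mathrm{Im}(z^g) - y^2/2$ with $1 < g < \min(2, \pi/\alpha)$.\<close>

lemma torsion_le_in_sector:
  assumes S: "bounded S" "open S" and cont: "continuous_on (closure S) U"
    and lap: "\<And>z. z \<in> S \<Longrightarrow> has_lap U z (-1)"
    and fr: "\<And>z. z \<in> frontier S \<Longrightarrow> U z = 0"
    and \<alpha>: "0 < \<alpha>" "\<alpha> < pi"
    and sector: "\<And>z. z \<in> S \<Longrightarrow> Im z > 0 \<and> Im (z * cis (- \<alpha>)) < 0"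
  obtains C \<gamma> where "C > 0" "\<gamma> > 0" "\<And>z. z \<in> S \<Longrightarrow> U z \<le> C * norm z powr \<gamma> * Im z"
proof -
  \<comment> \<open>The second term yields \<open>g * \<alpha> < pi\<close>, so
    \<open>sin (g * Arg z)\<close> stays nonnegative on the closed sector. The first keeps
    \<open>1 - \<gamma>\<close> positive, so that \<open>norm z powr g\<close> dominates the
    quadratic correction on a bounded set.\<close>
  define \<gamma> where "\<gamma> = min (1/2) ((pi - \<alpha>) / (2 * \<alpha>))"
  define g where "g = 1 + \<gamma>"
  have \<gamma>: "0 < \<gamma>" "\<gamma> \<le> 1/2" using \<alpha> by (auto simp: \<gamma>_def)
  have "\<gamma> * \<alpha> \<le> (pi - \<alpha>) / (2 * \<alpha>) * \<alpha>" using \<alpha> by (intro mult_right_mono) (auto simp: \<gamma>_def)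
  also have "\<dots> = (pi - \<alpha>) / 2" using \<alpha> by simp
  finally have "g * \<alpha> \<le> \<alpha> + (pi - \<alpha>) / 2" by (simp add: g_def distrib_right)
  also have "\<dots> < pi" using \<alpha> by (simp add: field_simps)
  finally have "g * \<alpha> < pi" .
  moreover have "0 < g * \<alpha>" using \<alpha> \<gamma> by (intro mult_pos_pos) (auto simp: g_def)
  ultimately have g\<alpha>: "0 < g * \<alpha>" "g * \<alpha> < pi" by auto
  \<comment> \<open>With \<open>K\<close> below, concavity gives
    \<open>m * sin t \<le> sin (g * t) \<le> g * K * sin t\<close> on \<open>[0, \<alpha>]\<close>;
    this compares \<open>h\<close> with \<open>norm z powr \<gamma> * Im z\<close> from both
    sides.\<close>
  define m where "m = sin (g * \<alpha>) / \<alpha>"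
  have m: "m > 0" using g\<alpha> \<alpha> by (auto simp: m_def sin_gt_zero)
  define K where "K = \<alpha> / sin \<alpha>"
  have sa: "sin \<alpha> > 0" using \<alpha> by (simp add: sin_gt_zero)
  have K: "K > 0" using \<alpha> sa by (simp add: K_def)
  obtain D where D: "D > 0" "\<And>w. w \<in> closure S \<Longrightarrow> norm w \<le> D"
    using S(1) bounded_closure bounded_pos by metis
  define h where "h = (\<lambda>z. Im (z powr of_real g))"
  have clS: "closure S \<subseteq> {z. Im z \<ge> 0 \<and> Im (z * cis (- \<alpha>)) \<le> 0}"
    by (rule closure_minimal)
      (use sector in \<open>auto intro!: closed_Collect_conj closed_Collect_le continuous_intros simp: less_imp_le\<close>)
  have polar: "0 \<le> Arg z" "Arg z \<le> \<alpha>" "Im z = norm z * sin (Arg z)" "h z = norm z powr g * sin (g * Arg z)"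
    if z: "z \<in> closure S" "z \<noteq> 0" for z
  proof -
    have zz: "z = norm z * cis (Arg z)" using rcis_cmod_Arg[of z] by (simp add: rcis_def)
    then have "Im z = Im (norm z * cis (Arg z))" by (rule arg_cong)
    then show im: "Im z = norm z * sin (Arg z)" by simp
    have "Im z \<ge> 0" using z clS by auto
    then show a0: "0 \<le> Arg z" by (simp add: Arg_less_0)
    have "z * cis (- \<alpha>) = norm z * cis (Arg z) * cis (- \<alpha>)"
      using zz by (rule arg_cong)
    also have "\<dots> = norm z * cis (Arg z - \<alpha>)"
      by (simp only: mult.assoc cis_mult) simp
    finally have "z * cis (- \<alpha>) = norm z * cis (Arg z - \<alpha>)" .
    moreover have "Im (z * cis (- \<alpha>)) \<le> 0" using z clS by blast
    ultimately have "norm z * sin (Arg z - \<alpha>) \<le> 0" by simp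
    then have "sin (Arg z - \<alpha>) \<le> 0" using z(2) by (simp add: mult_le_0_iff)
    then show "Arg z \<le> \<alpha>"
      using sin_gt_zero[of "Arg z - \<alpha>"] \<alpha> Arg_bounded[of z] by force
    show "h z = norm z powr g * sin (g * Arg z)"
      using z(2) by (simp add: h_def powr_def Arg_eq_Im_Ln[symmetric] Im_exp mult.commute)
  qed
  have lower: "m * norm z powr \<gamma> * Im z \<le> h z" and upper: "h z \<le> g * K * norm z powr \<gamma> * Im z"
    if z: "z \<in> closure S" "z \<noteq> 0" for z
  proof -
    note p = polar[OF z]
    have gs: "norm z powr g = norm z powr \<gamma> * norm z"
      using z(2) by (simp add: g_def powr_add mult.commute)
    have "m * sin (Arg z) \<le> m * Arg z" using m p(1) sin_x_le_x by simp
    also have "\<dots> = (g * Arg z) / (g * \<alpha>) * sin (g * \<alpha>)"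
      using \<gamma> by (simp add: m_def g_def)
    also have "\<dots> \<le> sin (g * Arg z)"
      using p \<gamma> g\<alpha> \<alpha> by (intro sin_ge_chord) (auto simp: g_def)
    finally have "norm z powr g * (m * sin (Arg z)) \<le> h z"
      unfolding p(4) by (intro mult_left_mono) auto
    then show "m * norm z powr \<gamma> * Im z \<le> h z" by (simp add: gs p(3) mult_ac)
    have "Arg z / \<alpha> * sin \<alpha> \<le> sin (Arg z)" using p \<alpha> by (intro sin_ge_chord) auto
    then have ak: "Arg z \<le> K * sin (Arg z)" using \<alpha> sa by (simp add: K_def field_simps)
    have "sin (g * Arg z) \<le> g * Arg z" using p \<gamma> by (intro sin_x_le_x) (simp add: g_def)
    also have "\<dots> \<le> g * (K * sin (Arg z))" using ak \<gamma> by (intro mult_left_mono) (auto simp: g_def)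
    finally have "h z \<le> norm z powr g * (g * (K * sin (Arg z)))"
      unfolding p(4) by (intro mult_left_mono) auto
    then show "h z \<le> g * K * norm z powr \<gamma> * Im z" by (simp add: gs p(3) mult_ac)
  qed
  \<comment> \<open>The value at the vertex comes from the convention for powers of
    \<open>0\<close>; it is also the limit, so \<open>h\<close> is continuous there.\<close>
  have h0: "h 0 = 0" by (simp add: h_def)
  have nonpos: "z \<notin> \<real>\<^sub>\<le>\<^sub>0" if "z \<in> closure S" "z \<noteq> 0" for z
  proof
    assume "z \<in> \<real>\<^sub>\<le>\<^sub>0"
    then have "Arg z = pi" using that(2) Arg_eq_pi[of z] by (auto simp: complex_nonpos_Reals_iff complex_eq_iff)
    then show False using polar(2)[OF that] \<alpha> by simp
  qed
  have conth: "continuous_on (closure S) h"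
    unfolding continuous_on_eq_continuous_within
  proof
    fix z assume z: "z \<in> closure S"
    show "continuous (at z within closure S) h"
    proof (cases "z = 0")
      case False
      have "(\<lambda>z. z powr of_real g) holomorphic_on - \<real>\<^sub>\<le>\<^sub>0"
        by (intro holomorphic_intros) auto
      then have "isCont (\<lambda>z. z powr of_real g) z"
        using nonpos[OF z False] continuous_on_eq_continuous_at[OF open_Compl[OF closed_nonpos_Reals_complex]]
        by (auto dest!: holomorphic_on_imp_continuous_on)
      then have "continuous (at z) (\<lambda>z. Im (z powr of_real g))"
        by (intro continuous_Im)
      then show ?thesis unfolding h_def by (rule continuous_at_imp_continuous_at_within)
    next
      case True
      have "((\<lambda>w. norm w powr g) \<longlongrightarrow> 0) (at 0 within closure S)"
        using \<gamma> by (intro tendsto_eq_intros tendsto_powr'[where b = g and a = 0, THEN tendsto_eq_rhs]) (auto simp: g_def intro!: tendsto_eq_intros)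
      moreover have "norm (h w) \<le> norm w powr g" for w
        unfolding h_def using abs_Im_le_cmod[of "w powr of_real g"] by (simp add: norm_powr_real_powr')
      ultimately have "(h \<longlongrightarrow> 0) (at 0 within closure S)"
        by (intro Lim_null_comparison[of h "\<lambda>w. norm w powr g"] always_eventually) auto
      then show ?thesis using True h0 by (simp add: continuous_within)
    qed
  qed
  have laph: "has_lap h z 0" if "z \<in> S" for z
  proof -
    have "z \<noteq> 0" using sector[OF that] by auto
    then have "z \<in> - \<real>\<^sub>\<le>\<^sub>0" using nonpos that closure_subset by auto
    moreover have "(\<lambda>z. z powr of_real g) holomorphic_on - \<real>\<^sub>\<le>\<^sub>0"
      by (intro holomorphic_intros) auto
    ultimately show ?thesis
      unfolding h_def by (intro has_lap_Im[where S = "- \<real>\<^sub>\<le>\<^sub>0"]) auto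
  qed
  \<comment> \<open>Then \<open>M * m = D powr (1 - \<gamma>) / 2\<close>, just enough for
    \<open>M * h\<close> to dominate \<open>(Im w)^2 / 2\<close> on the frontier.\<close>
  define M where "M = D powr (1 - \<gamma>) / (2 * m)"
  have M: "M > 0" using D m by (simp add: M_def)
  have le: "U z - (M * h z - (Im z)\<^sup>2 / 2) \<le> 0" if "z \<in> closure S" for z
  proof (rule max_principle[OF S _ _ _ that])
    show "continuous_on (closure S) (\<lambda>z. U z - (M * h z - (Im z)\<^sup>2 / 2))"
      using cont conth by (intro continuous_intros) auto
    show "\<exists>l\<ge>0. has_lap (\<lambda>z. U z - (M * h z - (Im z)\<^sup>2 / 2)) w l" if "w \<in> S" for w
      using has_lap_diff[OF lap[OF that] has_lap_diff[OF has_lap_cmult[OF laph[OF that], of M] has_lap_Im_power2[of 0 w]]]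
      by (intro exI[of _ 0]) simp
    show "U w - (M * h w - (Im w)\<^sup>2 / 2) \<le> 0" if w: "w \<in> frontier S" for w
    proof (cases "w = 0")
      case True
      then show ?thesis using fr[OF w] h0 by simp
    next
      case False
      have wc: "w \<in> closure S" using w by (simp add: frontier_def)
      then have im: "0 \<le> Im w" using clS by auto
      have "(Im w)\<^sup>2 / 2 \<le> norm w * Im w / 2"
        using im abs_Im_le_cmod[of w] by (simp add: power2_eq_square mult_right_mono)
      also have "\<dots> = norm w powr (1 - \<gamma>) * norm w powr \<gamma> * Im w / 2"
        using False by (simp add: powr_add[symmetric])
      also have "\<dots> \<le> D powr (1 - \<gamma>) * norm w powr \<gamma> * Im w / 2"
        using D(2)[OF wc] \<gamma> im by (intro divide_right_mono mult_right_mono powr_mono2) auto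
      also have "\<dots> = M * (m * norm w powr \<gamma> * Im w)" using m by (simp add: M_def)
      also have "\<dots> \<le> M * h w" using M lower[OF wc False] by simp
      finally show ?thesis using fr[OF w] by simp
    qed
  qed
  show ?thesis
  proof (rule that[of "M * g * K" \<gamma>])
    show "U z \<le> M * g * K * norm z powr \<gamma> * Im z" if z: "z \<in> S" for z
    proof -
      have zc: "z \<in> closure S" "z \<noteq> 0" using z closure_subset sector[OF z] by auto
      have "U z \<le> M * h z" using le[OF zc(1)] zero_le_power2[of "Im z"] by linarith
      also have "\<dots> \<le> M * (g * K * norm z powr \<gamma> * Im z)" using M upper[OF zc] by simp
      finally show ?thesis by (simp add: mult_ac)
    qed
  qed (use M K \<gamma> in \<open>auto simp: g_def\<close>)
qed

subsection \<open>A triangle with a distinguished base\<close>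

text \<open>The foot \<open>a\<close> of the altitude is unrestricted, so obtuse base angles are
  covered. By \<open>ex_based_triangle\<close> any side of any nondegenerate triangle can serve as
  the base.\<close>

locale based_triangle = orthonormal_frame +
  fixes P Q R :: "real^2" and L a h :: real
  assumes L_pos: "L > 0" and Q_eq: "Q = P + L *\<^sub>R d"
    and h_pos: "h > 0" and R_eq: "R = P + a *\<^sub>R d + h *\<^sub>R e"
begin

abbreviation "T \<equiv> frame P d e"
abbreviation "\<Omega> \<equiv> open_triangle P Q R"
definition "S = T -` \<Omega>"

lemma R_inner: "(R - P) \<bullet> d = a" "(R - P) \<bullet> e = h"
  using dd ee de by (simp_all add: R_eq inner_left_distrib inner_commute[of e d])

lemma not_collinear: "\<not> collinear {P, Q, R}"
proof
  assume "collinear {P, Q, R}"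
  then have "collinear {Q, P, R}" by (simp add: insert_commute)
  then have "collinear {0, Q - P, R - P}" by (subst (asm) collinear_3) (auto simp: NO_MATCH_def)
  moreover have "Q - P \<noteq> 0" using Q_eq L_pos dd by auto
  moreover have "R - P \<noteq> 0" using R_inner(2) h_pos by auto
  ultimately obtain k where "R - P = k *\<^sub>R (Q - P)"
    unfolding collinear_lemma by auto
  then have "(R - P) \<bullet> e = 0" using de by (simp add: Q_eq)
  then show False using R_inner(2) h_pos by simp
qed

lemma mem_triangle_iff:
  "x \<in> \<Omega> \<longleftrightarrow> (\<exists>\<beta> \<gamma>. 0 < \<beta> \<and> 0 < \<gamma> \<and> \<beta> + \<gamma> < 1 \<and> x = P + \<beta> *\<^sub>R (Q - P) + \<gamma> *\<^sub>R (R - P))"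
proof -
  have "x \<in> \<Omega> \<longleftrightarrow> (\<exists>\<alpha> \<beta> \<gamma>. 0 < \<alpha> \<and> 0 < \<beta> \<and> 0 < \<gamma> \<and> \<alpha> + \<beta> + \<gamma> = 1 \<and> \<alpha> *\<^sub>R P + \<beta> *\<^sub>R Q + \<gamma> *\<^sub>R R = x)"
    unfolding open_triangle_def using interior_convex_hull_3_minimal[OF not_collinear] by simp
  also have "\<dots> \<longleftrightarrow> (\<exists>\<beta> \<gamma>. 0 < \<beta> \<and> 0 < \<gamma> \<and> \<beta> + \<gamma> < 1 \<and> x = P + \<beta> *\<^sub>R (Q - P) + \<gamma> *\<^sub>R (R - P))"
  proof (intro iffI; elim exE conjE)
    fix \<alpha> \<beta> \<gamma> :: real
    assume *: "0 < \<alpha>" "0 < \<beta>" "0 < \<gamma>" "\<alpha> + \<beta> + \<gamma> = 1" "\<alpha> *\<^sub>R P + \<beta> *\<^sub>R Q + \<gamma> *\<^sub>R R = x"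
    have "\<alpha> = 1 - \<beta> - \<gamma>" using *(4) by simp
    with * show "\<exists>\<beta> \<gamma>. 0 < \<beta> \<and> 0 < \<gamma> \<and> \<beta> + \<gamma> < 1 \<and> x = P + \<beta> *\<^sub>R (Q - P) + \<gamma> *\<^sub>R (R - P)"
      by (intro exI[of _ \<beta>] exI[of _ \<gamma>]) (auto simp: algebra_simps)
  next
    fix \<beta> \<gamma> :: real
    assume *: "0 < \<beta>" "0 < \<gamma>" "\<beta> + \<gamma> < 1" "x = P + \<beta> *\<^sub>R (Q - P) + \<gamma> *\<^sub>R (R - P)"
    then show "\<exists>\<alpha> \<beta> \<gamma>. 0 < \<alpha> \<and> 0 < \<beta> \<and> 0 < \<gamma> \<and> \<alpha> + \<beta> + \<gamma> = 1 \<and> \<alpha> *\<^sub>R P + \<beta> *\<^sub>R Q + \<gamma> *\<^sub>R R = x"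
      by (intro exI[of _ "1 - \<beta> - \<gamma>"] exI[of _ \<beta>] exI[of _ \<gamma>]) (auto simp: algebra_simps)
  qed
  finally show ?thesis .
qed

lemma frame_barycentric:
  "T z = P + ((Re z - a * (Im z / h)) / L) *\<^sub>R (Q - P) + (Im z / h) *\<^sub>R (R - P)"
proof -
  have "P + \<beta> *\<^sub>R (Q - P) + \<gamma> *\<^sub>R (R - P) = P + (\<beta> * L + \<gamma> * a) *\<^sub>R d + (\<gamma> * h) *\<^sub>R e" for \<beta> \<gamma>
    by (simp add: Q_eq R_eq algebra_simps)
  then show ?thesis using L_pos h_pos by (simp add: frame_def)
qed

lemma mem_S: "z \<in> S \<longleftrightarrow> Im z > 0 \<and> a * Im z < h * Re z \<and> h * Re z + (L - a) * Im z < h * L"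
proof -
  have uniq: "\<gamma> = Im z / h \<and> \<beta> = (Re z - a * (Im z / h)) / L"
    if "T z = P + \<beta> *\<^sub>R (Q - P) + \<gamma> *\<^sub>R (R - P)" for \<beta> \<gamma>
  proof -
    have *: "T z - P = (\<beta> * L + \<gamma> * a) *\<^sub>R d + (\<gamma> * h) *\<^sub>R e"
      unfolding that by (simp add: Q_eq R_eq algebra_simps)
    have "Im z = \<gamma> * h" "Re z = \<beta> * L + \<gamma> * a"
      using frame_coords[of P z] dd ee de unfolding * by (simp_all add: inner_left_distrib inner_commute[of e d])
    then show ?thesis using L_pos h_pos by (simp add: field_simps)
  qed
  have "z \<in> S \<longleftrightarrow> 0 < (Re z - a * (Im z / h)) / L \<and> 0 < Im z / h \<and> (Re z - a * (Im z / h)) / L + Im z / h < 1"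
    unfolding S_def vimage_eq mem_triangle_iff using uniq frame_barycentric[of z] by blast
  then show ?thesis using L_pos h_pos by (auto simp: field_simps)
qed

lemma open_triangle_open: "open \<Omega>" by (simp add: open_triangle_def)

lemma S_open: "open S"
  unfolding S_def using open_triangle_open continuous_frame[of UNIV] open_vimage by blast

lemma T_closure: "T z \<in> closure \<Omega> \<longleftrightarrow> z \<in> closure S"
proof
  assume "z \<in> closure S"
  have "T ` closure S \<subseteq> closure (T ` S)"
    by (rule image_closure_subset[OF continuous_frame]) (auto intro: closure_subset[THEN subsetD])
  also have "\<dots> \<subseteq> closure \<Omega>" by (intro closure_mono) (auto simp: S_def)
  finally show "T z \<in> closure \<Omega>" using \<open>z \<in> closure S\<close> by blast
next
  let ?I = "\<lambda>x. Complex ((x - P) \<bullet> d) ((x - P) \<bullet> e)"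
  assume z: "T z \<in> closure \<Omega>"
  have "?I ` closure \<Omega> \<subseteq> closure (?I ` \<Omega>)"
    by (rule image_closure_subset) (auto intro!: continuous_intros intro: closure_subset[THEN subsetD])
  also have "\<dots> \<subseteq> closure S" by (intro closure_mono) (auto simp: S_def frame_inverse)
  finally have "?I (T z) \<in> closure S" using z by blast
  then show "z \<in> closure S" by simp
qed

lemma T_frontier: "T z \<in> frontier \<Omega> \<longleftrightarrow> z \<in> frontier S"
  using S_open open_triangle_open T_closure by (auto simp: frontier_def interior_open S_def)

lemma bounded_triangle: "bounded \<Omega>"
  unfolding open_triangle_def
  by (rule bounded_subset[OF _ interior_subset]) (simp add: bounded_convex_hull)

lemma S_bounded: "bounded S"
proof -
  obtain D where D: "\<And>x. x \<in> \<Omega> \<Longrightarrow> dist P x \<le> D"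
    using bounded_triangle bounded_any_center[of \<Omega> P] by auto
  have "norm z \<le> D" if "z \<in> S" for z
    using D[of "T z"] that dist_frame[of P 0 z] by (simp add: S_def frame_def)
  then show ?thesis unfolding bounded_iff by blast
qed

lemma S_convex: "convex S"
proof -
  have "convex {z. Im z > 0 \<and> (- h) * Re z + a * Im z < 0 \<and> h * Re z + (L - a) * Im z < h * L}"
  proof -
    have *: "convex {z. p * Re z + q * Im z < c}" for p q c
      using convex_halfspace_lt[of "Complex p q" c] by (simp add: inner_complex_def)
    have "{z. Im z > 0 \<and> (- h) * Re z + a * Im z < 0 \<and> h * Re z + (L - a) * Im z < h * L} =
      {z. 0 * Re z + (-1) * Im z < 0} \<inter> {z. (- h) * Re z + a * Im z < 0} \<inter> {z. h * Re z + (L - a) * Im z < h * L}"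
      by auto
    then show ?thesis by (simp only: convex_Int *)
  qed
  moreover have "S = {z. Im z > 0 \<and> (- h) * Re z + a * Im z < 0 \<and> h * Re z + (L - a) * Im z < h * L}"
    by (auto simp: mem_S)
  ultimately show ?thesis by simp
qed

lemma half_disc_in_S:
  assumes "0 < c" "c < L"
  obtains r where "r > 0" "\<And>z. z \<in> cball (of_real c) r \<Longrightarrow> Im z > 0 \<Longrightarrow> z \<in> S"
    "\<And>z. z \<in> cball (of_real c) r \<Longrightarrow> Im z \<ge> 0 \<Longrightarrow> z \<in> closure S"
proof -
  let ?O = "{z. a * Im z < h * Re z \<and> h * Re z + (L - a) * Im z < h * L}"
  have "open ?O" by (intro open_Collect_conj open_Collect_less continuous_intros)
  moreover have "of_real c \<in> ?O" using assms h_pos by simp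
  ultimately obtain r where r: "r > 0" "cball (of_real c) r \<subseteq> ?O" by (meson open_contains_cball)
  have 1: "z \<in> S" if "z \<in> ?O" "Im z > 0" for z using that by (simp add: mem_S)
  have 2: "z \<in> closure S" if "z \<in> cball (of_real c) r" "Im z \<ge> 0" for z
  proof -
    \<comment> \<open>A small vertical shift moves points of the diameter into \<open>S\<close>, so
      they are limits of points of \<open>S\<close>.\<close>
    have ev: "\<forall>\<^sub>F t in at_right (0::real). z + \<i> * of_real t \<in> ?O"
      using \<open>open ?O\<close> that r
      by (intro topological_tendstoD[where S = ?O]) (auto intro!: tendsto_eq_intros)
    have "\<forall>\<^sub>F t in at_right (0::real). z + \<i> * of_real t \<in> closure S"
      using ev eventually_at_right_less[of 0]
    proof eventually_elim
      case (elim t)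
      then have "z + \<i> * of_real t \<in> S" using that by (intro 1) auto
      then show ?case using closure_subset by blast
    qed
    moreover have "((\<lambda>t. z + \<i> * of_real t) \<longlongrightarrow> z) (at_right (0::real))"
      by (auto intro!: tendsto_eq_intros)
    ultimately show ?thesis
      by (intro Lim_in_closed_set[of "closure S" _ "at_right (0::real)"]) auto
  qed
  show ?thesis using that[OF r(1)] 1 2 r(2) by blast
qed

lemma flat_in_frontier: "z \<in> closure S \<Longrightarrow> Im z = 0 \<Longrightarrow> z \<in> frontier S"
  using S_open by (auto simp: frontier_def interior_open mem_S)

end

subsection \<open>Boundary behaviour of the gradient\<close>

locale torsion_triangle = based_triangle +
  fixes u :: "real^2 \<Rightarrow> real"
  assumes torsion: "torsion_function \<Omega> u"
begin

definition "U z = u (T z)"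

lemma C2: "C2_on \<Omega> u"
  using torsion by (simp add: torsion_function_def)

lemma u_differentiable: "x \<in> \<Omega> \<Longrightarrow> u differentiable (at x)"
  using C2_on_differentiable(1)[OF C2 open_triangle_open] .

lemma U_continuous: "continuous_on (closure S) U"
  unfolding U_def
  by (rule continuous_on_compose2[of "closure \<Omega>" u])
    (use torsion T_closure in \<open>auto simp: torsion_function_def intro!: continuous_intros\<close>)

lemma U_lap: "z \<in> S \<Longrightarrow> has_lap U z (-1)"
proof -
  assume "z \<in> S"
  then have z: "T z \<in> \<Omega>" by (simp add: S_def)
  then have "laplacian u (T z) = -1" using torsion by (auto simp: torsion_function_def)
  with has_lap_frame[OF C2 open_triangle_open z] show ?thesis
    by (simp add: U_def[abs_def])
qed

lemma U_frontier: "z \<in> frontier S \<Longrightarrow> U z = 0"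
  using torsion T_frontier by (simp add: U_def torsion_function_def)

lemma U_nonneg: "z \<in> closure S \<Longrightarrow> U z \<ge> 0"
proof -
  assume z: "z \<in> closure S"
  have "-1 * U z \<le> 0"
  proof (rule max_principle[OF S_bounded S_open _ _ _ z])
    show "continuous_on (closure S) (\<lambda>z. -1 * U z)"
      using U_continuous by (intro continuous_intros)
    show "\<exists>l\<ge>0. has_lap (\<lambda>z. -1 * U z) w l" if "w \<in> S" for w
      using has_lap_cmult[OF U_lap[OF that], of "-1"] by (intro exI[of _ 1]) simp
  qed (simp add: U_frontier)
  then show ?thesis by simp
qed

text \<open>The \<open>f\<close> obtained here is already the derivative of the function from the
  half disc, hence the reflected extension of \<open>(u_y + y) + \<i> * u_x\<close> across the base.
  Its positive value at \<open>c\<close> is the Hopf estimate.\<close>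

lemma side_expansion:
  assumes "0 < c" "c < L"
  obtains r f where "r > 0" "f holomorphic_on ball (of_real c) r"
    "\<And>z. z \<in> ball (of_real c) r \<Longrightarrow> Im z > 0 \<Longrightarrow>
      z \<in> S \<and> f z = Complex (grad u (T z) \<bullet> e + Im z) (grad u (T z) \<bullet> d)"
    "\<And>z. z \<in> ball (of_real c) r \<Longrightarrow> Im z = 0 \<Longrightarrow> Im (f z) = 0"
    "Re (f (of_real c)) > 0"
proof -
  obtain r where r: "r > 0" "\<And>z. z \<in> cball (of_real c) r \<Longrightarrow> Im z > 0 \<Longrightarrow> z \<in> S"
    "\<And>z. z \<in> cball (of_real c) r \<Longrightarrow> Im z \<ge> 0 \<Longrightarrow> z \<in> closure S"
    using half_disc_in_S[OF assms] by blast
  obtain f where f: "f holomorphic_on ball (of_real c) r"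
    "\<And>z. z \<in> ball (of_real c) r \<Longrightarrow> Im z \<ge> 0 \<Longrightarrow> U z + (Im z)\<^sup>2 / 2 = Im (f z)"
    "\<And>z. z \<in> ball (of_real c) r \<Longrightarrow> Im z = 0 \<Longrightarrow> Im (deriv f z) = 0"
    "Re (deriv f (of_real c)) > 0"
  proof (rule torsion_half_disc[of c r U])
    show "continuous_on {z \<in> cball (of_real c) r. Im z \<ge> 0} U"
      by (rule continuous_on_subset[OF U_continuous]) (use r(3) in blast)
    show "has_lap U z (-1)" if "z \<in> {z \<in> ball (of_real c) r. Im z > 0}" for z
      using that r(2) by (intro U_lap) auto
    show "U (of_real x) = 0" if "\<bar>x - c\<bar> \<le> r" for x
    proof -
      have "of_real x \<in> cball (of_real c :: complex) r"
        using that by (simp add: dist_of_real dist_real_def)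
      then show ?thesis using r(3) by (intro U_frontier flat_in_frontier) auto
    qed
  qed (use r U_nonneg that in auto)
  show ?thesis
  proof (rule that[OF r(1), of "deriv f"])
    show "deriv f holomorphic_on ball (of_real c) r"
      by (rule holomorphic_deriv[OF f(1) open_ball])
    fix z assume z: "z \<in> ball (of_real c) r" "Im z > 0"
    let ?A = "{z \<in> ball (of_real c) r. Im z > 0}"
    have zS: "z \<in> S" using z r(2) by auto
    have "open ?A"
      by (intro open_Collect_conj open_Collect_less continuous_intros) (auto simp: open_ball[unfolded ball_def] ball_def)
    moreover have "f holomorphic_on ?A" by (rule holomorphic_on_subset[OF f(1)]) auto
    ultimately have "deriv f z = Complex (grad u (T z) \<bullet> e + (Im z - 0)) (grad u (T z) \<bullet> d)"
      using zS z f(2)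
      by (intro deriv_eq_grad[where A = ?A] u_differentiable) (auto simp: S_def U_def)
    then show "z \<in> S \<and> deriv f z = Complex (grad u (T z) \<bullet> e + Im z) (grad u (T z) \<bullet> d)"
      using zS by simp
  qed (use f in auto)
qed

text \<open>With the quadratic correction centred at the height of \<open>x\<close>, the imaginary
  part lies between \<open>0\<close> and \<open>M + \<rho>^2 / 2\<close>, and the correction
  contributes nothing to the gradient at \<open>x\<close>; \<open>deriv_bound_Im\<close> does the
  rest.\<close>

lemma grad_bound:
  assumes "x \<in> \<Omega>" "\<rho> > 0" "cball x \<rho> \<subseteq> \<Omega>" "\<And>y. y \<in> cball x \<rho> \<Longrightarrow> u y \<le> M" "M \<ge> 0"
  shows "norm (grad u x) \<le> 18 * (M + \<rho>\<^sup>2 / 2) / \<rho>"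
proof -
  define z where "z = Complex ((x - P) \<bullet> d) ((x - P) \<bullet> e)"
  have Tz: "T z = x" by (simp add: z_def frame_inverse)
  have ball: "T w \<in> cball x \<rho>" if "w \<in> cball z \<rho>" for w
    using that by (simp add: Tz[symmetric] dist_frame)
  then have sub: "cball z \<rho> \<subseteq> S" using assms(3) by (auto simp: S_def simp del: mem_cball)
  let ?v = "\<lambda>w. U w + (Im w - Im z)\<^sup>2 / 2"
  have "\<exists>f. f holomorphic_on ball z \<rho> \<and> (\<forall>w\<in>ball z \<rho>. Im (f w) = ?v w)"
  proof (rule harmonic_disc_Im_holomorphic[OF _ assms(2)])
    show "continuous_on (cball z \<rho>) ?v"
      using sub closure_subset by (intro continuous_intros continuous_on_subset[OF U_continuous]) auto
    show "has_lap ?v w 0" if "w \<in> ball z \<rho>" for w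
    proof -
      have "w \<in> S" using that sub by (auto simp del: mem_cball mem_ball dest: ball_subset_cball[THEN subsetD])
      from has_lap_add[OF U_lap[OF this] has_lap_Im_power2[of "Im z"]] show ?thesis by simp
    qed
  qed
  then obtain f where f: "f holomorphic_on ball z \<rho>" "\<And>w. w \<in> ball z \<rho> \<Longrightarrow> Im (f w) = ?v w" by blast
  have z: "z \<in> ball z \<rho>" using assms(2) by simp
  have "norm (deriv f z) \<le> 18 * (M + \<rho>\<^sup>2 / 2) / \<rho>"
  proof (rule deriv_bound_Im[OF f(1) assms(2)])
    show "M + \<rho>\<^sup>2 / 2 > 0" using assms(2,5) by (simp add: add_nonneg_pos)
    show "\<bar>Im (f w)\<bar> \<le> M + \<rho>\<^sup>2 / 2" if w: "w \<in> ball z \<rho>" for w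
    proof -
      have wc: "w \<in> cball z \<rho>" using w by simp
      have "0 \<le> U w" using wc sub closure_subset by (intro U_nonneg) blast
      moreover have "U w \<le> M" unfolding U_def using assms(4) ball[OF wc] by blast
      moreover have "(Im w - Im z)\<^sup>2 \<le> \<rho>\<^sup>2"
        using abs_Im_le_cmod[of "w - z"] w by (intro abs_le_square_iff[THEN iffD1]) (auto simp: dist_norm norm_minus_commute)
      moreover have "0 \<le> (Im w - Im z)\<^sup>2" by simp
      ultimately show ?thesis unfolding f(2)[OF w] by simp
    qed
  qed
  also have "deriv f z = Complex (grad u (T z) \<bullet> e + (Im z - Im z)) (grad u (T z) \<bullet> d)"
    by (rule deriv_eq_grad[OF _ f(1) open_ball z])
      (use f(2) assms(1) Tz u_differentiable in \<open>auto simp: U_def\<close>)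
  also have "norm \<dots> = norm (grad u x)"
    using norm_sq_expand[of "grad u x"] by (simp add: Tz cmod_def real_sqrt_unique)
  finally show ?thesis .
qed

lemma frame_zero: "T 0 = P"
  by (simp add: frame_def)

text \<open>The sector is the angle of the triangle at \<open>P\<close>, of opening
  \<open>Arg (Complex a h)\<close>. The last factor is the distance to the base, so the bound is
  sharp enough near this side but not near the other one through \<open>P\<close>.\<close>

lemma vertex_growth:
  obtains C \<gamma> where "C > 0" "\<gamma> > 0"
    "\<And>x. x \<in> \<Omega> \<Longrightarrow> u x \<le> C * norm (x - P) powr \<gamma> * ((x - P) \<bullet> e)"
proof -
  define w where "w = Complex a h"
  define \<alpha> where "\<alpha> = Arg w"
  have nw: "norm w > 0" using h_pos by (auto simp: w_def complex_eq_iff)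
  have \<alpha>: "0 < \<alpha>" "\<alpha> < pi" using h_pos Arg_lt_pi[of w] by (auto simp: \<alpha>_def w_def)
  have w: "w = rcis (norm w) \<alpha>" by (simp add: \<alpha>_def rcis_cmod_Arg)
  have "Re w = norm w * cos \<alpha>" using arg_cong[OF w, of Re] by (simp only: Re_rcis)
  moreover have "Im w = norm w * sin \<alpha>" using arg_cong[OF w, of Im] by (simp only: Im_rcis)
  ultimately have ah: "a = norm w * cos \<alpha>" "h = norm w * sin \<alpha>" by (simp_all add: w_def)
  have "Im z > 0 \<and> Im (z * cis (- \<alpha>)) < 0" if "z \<in> S" for z
  proof -
    have "norm w * Im (z * cis (- \<alpha>)) = a * Im z - h * Re z"
      by (simp add: ah algebra_simps)
    also have "\<dots> < 0" using that by (simp add: mem_S)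
    finally show ?thesis using that nw by (simp add: mem_S mult_less_0_iff)
  qed
  then obtain C \<gamma> where C: "C > 0" "\<gamma> > 0" "\<And>z. z \<in> S \<Longrightarrow> U z \<le> C * norm z powr \<gamma> * Im z"
    using torsion_le_in_sector[OF S_bounded S_open U_continuous U_lap U_frontier \<alpha>] by blast
  show ?thesis
  proof (rule that[OF C(1,2)])
    fix x assume x: "x \<in> \<Omega>"
    define z where "z = Complex ((x - P) \<bullet> d) ((x - P) \<bullet> e)"
    have Tz: "T z = x" by (simp add: z_def frame_inverse)
    have "norm z = norm (x - P)"
      using dist_frame[of P z 0] frame_zero Tz by (simp add: dist_norm)
    then show "u x \<le> C * norm (x - P) powr \<gamma> * ((x - P) \<bullet> e)"
      using C(3)[of z] x Tz by (simp add: S_def U_def) (simp add: z_def)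
  qed
qed

text \<open>Close to \<open>P\<close> the two sides through \<open>P\<close> decide membership:
  \<open>\<rho>\<close> is chosen so that the inequality of the opposite side holds
  automatically.\<close>

lemma near_vertex:
  obtains \<rho> where "\<rho> > 0"
    "\<And>x. norm (x - P) < \<rho> \<Longrightarrow> 0 < (x - P) \<bullet> e \<Longrightarrow> a * ((x - P) \<bullet> e) < h * ((x - P) \<bullet> d) \<Longrightarrow> x \<in> \<Omega>"
proof -
  define \<rho> where "\<rho> = h * L / (h + \<bar>L - a\<bar>)"
  have pos: "h + \<bar>L - a\<bar> > 0" using h_pos by linarith
  have "\<rho> > 0" using h_pos L_pos pos by (simp add: \<rho>_def)
  moreover have "x \<in> \<Omega>"
    if x: "norm (x - P) < \<rho>" "0 < (x - P) \<bullet> e" "a * ((x - P) \<bullet> e) < h * ((x - P) \<bullet> d)" for x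
  proof -
    let ?z = "Complex ((x - P) \<bullet> d) ((x - P) \<bullet> e)"
    have "\<bar>(x - P) \<bullet> d\<bar> \<le> norm (x - P)" "\<bar>(x - P) \<bullet> e\<bar> \<le> norm (x - P)"
      using Cauchy_Schwarz_ineq2[of "x - P" d] Cauchy_Schwarz_ineq2[of "x - P" e] by simp_all
    note le = this
    have "h * ((x - P) \<bullet> d) \<le> h * norm (x - P)"
      using h_pos le(1) by (intro mult_left_mono) auto
    moreover have "(L - a) * ((x - P) \<bullet> e) \<le> \<bar>L - a\<bar> * norm (x - P)"
      using abs_ge_self[of "(L - a) * ((x - P) \<bullet> e)"] mult_left_mono[OF le(2), of "\<bar>L - a\<bar>"]
      by (simp add: abs_mult)
    ultimately have "h * ((x - P) \<bullet> d) + (L - a) * ((x - P) \<bullet> e) \<le> (h + \<bar>L - a\<bar>) * norm (x - P)"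
      by (simp add: distrib_right)
    also have "\<dots> < (h + \<bar>L - a\<bar>) * \<rho>" using x(1) pos by simp
    also have "\<dots> = h * L" using pos by (simp add: \<rho>_def)
    finally have "?z \<in> S" using x by (simp add: mem_S)
    then show ?thesis by (simp add: S_def frame_inverse)
  qed
  ultimately show ?thesis using that by blast
qed

lemma continuous_grad: "continuous_on \<Omega> (grad u)"
  unfolding grad_def[abs_def]
proof (intro continuous_intros)
  fix b :: "real^2" assume "b \<in> Basis"
  then show "continuous_on \<Omega> (partial b u)"
    using C2_on_differentiable(2)[OF C2 open_triangle_open]
    by (auto intro!: continuous_at_imp_continuous_on differentiable_imp_continuous_within)
qed

end

text \<open>Near a vertex both sides bound $u$ by $C r^\gamma$ times the distance to the side;
  the interior gradient estimate on a disc of comparable radius then gives $|\nabla u| = O(r^\gamma)$.\<close>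

lemma grad_tendsto_0_vertex:
  assumes "torsion_triangle d e P Q R L a h u" "torsion_triangle d' e' P R Q L' a' h' u"
  shows "(grad u \<longlongrightarrow> 0) (at P within open_triangle P Q R)"
proof -
  interpret t1: torsion_triangle d e P Q R L a h u by fact
  interpret t2: torsion_triangle d' e' P R Q L' a' h' u by fact
  let ?W = "open_triangle P Q R"
  have W: "open_triangle P R Q = ?W" by (simp add: open_triangle_def insert_commute)
  obtain C1 \<gamma>1 where C1: "C1 > 0" "\<gamma>1 > 0"
    "\<And>x. x \<in> ?W \<Longrightarrow> u x \<le> C1 * norm (x - P) powr \<gamma>1 * ((x - P) \<bullet> e)"
    using t1.vertex_growth by blast
  obtain C2 \<gamma>2 where C2: "C2 > 0" "\<gamma>2 > 0"
    "\<And>x. x \<in> ?W \<Longrightarrow> u x \<le> C2 * norm (x - P) powr \<gamma>2 * ((x - P) \<bullet> e')"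
    using t2.vertex_growth unfolding W by blast
  have pos: "0 < (x - P) \<bullet> e" "0 < (x - P) \<bullet> e'" if "x \<in> ?W" for x
    using that t1.mem_S[of "Complex ((x - P) \<bullet> d) ((x - P) \<bullet> e)"]
      t2.mem_S[of "Complex ((x - P) \<bullet> d') ((x - P) \<bullet> e')"]
    by (simp_all add: t1.S_def t2.S_def t1.frame_inverse t2.frame_inverse W)
  \<comment> \<open>Both sides are \<open>L * h * h'\<close> times the barycentric coordinate of
    \<open>Q\<close>. This translates the inequality for the side \<open>P R\<close> in the first
    frame into positivity of the distance to that side in the second.\<close>
  have e': "L * h * ((x - P) \<bullet> e') = h' * (h * ((x - P) \<bullet> d) - a * ((x - P) \<bullet> e))" for x
  proof -
    define z where "z = Complex ((x - P) \<bullet> d) ((x - P) \<bullet> e)"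
    define \<beta> where "\<beta> = (Re z - a * (Im z / h)) / L"
    have "x = P + \<beta> *\<^sub>R (Q - P) + (Im z / h) *\<^sub>R (R - P)"
      using t1.frame_barycentric[of z] unfolding z_def t1.frame_inverse \<beta>_def by simp
    then have "x - P = \<beta> *\<^sub>R (Q - P) + (Im z / h) *\<^sub>R (R - P)"
      by (metis add.assoc add_diff_cancel_left')
    moreover have "(Q - P) \<bullet> e' = h'" by (rule t2.R_inner(2))
    moreover have "(R - P) \<bullet> e' = 0" using t2.Q_eq t2.de by simp
    ultimately have "(x - P) \<bullet> e' = \<beta> * h'" by (simp add: inner_left_distrib)
    moreover have "L * h * \<beta> = h * Re z - a * Im z"
      using t1.L_pos t1.h_pos by (simp add: \<beta>_def field_simps)
    ultimately show ?thesis by (simp add: z_def mult_ac)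
  qed
  obtain \<rho> where \<rho>: "\<rho> > 0" "\<And>x. norm (x - P) < \<rho> \<Longrightarrow> 0 < (x - P) \<bullet> e \<Longrightarrow> 0 < (x - P) \<bullet> e' \<Longrightarrow> x \<in> ?W"
  proof -
    obtain \<rho> where "\<rho> > 0" and \<rho>: "\<And>x. norm (x - P) < \<rho> \<Longrightarrow> 0 < (x - P) \<bullet> e \<Longrightarrow>
        a * ((x - P) \<bullet> e) < h * ((x - P) \<bullet> d) \<Longrightarrow> x \<in> ?W"
      using t1.near_vertex by blast
    have "a * ((x - P) \<bullet> e) < h * ((x - P) \<bullet> d)" if "0 < (x - P) \<bullet> e'" for x
    proof -
      have "0 < h' * (h * ((x - P) \<bullet> d) - a * ((x - P) \<bullet> e))"
        unfolding e'[symmetric] using that t1.L_pos t1.h_pos by simp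
      then show ?thesis using t2.h_pos by (simp add: zero_less_mult_iff)
    qed
    with \<rho> \<open>\<rho> > 0\<close> show ?thesis using that by blast
  qed
  \<comment> \<open>The interior estimate with \<open>M = A * (3 * \<delta> / 2)\<close> and radius
    \<open>\<delta> / 2\<close> gives \<open>54 * A + 9 / 2 * \<delta>\<close>, and
    \<open>\<delta> \<le> r\<close>.\<close>
  define B where "B = (\<lambda>r. 54 * (C1 * (2 * r) powr \<gamma>1 + C2 * (2 * r) powr \<gamma>2) + 5 * r)"
  have bound: "norm (grad u x) \<le> B (norm (x - P))" if x: "x \<in> ?W" "norm (x - P) < \<rho> / 2" for x
  proof -
    define r where "r = norm (x - P)"
    \<comment> \<open>The distance to the nearer of the two sides. On the disc of radius
      \<open>\<delta> / 2\<close> the distance to that side is at most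
      \<open>3 * \<delta> / 2\<close>, and both distances stay positive.\<close>
    define \<delta> where "\<delta> = min ((x - P) \<bullet> e) ((x - P) \<bullet> e')"
    have \<delta>: "\<delta> > 0" using pos[OF x(1)] by (simp add: \<delta>_def)
    have \<delta>_le: "\<delta> \<le> (x - P) \<bullet> e" "\<delta> \<le> (x - P) \<bullet> e'" by (auto simp: \<delta>_def)
    have "\<delta> \<le> r"
      using Cauchy_Schwarz_ineq2[of "x - P" e] by (simp add: \<delta>_def r_def min.coboundedI1)
    define A where "A = C1 * (2 * r) powr \<gamma>1 + C2 * (2 * r) powr \<gamma>2"
    have A: "A \<ge> 0" "C1 * (2 * r) powr \<gamma>1 \<le> A" "C2 * (2 * r) powr \<gamma>2 \<le> A"
      using C1(1) C2(1) by (auto simp: A_def)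
    have near: "(y - P) \<bullet> v \<le> (x - P) \<bullet> v + \<delta> / 2" "(x - P) \<bullet> v \<le> (y - P) \<bullet> v + \<delta> / 2"
      if "y \<in> cball x (\<delta> / 2)" "norm v = 1" for y v
    proof -
      have "(y - P) \<bullet> v - (x - P) \<bullet> v = (y - x) \<bullet> v" by (simp add: inner_diff_left)
      moreover have "\<bar>(y - x) \<bullet> v\<bar> \<le> \<delta> / 2"
        using Cauchy_Schwarz_ineq2[of "y - x" v] that by (simp add: dist_norm norm_minus_commute)
      ultimately show "(y - P) \<bullet> v \<le> (x - P) \<bullet> v + \<delta> / 2" "(x - P) \<bullet> v \<le> (y - P) \<bullet> v + \<delta> / 2"
        by linarith+
    qed
    have ny: "norm (y - P) \<le> 2 * r" if "y \<in> cball x (\<delta> / 2)" for y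
      using norm_triangle_ineq[of "y - x" "x - P"] that \<open>\<delta> \<le> r\<close> \<delta>
      by (simp add: dist_norm norm_minus_commute r_def)
    have sub: "cball x (\<delta> / 2) \<subseteq> ?W"
    proof
      fix y assume y: "y \<in> cball x (\<delta> / 2)"
      have "norm (y - P) < \<rho>" using ny[OF y] x(2) by (simp add: r_def)
      moreover have "0 < (y - P) \<bullet> e" "0 < (y - P) \<bullet> e'"
        using near(2)[OF y t1.norms(2)] near(2)[OF y t2.norms(2)] \<delta> \<delta>_le by linarith+
      ultimately show "y \<in> ?W" by (rule \<rho>(2))
    qed
    have le: "u y \<le> A * (3 * \<delta> / 2)" if y: "y \<in> cball x (\<delta> / 2)" for y
    proof -
      have yW: "y \<in> ?W" using sub y by blast
      consider "\<delta> = (x - P) \<bullet> e" | "\<delta> = (x - P) \<bullet> e'" unfolding \<delta>_def min_def by meson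
      then show ?thesis
      proof cases
        case 1
        have "u y \<le> C1 * norm (y - P) powr \<gamma>1 * ((y - P) \<bullet> e)" by (rule C1(3)[OF yW])
        also have "\<dots> \<le> C1 * (2 * r) powr \<gamma>1 * (3 * \<delta> / 2)"
          using near(1)[OF y t1.norms(2)] 1 C1(1,2) ny[OF y] pos[OF yW]
          by (intro mult_mono powr_mono2) auto
        also have "\<dots> \<le> A * (3 * \<delta> / 2)" using A \<delta> by (intro mult_right_mono) auto
        finally show ?thesis .
      next
        case 2
        have "u y \<le> C2 * norm (y - P) powr \<gamma>2 * ((y - P) \<bullet> e')" by (rule C2(3)[OF yW])
        also have "\<dots> \<le> C2 * (2 * r) powr \<gamma>2 * (3 * \<delta> / 2)"
          using near(1)[OF y t2.norms(2)] 2 C2(1,2) ny[OF y] pos[OF yW]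
          by (intro mult_mono powr_mono2) auto
        also have "\<dots> \<le> A * (3 * \<delta> / 2)" using A \<delta> by (intro mult_right_mono) auto
        finally show ?thesis .
      qed
    qed
    have "norm (grad u x) \<le> 18 * (A * (3 * \<delta> / 2) + (\<delta> / 2)\<^sup>2 / 2) / (\<delta> / 2)"
      using \<delta> A by (intro t1.grad_bound x(1) sub le) auto
    also have "\<dots> = 54 * A + 9 / 2 * \<delta>"
      using \<delta> by (simp add: field_simps power2_eq_square)
    also have "\<dots> \<le> B r" using \<open>\<delta> \<le> r\<close> \<delta> by (simp add: B_def A_def)
    finally show ?thesis by (simp add: r_def)
  qed
  show ?thesis
  proof (rule Lim_null_comparison)
    have "\<forall>\<^sub>F x in at P within ?W. x \<in> ?W \<and> dist x P < \<rho> / 2"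
      using \<rho>(1) unfolding eventually_at by (intro exI[of _ "\<rho> / 2"]) auto
    then show "\<forall>\<^sub>F x in at P within ?W. norm (grad u x) \<le> B (norm (x - P))"
      by eventually_elim (use bound in \<open>auto simp: dist_norm\<close>)
    have lim: "((\<lambda>x. 2 * norm (x - P)) \<longlongrightarrow> 0) (at P within ?W)"
      by (auto intro!: tendsto_eq_intros)
    have "((\<lambda>x. (2 * norm (x - P)) powr \<gamma>) \<longlongrightarrow> 0) (at P within ?W)" if "\<gamma> > 0" for \<gamma>
      by (rule tendsto_zero_powrI[OF lim tendsto_const _ that]) simp
    from this[OF C1(2)] this[OF C2(2)] lim
    have "((\<lambda>x. 54 * (C1 * (2 * norm (x - P)) powr \<gamma>1 + C2 * (2 * norm (x - P)) powr \<gamma>2) +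
        5 / 2 * (2 * norm (x - P))) \<longlongrightarrow> 54 * (C1 * 0 + C2 * 0) + 5 / 2 * 0) (at P within ?W)"
      by (intro tendsto_intros)
    then show "((\<lambda>x. B (norm (x - P))) \<longlongrightarrow> 0) (at P within ?W)"
      by (simp add: B_def)
  qed
qed

subsection \<open>Nodal domains and crossing paths\<close>

text \<open>Both paths fit into a rectangle standing on the real axis, which reduces the claim to
  the Fashoda theorem for interlaced end points on one edge.\<close>

lemma half_plane_paths_cross:
  fixes f g :: "real \<Rightarrow> complex"
  assumes "path f" "path g"
    and nonneg: "\<And>z. z \<in> path_image f \<union> path_image g \<Longrightarrow> Im z \<ge> 0"
    and ends: "Im (pathstart f) = 0" "Im (pathfinish f) = 0" "Im (pathstart g) = 0" "Im (pathfinish g) = 0"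
    and order: "Re (pathstart f) < Re (pathstart g)" "Re (pathstart g) < Re (pathfinish f)"
      "Re (pathfinish f) < Re (pathfinish g)"
  shows "path_image f \<inter> path_image g \<noteq> {}"
proof -
  define V :: "complex \<Rightarrow> real^2" where "V = (\<lambda>z. vector [Re z, Im z])"
  have V: "V z $ 1 = Re z" "V z $ 2 = Im z" for z by (simp_all add: V_def)
  have inj: "V z = V w \<Longrightarrow> z = w" for z w by (metis V complex_eq_iff)
  have "V = (\<lambda>z. \<chi> i. if i = 1 then Re z else Im z)"
    by (auto simp: fun_eq_iff vec_eq_iff forall_2 V)
  moreover have "continuous_on A (\<lambda>z. if i = 1 then Re z else Im z)" for A and i :: 2
    by (cases "i = 1") (auto intro!: continuous_intros)
  ultimately have "continuous_on A V" for A
    by (simp add: continuous_on_vec_lambda)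
  then have paths: "path (V \<circ> f)" "path (V \<circ> g)"
    using assms(1,2) by (auto intro: path_continuous_image)
  have "bounded (path_image f \<union> path_image g)"
    using assms(1,2) by (simp add: bounded_path_image)
  then obtain B where B: "\<And>z. z \<in> path_image f \<union> path_image g \<Longrightarrow> norm z \<le> B"
    unfolding bounded_iff by blast
  have box: "V z \<in> cbox (vector [-B, 0]) (vector [B, B])" if "z \<in> path_image f \<union> path_image g" for z
    using B[OF that] nonneg[OF that] abs_Re_le_cmod[of z] abs_Im_le_cmod[of z]
    by (auto simp: mem_box_cart forall_2 V abs_le_iff)
  obtain x where "x \<in> path_image (V \<circ> f)" "x \<in> path_image (V \<circ> g)"
    by (rule fashoda_interlace[OF paths, of "vector [-B, 0]" "vector [B, B]"])
      (use box ends order in \<open>auto simp: path_image_compose pathstart_compose pathfinish_compose V\<close>)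
  then show ?thesis using inj by (fastforce simp: path_image_compose)
qed

text \<open>If \<open>H \<le> 0\<close> held on the whole frontier of the component \<open>V\<close>
  of \<open>{H > 0}\<close> around \<open>z\<close>, the maximum principle on \<open>V\<close> would
  contradict \<open>H z > 0\<close>. A frontier point of \<open>V\<close> with \<open>H > 0\<close>
  cannot lie in \<open>S\<close>, hence it lies on the frontier of \<open>S\<close>.\<close>

lemma path_to_positive_boundary:
  fixes S :: "complex set"
  assumes S: "bounded S" "open S" "convex S" and cont: "continuous_on (closure S) H"
    and lap: "\<And>z. z \<in> S \<Longrightarrow> has_lap H z 0"
    and z: "z \<in> S" "H z > 0"
  obtains \<gamma> where "path \<gamma>" "pathstart \<gamma> = z" "pathfinish \<gamma> \<in> frontier S"
    "path_image \<gamma> \<subseteq> {w \<in> closure S. H w > 0}"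
proof -
  let ?A = "{w \<in> S. H w > 0}"
  have oA: "open ?A"
  proof -
    have "continuous_on S H" using cont closure_subset continuous_on_subset by blast
    then have "open (S \<inter> H -` {0<..})" using S(2) by (intro continuous_open_preimage) auto
    moreover have "S \<inter> H -` {0<..} = ?A" by auto
    ultimately show ?thesis by simp
  qed
  define V where "V = connected_component_set ?A z"
  have oV: "open V" unfolding V_def by (rule open_connected_component[OF oA])
  have VA: "V \<subseteq> ?A" unfolding V_def by (rule connected_component_subset)
  have zV: "z \<in> V" using z by (simp add: V_def connected_component_refl)
  have clV: "closure V \<subseteq> closure S" using VA by (intro closure_mono) blast
  have "\<exists>q\<in>frontier V. H q > 0"
  proof (rule ccontr)
    assume "\<not> ?thesis"
    then have le: "\<And>w. w \<in> frontier V \<Longrightarrow> H w \<le> 0" by force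
    have "bounded V" by (rule bounded_subset[OF S(1)]) (use VA in blast)
    moreover have "\<exists>l\<ge>0. has_lap H w l" if "w \<in> V" for w using lap[of w] that VA by blast
    moreover have "z \<in> closure V" using zV closure_subset by blast
    ultimately have "H z \<le> 0"
      using max_principle[OF _ oV continuous_on_subset[OF cont clV] _ le] by blast
    then show False using z by simp
  qed
  then obtain q where q: "q \<in> frontier V" "H q > 0" by blast
  have qc: "q \<in> closure V" "q \<notin> V" using q oV by (auto simp: frontier_def interior_open)
  have "q \<notin> S"
  proof
    assume "q \<in> S"
    then have "q \<in> ?A" using q by simp
    \<comment> \<open>Components are relatively closed, so a frontier point of \<open>V\<close>
      within \<open>{H > 0}\<close> would belong to the open set \<open>V\<close>.\<close>
    moreover have "closedin (top_of_set ?A) V"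
      unfolding V_def by (rule closedin_connected_component)
    then obtain C where C: "closed C" "V = ?A \<inter> C" unfolding closedin_closed by blast
    then have "closure V \<subseteq> C" by (intro closure_minimal) auto
    ultimately have "q \<in> V" using qc(1) C(2) by blast
    with qc show False by simp
  qed
  then have qF: "q \<in> frontier S" using qc clV S(2) by (auto simp: frontier_def interior_open)
  have qS: "q \<in> closure S" using qc clV by blast
  obtain \<delta> where \<delta>: "\<delta> > 0" "\<And>w. w \<in> closure S \<Longrightarrow> dist w q < \<delta> \<Longrightarrow> \<bar>H w - H q\<bar> < H q"
    using cont q(2) qS unfolding continuous_on_iff dist_real_def by meson
  then have pos: "H w > 0" if "w \<in> closure S" "w \<in> ball q \<delta>" for w
    using that \<delta>(2)[of w] by (force simp: dist_commute)
  obtain y where y: "y \<in> V" "y \<in> ball q \<delta>"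
    using qc(1) \<delta>(1) unfolding closure_approachable by (metis dist_commute mem_ball)
  have "path_connected V"
    using oV connected_connected_component[of ?A z] unfolding V_def
    by (simp add: connected_open_path_connected)
  then obtain g where g: "path g" "path_image g \<subseteq> V" "pathstart g = z" "pathfinish g = y"
    using zV y(1) unfolding path_connected_def by blast
  have yS: "y \<in> closure S" using y VA closure_subset by blast
  \<comment> \<open>It is not clear that \<open>q\<close> can be reached inside \<open>V\<close>.
    But \<open>H > 0\<close> on the part of \<open>closure S\<close> near \<open>q\<close>, and this
    part is convex, so a straight segment completes the path.\<close>
  have seg: "closed_segment y q \<subseteq> {w \<in> closure S. H w > 0}"
  proof
    fix w assume w: "w \<in> closed_segment y q"
    have "w \<in> closure S"
      using w yS qS closed_segment_subset[OF yS qS convex_closure[OF S(3)]] by blast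
    moreover have "w \<in> ball q \<delta>"
      using w y(2) \<delta>(1) closed_segment_subset[of y "ball q \<delta>" q] by auto
    ultimately show "w \<in> {w \<in> closure S. H w > 0}" using pos by simp
  qed
  show ?thesis
  proof (rule that[of "g +++ linepath y q"])
    show "path_image (g +++ linepath y q) \<subseteq> {w \<in> closure S. H w > 0}"
      using g seg VA closure_subset[of S] by (auto simp: path_image_join)
  qed (use g qF in auto)
qed

text \<open>Two rays at $p$ in the order $H > 0$, $H < 0$ would extend to paths inside $\{H > 0\}$ and
  $\{H < 0\}$ ending at $0$ and at $L$; detaching them near $p$ onto $p+r$ and $p-r$ interlaces
  their end points on the real axis.\<close>

lemma nodal_rays_impossible:
  fixes S :: "complex set" and p L :: real
  assumes S: "bounded S" "open S" "convex S" and cont: "continuous_on (closure S) H"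
    and lap: "\<And>z. z \<in> S \<Longrightarrow> has_lap H z 0"
    and upper: "\<And>z. z \<in> S \<Longrightarrow> Im z > 0"
    and left: "\<And>z. z \<in> frontier S \<Longrightarrow> H z > 0 \<Longrightarrow>
      closed_segment z 0 \<subseteq> {w \<in> closure S. H w > 0} \<union> {0}"
    and right: "\<And>z. z \<in> frontier S \<Longrightarrow> H z < 0 \<Longrightarrow>
      closed_segment z (of_real L) \<subseteq> {w \<in> closure S. H w < 0} \<union> {of_real L}"
    and zero: "H 0 = 0" "H (of_real L) = 0" "H (of_real p) = 0" and p: "0 < p" "p < L"
    and \<theta>: "0 < \<theta>1" "\<theta>1 < \<theta>2" "\<theta>2 < pi" and \<rho>: "\<rho> > 0"
    and ray1: "\<And>t. 0 < t \<Longrightarrow> t \<le> \<rho> \<Longrightarrow> of_real p + of_real t * cis \<theta>1 \<in> S \<and> H (of_real p + of_real t * cis \<theta>1) > 0"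
    and ray2: "\<And>t. 0 < t \<Longrightarrow> t \<le> \<rho> \<Longrightarrow> of_real p + of_real t * cis \<theta>2 \<in> S \<and> H (of_real p + of_real t * cis \<theta>2) < 0"
  shows False
proof -
  define z where "z = (\<lambda>\<theta> t. of_real p + of_real t * cis \<theta>)"
  \<comment> \<open>The end points of the paths, at which \<open>H\<close> vanishes, are adjoined;
    \<open>Pos\<close> and \<open>Neg\<close> remain disjoint.\<close>
  define Pos where "Pos = {w \<in> closure S. H w > 0} \<union> {0}"
  define Neg where "Neg = {w \<in> closure S. H w < 0} \<union> {of_real L}"
  have clS: "Im w \<ge> 0" if "w \<in> closure S" for w
  proof -
    have "closure S \<subseteq> {z. Im z \<ge> 0}"
      by (rule closure_minimal) (auto simp: less_imp_le upper intro!: closed_Collect_le continuous_intros)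
    then show ?thesis using that by blast
  qed
  have r1: "z \<theta>1 \<rho> \<in> S" "H (z \<theta>1 \<rho>) > 0" and r2: "z \<theta>2 \<rho> \<in> S" "H (z \<theta>2 \<rho>) < 0"
    using ray1[of \<rho>] ray2[of \<rho>] \<rho> by (auto simp: z_def)
  obtain g1 where g1: "path g1" "pathstart g1 = z \<theta>1 \<rho>" "pathfinish g1 \<in> frontier S"
    "path_image g1 \<subseteq> {w \<in> closure S. H w > 0}"
    using path_to_positive_boundary[OF S cont lap r1] by blast
  have lap': "has_lap (\<lambda>w. - H w) w 0" if "w \<in> S" for w
    using has_lap_cmult[OF lap[OF that], of "-1"] by simp
  have "continuous_on (closure S) (\<lambda>w. - H w)" using cont by (intro continuous_intros)
  then obtain g2 where g2: "path g2" "pathstart g2 = z \<theta>2 \<rho>" "pathfinish g2 \<in> frontier S"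
    "path_image g2 \<subseteq> {w \<in> closure S. H w < 0}"
    using path_to_positive_boundary[OF S _ lap' r2(1)] r2(2) by auto
  define G1 where "G1 = g1 +++ linepath (pathfinish g1) 0"
  define G2 where "G2 = g2 +++ linepath (pathfinish g2) (of_real L)"
  have G1: "path G1" "pathstart G1 = z \<theta>1 \<rho>" "pathfinish G1 = 0" "path_image G1 \<subseteq> Pos"
    using g1 left[OF g1(3)] pathfinish_in_path_image[of g1]
    by (auto simp: G1_def path_image_join Pos_def)
  have G2: "path G2" "pathstart G2 = z \<theta>2 \<rho>" "pathfinish G2 = of_real L" "path_image G2 \<subseteq> Neg"
    using g2 right[OF g2(3)] pathfinish_in_path_image[of g2]
    by (auto simp: G2_def path_image_join Neg_def)
  \<comment> \<open>\<open>H\<close> vanishes at \<open>p\<close>, so both paths keep a positive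
    distance \<open>\<delta>\<close> from it, which leaves room for the detours.\<close>
  have "of_real p \<notin> path_image G1 \<union> path_image G2"
    using G1(4) G2(4) zero p by (auto simp: Pos_def Neg_def)
  moreover have "closed (path_image G1 \<union> path_image G2)"
    using G1(1) G2(1) by (intro closed_Un closed_path_image)
  ultimately have "open (- (path_image G1 \<union> path_image G2))"
      "of_real p \<in> - (path_image G1 \<union> path_image G2)"
    by (auto simp only: open_Compl Compl_iff)
  then obtain \<delta> where \<delta>_pos: "\<delta> > 0"
    and \<delta>_ball: "ball (of_real p) \<delta> \<subseteq> - (path_image G1 \<union> path_image G2)"
    by (rule openE)
  have \<delta>: "\<delta> > 0" "\<And>w. w \<in> path_image G1 \<union> path_image G2 \<Longrightarrow> \<not> dist (of_real p) w < \<delta>"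
    using \<delta>_pos \<delta>_ball by auto
  \<comment> \<open>Below \<open>\<delta>\<close> the detours miss the long paths; below
    \<open>\<rho>\<close> they attach to the rays; below \<open>p\<close> and \<open>L - p\<close>
    the new end points stay between \<open>0\<close> and \<open>L\<close>.\<close>
  define k where "k = Min {\<delta>, \<rho>, p, L - p}"
  define r where "r = k / 2"
  have "0 < k" "k \<le> \<delta>" "k \<le> \<rho>" "k \<le> p" "k \<le> L - p"
    using \<delta>(1) \<rho> p by (auto simp: k_def)
  then have r: "0 < r" "r < \<delta>" "r < \<rho>" "r < p" "p + r < L"
    by (auto simp: r_def)
  define F1 where "F1 = linepath (of_real (p + r)) (z \<theta>1 r) +++ linepath (z \<theta>1 r) (z \<theta>1 \<rho>) +++ G1"
  define F2 where "F2 = linepath (of_real (p - r)) (z \<theta>2 r) +++ linepath (z \<theta>2 r) (z \<theta>2 \<rho>) +++ G2"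
  define A1 where "A1 = closed_segment (of_real (p + r)) (z \<theta>1 r)"
  define B1 where "B1 = closed_segment (z \<theta>1 r) (z \<theta>1 \<rho>)"
  define A2 where "A2 = closed_segment (of_real (p - r)) (z \<theta>2 r)"
  define B2 where "B2 = closed_segment (z \<theta>2 r) (z \<theta>2 \<rho>)"
  have im1: "path_image F1 = A1 \<union> B1 \<union> path_image G1" and im2: "path_image F2 = A2 \<union> B2 \<union> path_image G2"
    using G1 G2 by (auto simp: F1_def F2_def path_image_join A1_def A2_def B1_def B2_def)
  have zr: "z \<theta> t = of_real p + of_real t * cis \<theta>" for \<theta> t by (simp add: z_def)
  have Bz: "\<exists>t. 0 < t \<and> t \<le> \<rho> \<and> w = z \<theta> t" if "w \<in> closed_segment (z \<theta> r) (z \<theta> \<rho>)" for w \<theta>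
  proof -
    obtain s where s: "0 \<le> s" "s \<le> 1" "w = (1 - s) *\<^sub>R z \<theta> r + s *\<^sub>R z \<theta> \<rho>"
      using \<open>w \<in> _\<close> unfolding closed_segment_def by blast
    have "w = z \<theta> ((1 - s) * r + s * \<rho>)"
      using s(3) by (simp add: zr scaleR_conv_of_real algebra_simps)
    moreover have "(1 - s) * r + s * \<rho> \<le> \<rho>" using s r by (intro convex_bound_le) auto
    moreover have "0 < (1 - s) * r + s * \<rho>"
    proof (cases "s = 1")
      case False
      then show ?thesis using s r \<rho> by (intro add_pos_nonneg mult_pos_pos) auto
    qed (use \<rho> in simp)
    ultimately show ?thesis by blast
  qed
  have B1: "B1 \<subseteq> Pos - {0}" "B1 \<subseteq> S" and B2: "B2 \<subseteq> Neg - {of_real L}" "B2 \<subseteq> S"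
    using Bz[of _ \<theta>1] Bz[of _ \<theta>2] ray1 ray2 zero closure_subset[of S]
    by (force simp: B1_def B2_def Pos_def Neg_def zr)+
  have nz: "dist (of_real p) (z \<theta> r) = r" for \<theta>
    using r(1) by (simp add: zr dist_norm norm_mult)
  have nr: "dist (of_real p :: complex) (of_real (p + r)) \<le> r" "dist (of_real p :: complex) (of_real (p - r)) \<le> r"
    using r(1) by (simp_all add: dist_norm)
  have "A1 \<subseteq> cball (of_real p) r" "A2 \<subseteq> cball (of_real p) r"
    unfolding A1_def A2_def using nz nr by (intro closed_segment_subset convex_cball; simp)+
  then have A: "A1 \<inter> path_image G2 = {}" "A2 \<inter> path_image G1 = {}"
    using \<delta>(2) r(2) by fastforce+
  have PN: "Pos \<inter> Neg = {}" using zero p by (auto simp: Pos_def Neg_def)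
  define \<mu> where "\<mu> = (\<theta>1 + \<theta>2) / 2"
  have \<mu>: "0 < \<mu>" "\<mu> < pi" "\<theta>1 < \<mu>" "\<mu> < \<theta>2" using \<theta> by (auto simp: \<mu>_def)
  define \<phi> where "\<phi> = (\<lambda>w. Im (cis (- \<mu>) * (w - of_real p)))"
  have conv: "convex {w. \<phi> w < 0}" "convex {w. \<phi> w > 0}"
  proof -
    have eq: "\<phi> w = inner (Complex (- sin \<mu>) (cos \<mu>)) w + sin \<mu> * p" for w
      by (simp add: \<phi>_def inner_complex_def algebra_simps)
    have "{w. \<phi> w < 0} = {w. inner (Complex (- sin \<mu>) (cos \<mu>)) w < - sin \<mu> * p}"
      "{w. \<phi> w > 0} = {w. inner (Complex (- sin \<mu>) (cos \<mu>)) w > - sin \<mu> * p}"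
      unfolding eq by auto
    then show "convex {w. \<phi> w < 0}" "convex {w. \<phi> w > 0}"
      by (simp_all only: convex_halfspace_lt convex_halfspace_gt)
  qed
  have \<phi>z: "\<phi> (z \<theta> t) = t * sin (\<theta> - \<mu>)" for \<theta> t
  proof -
    have "cis (- \<mu>) * (z \<theta> t - of_real p) = of_real t * cis (\<theta> - \<mu>)"
      by (simp add: zr cis_mult algebra_simps)
    then have "\<phi> (z \<theta> t) = Im (of_real t * cis (\<theta> - \<mu>))" unfolding \<phi>_def by (rule arg_cong)
    then show ?thesis by simp
  qed
  have "sin \<mu> > 0" using \<mu> by (simp add: sin_gt_zero)
  then have "\<phi> (of_real (p + r)) < 0" "\<phi> (of_real (p - r)) > 0"
    using r(1) by (simp_all add: \<phi>_def algebra_simps)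
  moreover have "sin (\<theta>1 - \<mu>) < 0" "sin (\<theta>2 - \<mu>) > 0"
    using \<mu> \<theta> sin_gt_zero[of "\<mu> - \<theta>1"] sin_gt_zero[of "\<theta>2 - \<mu>"] sin_minus[of "\<mu> - \<theta>1"] by simp_all
  then have "\<phi> (z \<theta>1 t) < 0" "\<phi> (z \<theta>2 t) > 0" if "t > 0" for t
    using that by (simp_all add: \<phi>z mult_pos_neg)
  ultimately have "of_real (p + r) \<in> {w. \<phi> w < 0}" "of_real (p - r) \<in> {w. \<phi> w > 0}"
    "z \<theta>1 r \<in> {w. \<phi> w < 0}" "z \<theta>1 \<rho> \<in> {w. \<phi> w < 0}"
    "z \<theta>2 r \<in> {w. \<phi> w > 0}" "z \<theta>2 \<rho> \<in> {w. \<phi> w > 0}"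
    using r(1) \<rho> by blast+
  then have "A1 \<subseteq> {w. \<phi> w < 0}" "B1 \<subseteq> {w. \<phi> w < 0}" "A2 \<subseteq> {w. \<phi> w > 0}" "B2 \<subseteq> {w. \<phi> w > 0}"
    unfolding A1_def A2_def B1_def B2_def by (simp_all only: closed_segment_subset conv)
  then have sep: "(A1 \<union> B1) \<inter> (A2 \<union> B2) = {}" by fastforce
  \<comment> \<open>Initial pieces are separated by the line, detours miss the opposite long path by
    the choice of \<open>\<delta>\<close>, and all remaining pairs are separated by the sign of
    \<open>H\<close>.\<close>
  have disj: "path_image F1 \<inter> path_image F2 = {}"
    unfolding im1 im2 using sep A PN B1(1) B2(1) G1(4) G2(4) by blast
  have nonneg: "Im w \<ge> 0" if "w \<in> path_image F1 \<union> path_image F2" for w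
  proof -
    have convI: "convex {w. Im w \<ge> 0}" using convex_halfspace_Im_ge[of 0] by simp
    have zS: "z \<theta>1 r \<in> S" "z \<theta>2 r \<in> S" using ray1[of r] ray2[of r] r by (auto simp: zr)
    have "A1 \<subseteq> {w. Im w \<ge> 0}" "A2 \<subseteq> {w. Im w \<ge> 0}"
      unfolding A1_def A2_def using upper[OF zS(1)] upper[OF zS(2)]
      by (intro closed_segment_subset convI; simp)+
    moreover have "Pos \<subseteq> {w. Im w \<ge> 0}" "Neg \<subseteq> {w. Im w \<ge> 0}"
      using clS by (auto simp: Pos_def Neg_def)
    moreover have "B1 \<subseteq> {w. Im w \<ge> 0}" "B2 \<subseteq> {w. Im w \<ge> 0}"
      using B1(2) B2(2) upper less_imp_le by blast+
    ultimately show ?thesis using that G1(4) G2(4) unfolding im1 im2 by blast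
  qed
  have pF: "path F1" "pathstart F1 = of_real (p + r)" "pathfinish F1 = 0"
    "path F2" "pathstart F2 = of_real (p - r)" "pathfinish F2 = of_real L"
    using G1 G2 by (auto simp: F1_def F2_def)
  \<comment> \<open>After reversal the end points are interlaced as
    \<open>0 < p - r < p + r < L\<close>.\<close>
  have "path_image (reversepath F1) \<inter> path_image F2 \<noteq> {}"
    by (rule half_plane_paths_cross) (use pF nonneg r in auto)
  then show False using disj by simp
qed

text \<open>Near $p$ one has $f(z) - f(p) \approx c (z-p)^n$ with $c$ real and $n \ge 2$, so the sign of
  $\mathrm{Im} f$ on the ray of angle $\theta$ is that of $c \sin n\theta$; only $n = 2$, $c < 0$
  does not show a positive sector to the right of a negative one.\<close>

lemma degenerate_critical_point_rays:
  fixes p r :: real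
  assumes f: "f holomorphic_on ball (of_real p) r" and "r > 0"
    and real: "\<And>z. z \<in> ball (of_real p) r \<Longrightarrow> Im z = 0 \<Longrightarrow> Im (f z) = 0"
    and crit: "deriv f (of_real p) = 0"
    and nonconst: "\<not> f constant_on ball (of_real p) r"
    and nonneg: "Re (deriv (deriv f) (of_real p)) \<ge> 0"
  obtains \<theta>1 \<theta>2 \<rho> where "0 < \<theta>1" "\<theta>1 < \<theta>2" "\<theta>2 < pi" "0 < \<rho>" "\<rho> < r"
    "\<And>t. 0 < t \<Longrightarrow> t \<le> \<rho> \<Longrightarrow> Im (f (of_real p + of_real t * cis \<theta>1)) > 0"
    "\<And>t. 0 < t \<Longrightarrow> t \<le> \<rho> \<Longrightarrow> Im (f (of_real p + of_real t * cis \<theta>2)) < 0"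
proof -
  let ?p = "of_real p :: complex"
  have pr: "?p \<in> ball ?p r" using \<open>r > 0\<close> by simp
  have fp: "Im (f ?p) = 0" using real[OF pr] by simp
  obtain g s n where n: "0 < n" and s: "0 < s" "ball ?p s \<subseteq> ball ?p r"
    and g: "g holomorphic_on ball ?p s"
    and fg': "\<And>w. w \<in> ball ?p s \<Longrightarrow> f w - f ?p = (w - ?p) ^ n * g w"
    and g0: "\<And>w. w \<in> ball ?p s \<Longrightarrow> g w \<noteq> 0"
  proof (rule holomorphic_factor_zero_nonconstant[of "\<lambda>w. f w - f ?p" "ball ?p r" ?p])
    show "\<not> (\<lambda>w. f w - f ?p) constant_on ball ?p r"
      using nonconst unfolding constant_on_def by (metis diff_eq_eq)
  qed (use f pr that in \<open>auto intro!: holomorphic_intros\<close>)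
  have fg: "f w = f ?p + (w - ?p) ^ n * g w" if "w \<in> ball ?p s" for w
    using fg'[OF that] by (simp add: algebra_simps)
  have ps: "?p \<in> ball ?p s" using s by simp
  have dg: "(g has_field_derivative deriv g w) (at w)" if "w \<in> ball ?p s" for w
    using holomorphic_derivI[OF g open_ball that] .
  have df: "deriv f w = of_nat n * (w - ?p) ^ (n - 1) * g w + (w - ?p) ^ n * deriv g w"
    if w: "w \<in> ball ?p s" for w
  proof (rule DERIV_imp_deriv)
    have "((\<lambda>w. f ?p + (w - ?p) ^ n * g w) has_field_derivative
        of_nat n * (w - ?p) ^ (n - 1) * g w + (w - ?p) ^ n * deriv g w) (at w)"
      using dg[OF w] by (auto intro!: derivative_eq_intros)
    then show "(f has_field_derivative of_nat n * (w - ?p) ^ (n - 1) * g w + (w - ?p) ^ n * deriv g w) (at w)"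
      by (rule has_field_derivative_transform_within_open[OF _ open_ball w]) (rule fg[symmetric])
  qed
  have "n \<noteq> 1" using df[OF ps] crit g0[OF ps] by auto
  with n have n2: "n \<ge> 2" by simp
  have "isCont g ?p" using dg[OF ps] DERIV_isCont by blast
  have lim: "((\<lambda>t. g (?p + of_real t * cis \<theta>)) \<longlongrightarrow> g ?p) (at_right (0::real))" for \<theta>
    by (rule isCont_tendsto_compose[OF \<open>isCont g ?p\<close>]) (auto intro!: tendsto_eq_intros)
  have small: "\<forall>\<^sub>F t in at_right (0::real). 0 < t \<and> t < s"
    using s(1) by (auto simp: eventually_at_right_field)
  have ray: "Im (f (?p + of_real t * cis \<theta>)) = t ^ n * Im (cis (real n * \<theta>) * g (?p + of_real t * cis \<theta>))"
    if t: "0 < t" "t < s" for t \<theta>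
  proof -
    have "?p + of_real t * cis \<theta> \<in> ball ?p s" using t by (simp add: dist_norm norm_mult)
    from fg[OF this] have "f (?p + of_real t * cis \<theta>) =
        f ?p + of_real (t ^ n) * (cis (real n * \<theta>) * g (?p + of_real t * cis \<theta>))"
      by (simp add: power_mult_distrib Complex.DeMoivre)
    then show ?thesis by (simp add: fp del: of_real_power)
  qed
  \<comment> \<open>\<open>f\<close> is real on the axis, and dividing by the real factor
    \<open>t ^ n\<close> keeps this in the limit.\<close>
  have img: "Im (g ?p) = 0"
  proof -
    have "\<forall>\<^sub>F t in at_right (0::real). Im (g (?p + of_real t * cis 0)) = 0"
      using small
    proof eventually_elim
      case (elim t)
      have "?p + of_real t * cis 0 \<in> ball ?p s" using elim by (simp add: dist_norm)
      then have "?p + of_real t * cis 0 \<in> ball ?p r" using s(2) by blast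
      then have "Im (f (?p + of_real t * cis 0)) = 0" by (rule real) simp
      with ray[of t 0] elim show ?case by simp
    qed
    moreover have "((\<lambda>t. Im (g (?p + of_real t * cis 0))) \<longlongrightarrow> Im (g ?p)) (at_right (0::real))"
      by (intro tendsto_Im lim)
    ultimately show ?thesis
      by (intro tendsto_unique[OF trivial_limit_at_right_real, of _ "Im (g ?p)" 0 0])
        (auto intro: tendsto_eventually elim: Lim_transform_eventually)
  qed
  define c where "c = Re (g ?p)"
  have c0: "c \<noteq> 0" using g0[OF ps] img by (auto simp: c_def complex_eq_iff)
  have sign: "((\<lambda>t. Im (cis (real n * \<theta>) * g (?p + of_real t * cis \<theta>))) \<longlongrightarrow> c * sin (real n * \<theta>)) (at_right (0::real))" for \<theta>
  proof -
    have "((\<lambda>t. Im (cis (real n * \<theta>) * g (?p + of_real t * cis \<theta>))) \<longlongrightarrow> Im (cis (real n * \<theta>) * g ?p)) (at_right (0::real))"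
      by (intro tendsto_intros lim)
    then show ?thesis using img by (simp add: c_def mult.commute)
  qed
  note result = that
  have key: thesis if \<theta>: "0 < \<theta>1" "\<theta>1 < \<theta>2" "\<theta>2 < pi" "c * sin (real n * \<theta>1) > 0" "c * sin (real n * \<theta>2) < 0" for \<theta>1 \<theta>2
  proof -
    have "\<forall>\<^sub>F t in at_right (0::real). t < r \<and> Im (f (?p + of_real t * cis \<theta>1)) > 0 \<and> Im (f (?p + of_real t * cis \<theta>2)) < 0"
      using order_tendstoD(1)[OF sign \<theta>(4)] order_tendstoD(2)[OF sign \<theta>(5)] small
        eventually_at_right_real[OF \<open>r > 0\<close>]
      by eventually_elim (auto simp: ray mult_pos_neg)
    then obtain b where b: "b > 0" "\<And>t. 0 < t \<Longrightarrow> t < b \<Longrightarrow> t < r \<and> Im (f (?p + of_real t * cis \<theta>1)) > 0 \<and> Im (f (?p + of_real t * cis \<theta>2)) < 0"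
      by (auto simp: eventually_at_right_field)
    show thesis
    proof (rule result[OF \<theta>(1-3), of "b / 2"])
      fix t assume "0 < t" "t \<le> b / 2"
      then show "Im (f (?p + of_real t * cis \<theta>1)) > 0" "Im (f (?p + of_real t * cis \<theta>2)) < 0"
        using b(2)[of t] b(1) by auto
    qed (use b(1) b(2)[of "b / 2"] in auto)
  qed
  have s32: "sin (3 * pi / 2) = -1" "sin (5 * pi / 2) = 1"
  proof -
    have "3 * pi / 2 = pi / 2 + pi" "5 * pi / 2 = (pi / 2 + pi) + pi" by simp_all
    then show "sin (3 * pi / 2) = -1" "sin (5 * pi / 2) = 1" by (simp_all only: sin_periodic_pi) simp_all
  qed
  show thesis
  proof (cases "c > 0")
    case True
    show thesis
    \<comment> \<open>Here \<open>n * \<theta>\<close> takes the values \<open>pi / 2\<close> and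
      \<open>3 * pi / 2\<close>; the second angle is below \<open>pi\<close> because
      \<open>n \<ge> 2\<close>.\<close>
    proof (rule key)
      show "0 < pi / (2 * real n)" "pi / (2 * real n) < 3 * pi / (2 * real n)" "3 * pi / (2 * real n) < pi"
        using n2 by (auto simp: field_simps)
      have "real n * (pi / (2 * real n)) = pi / 2" "real n * (3 * pi / (2 * real n)) = 3 * pi / 2" using n2 by auto
      then show "c * sin (real n * (pi / (2 * real n))) > 0" "c * sin (real n * (3 * pi / (2 * real n))) < 0"
        using True s32 by (simp_all only:) simp_all
    qed
  next
    case False
    then have c: "c < 0" using c0 by simp
    \<comment> \<open>For \<open>n = 2\<close> the second derivative of \<open>f\<close> at
      \<open>p\<close> would be \<open>2 * c < 0\<close>.\<close>
    have "n \<noteq> 2"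
    proof
      assume n: "n = 2"
      have "((\<lambda>w. 2 * (w - ?p) * g w + (w - ?p)\<^sup>2 * deriv g w) has_field_derivative 2 * g ?p) (at ?p)"
        using dg[OF ps] holomorphic_derivI[OF holomorphic_deriv[OF g open_ball] open_ball ps]
        by (auto intro!: derivative_eq_intros)
      then have "(deriv f has_field_derivative 2 * g ?p) (at ?p)"
        by (rule has_field_derivative_transform_within_open[OF _ open_ball ps]) (simp add: df n)
      then have "deriv (deriv f) ?p = 2 * g ?p" by (rule DERIV_imp_deriv)
      then show False using nonneg c by (simp add: c_def)
    qed
    then have n3: "n \<ge> 3" using n2 by simp
    show thesis
    \<comment> \<open>For \<open>c < 0\<close> the pattern moves on by one sector, to
      \<open>3 * pi / 2\<close> and \<open>5 * pi / 2\<close>; now \<open>n \<ge> 3\<close> is what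
      keeps the second angle below \<open>pi\<close>.\<close>
    proof (rule key)
      show "0 < 3 * pi / (2 * real n)" "3 * pi / (2 * real n) < 5 * pi / (2 * real n)" "5 * pi / (2 * real n) < pi"
        using n3 by (auto simp: field_simps)
      have eq: "real n * (3 * pi / (2 * real n)) = 3 * pi / 2" "real n * (5 * pi / (2 * real n)) = 5 * pi / 2"
        using n2 by auto
      show "c * sin (real n * (3 * pi / (2 * real n))) > 0" "c * sin (real n * (5 * pi / (2 * real n))) < 0"
        unfolding eq s32 using c by simp_all
    qed
  qed
qed

subsection \<open>Limits of the gradient on the sides\<close>

text \<open>Limits within the triangle are therefore unique, and \<open>Lim\<close> in
  \<open>grad_closure\<close> returns the limit whenever there is one.\<close>

lemma (in based_triangle) in_closure_islimpt:
  assumes "x \<in> closure \<Omega>"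
  shows "at x within \<Omega> \<noteq> bot"
proof -
  have "x islimpt \<Omega>"
    using assms open_triangle_open interior_limit_point[of x \<Omega>] by (auto simp: closure_def interior_open)
  then show ?thesis using trivial_limit_within by blast
qed

context torsion_triangle
begin

definition "\<Phi> z = Complex (grad u (T z) \<bullet> e + Im z) (grad u (T z) \<bullet> d)"

text \<open>The gradient is read off as \<open>Im f\<close> along \<open>d\<close> and
  \<open>Re f - y\<close> along \<open>e\<close>. Since \<open>f\<close> is continuous across the
  base and real on it, only the normal component survives in the limit.\<close>

lemma side_expansion_limit:
  assumes "0 < c" "c < L"
  obtains r f where "r > 0" "f holomorphic_on ball (of_real c) r"
    "\<And>z. z \<in> ball (of_real c) r \<Longrightarrow> Im z > 0 \<Longrightarrow> z \<in> S \<and> f z = \<Phi> z"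
    "\<And>z. z \<in> ball (of_real c) r \<Longrightarrow> Im z = 0 \<Longrightarrow> Im (f z) = 0"
    "Re (f (of_real c)) > 0"
    "\<And>s. \<bar>s - c\<bar> < r \<Longrightarrow> (grad u \<longlongrightarrow> Re (f (of_real s)) *\<^sub>R e) (at (P + s *\<^sub>R d) within \<Omega>)"
proof -
  obtain r f where rf: "r > 0" "f holomorphic_on ball (of_real c) r"
    "\<And>z. z \<in> ball (of_real c) r \<Longrightarrow> Im z > 0 \<Longrightarrow>
      z \<in> S \<and> f z = Complex (grad u (T z) \<bullet> e + Im z) (grad u (T z) \<bullet> d)"
    "\<And>z. z \<in> ball (of_real c) r \<Longrightarrow> Im z = 0 \<Longrightarrow> Im (f z) = 0"
    "Re (f (of_real c)) > 0"
    using side_expansion[OF assms] by blast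
  have lim: "(grad u \<longlongrightarrow> Re (f (of_real s)) *\<^sub>R e) (at (P + s *\<^sub>R d) within \<Omega>)" if s: "\<bar>s - c\<bar> < r" for s
  proof -
    let ?x = "P + s *\<^sub>R d"
    let ?I = "\<lambda>x. Complex ((x - P) \<bullet> d) ((x - P) \<bullet> e)"
    have sb: "of_real s \<in> ball (of_real c :: complex) r"
      using s by (simp add: dist_of_real dist_real_def abs_minus_commute)
    have Ix: "?I ?x = of_real s" using dd de by (simp add: complex_eq_iff)
    have I: "(?I \<longlongrightarrow> of_real s) (at ?x within \<Omega>)"
    proof -
      have "continuous_on UNIV ?I" by (intro continuous_intros)
      then have "isCont ?I ?x" by (simp add: continuous_on_eq_continuous_at)
      then have "(?I \<longlongrightarrow> ?I ?x) (at ?x within \<Omega>)"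
        using continuous_at_imp_continuous_at_within continuous_within by blast
      then show ?thesis unfolding Ix .
    qed
    have "isCont f (of_real s)"
      using rf(2) sb continuous_on_eq_continuous_at[OF open_ball] holomorphic_on_imp_continuous_on by blast
    from isCont_tendsto_compose[OF this I]
    have fI: "((\<lambda>x. f (?I x)) \<longlongrightarrow> f (of_real s)) (at ?x within \<Omega>)" .
    have "((\<lambda>x. Im (f (?I x)) *\<^sub>R d + (Re (f (?I x)) - Im (?I x)) *\<^sub>R e) \<longlongrightarrow>
        Im (f (of_real s)) *\<^sub>R d + (Re (f (of_real s)) - Im (of_real s)) *\<^sub>R e) (at ?x within \<Omega>)"
      by (intro tendsto_intros fI tendsto_Im[OF I])
    moreover have "\<forall>\<^sub>F x in at ?x within \<Omega>. Im (f (?I x)) *\<^sub>R d + (Re (f (?I x)) - Im (?I x)) *\<^sub>R e = grad u x"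
    proof -
      have "\<forall>\<^sub>F x in at ?x within \<Omega>. ?I x \<in> ball (of_real c) r"
        using I sb by (intro topological_tendstoD) auto
      moreover have "\<forall>\<^sub>F x in at ?x within \<Omega>. x \<in> \<Omega>"
        by (simp add: eventually_at_filter)
      ultimately show ?thesis
      proof eventually_elim
        case (elim x)
        have "?I x \<in> S" using elim(2) by (simp add: S_def frame_inverse)
        then have "Im (?I x) > 0" by (simp add: mem_S)
        with rf(3)[OF elim(1)] have "f (?I x) = Complex (grad u x \<bullet> e + Im (?I x)) (grad u x \<bullet> d)"
          by (simp add: frame_inverse)
        then show ?case using expand[of "grad u x", symmetric] by simp
      qed
    qed
    ultimately have "(grad u \<longlongrightarrow> Im (f (of_real s)) *\<^sub>R d + (Re (f (of_real s)) - Im (of_real s)) *\<^sub>R e) (at ?x within \<Omega>)"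
      by (rule Lim_transform_eventually)
    then show ?thesis using rf(4)[OF sb] by simp
  qed
  show ?thesis
  proof (rule that[OF rf(1,2) _ rf(4,5) lim])
    show "z \<in> S \<and> f z = \<Phi> z" if "z \<in> ball (of_real c) r" "Im z > 0" for z
      using rf(3)[OF that] by (simp add: \<Phi>_def)
  qed
qed

text \<open>Near each point \<open>\<Phi>\<close> is the derivative of a local holomorphic function
  with imaginary part \<open>U + y^2 / 2\<close>; the real constants in which these local functions
  differ do not affect it.\<close>

lemma \<Phi>_holomorphic: "\<Phi> holomorphic_on S"
  unfolding holomorphic_on_open[OF S_open]
proof
  fix z assume "z \<in> S"
  then obtain r where r: "r > 0" "cball z r \<subseteq> S" using S_open open_contains_cball by blast
  have "\<exists>f. f holomorphic_on ball z r \<and> (\<forall>w\<in>ball z r. Im (f w) = U w + (Im w - 0)\<^sup>2 / 2)"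
  proof (rule harmonic_disc_Im_holomorphic[OF _ r(1)])
    show "continuous_on (cball z r) (\<lambda>w. U w + (Im w - 0)\<^sup>2 / 2)"
      using r(2) closure_subset by (intro continuous_intros continuous_on_subset[OF U_continuous]) auto
    show "has_lap (\<lambda>w. U w + (Im w - 0)\<^sup>2 / 2) w 0" if "w \<in> ball z r" for w
    proof -
      have "w \<in> S" using that r(2) by (auto simp del: mem_cball mem_ball dest: ball_subset_cball[THEN subsetD])
      from has_lap_add[OF U_lap[OF this] has_lap_Im_power2[of 0]] show ?thesis by simp
    qed
  qed
  then obtain f where f: "f holomorphic_on ball z r"
    "\<And>w. w \<in> ball z r \<Longrightarrow> Im (f w) = U w + (Im w - 0)\<^sup>2 / 2" by blast
  have eq: "deriv f w = \<Phi> w" if w: "w \<in> ball z r" for w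
  proof -
    have "T w \<in> \<Omega>" using w r(2) by (auto simp: S_def subset_iff)
    then have "deriv f w = Complex (grad u (T w) \<bullet> e + (Im w - 0)) (grad u (T w) \<bullet> d)"
      using f by (intro deriv_eq_grad[OF _ f(1) open_ball w] u_differentiable) (auto simp: U_def)
    then show ?thesis by (simp add: \<Phi>_def)
  qed
  have z: "z \<in> ball z r" using r by simp
  have "(deriv f has_field_derivative deriv (deriv f) z) (at z)"
    using holomorphic_derivI[OF holomorphic_deriv[OF f(1) open_ball] open_ball z] .
  then have "(\<Phi> has_field_derivative deriv (deriv f) z) (at z)"
    by (rule has_field_derivative_transform_within_open[OF _ open_ball z eq])
  then show "\<exists>f'. (\<Phi> has_field_derivative f') (at z)" ..
qed

end

lemma ex_based_triangle:
  fixes P Q R :: "real^2"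
  assumes "\<not> collinear {P, Q, R}"
  shows "\<exists>d e L a h. based_triangle d e P Q R L a h"
proof -
  have "P \<noteq> Q" using assms by auto
  define L where "L = norm (Q - P)"
  have L: "L > 0" using \<open>P \<noteq> Q\<close> by (simp add: L_def)
  define d where "d = (1 / L) *\<^sub>R (Q - P)"
  have Q: "Q = P + L *\<^sub>R d" using L by (simp add: d_def)
  have dd: "d \<bullet> d = 1"
    using L by (simp add: d_def L_def dot_square_norm power2_eq_square)
  define e0 :: "real^2" where "e0 = vector [- (d $ 2), d $ 1]"
  have e0: "e0 \<bullet> e0 = 1" "d \<bullet> e0 = 0"
    using dd by (simp_all add: e0_def inner_vec_def sum_2)
  \<comment> \<open>Orients the normal towards \<open>R\<close>, so that the height becomes
    positive.\<close>
  define \<sigma> where "\<sigma> = sgn ((R - P) \<bullet> e0)"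
  interpret o0: orthonormal_frame d e0 by unfold_locales (use dd e0 in auto)
  have ne: "(R - P) \<bullet> e0 \<noteq> 0"
  proof
    assume "(R - P) \<bullet> e0 = 0"
    then have "R - P = ((R - P) \<bullet> d) *\<^sub>R d" using o0.expand[of "R - P"] by simp
    then have "R - P = (((R - P) \<bullet> d) / L) *\<^sub>R (Q - P)" by (simp add: d_def)
    then have "collinear {0, Q - P, R - P}" unfolding collinear_lemma by blast
    then have "collinear {Q, P, R}"
      by (subst collinear_3) (auto simp: NO_MATCH_def)
    then show False using assms by (simp add: insert_commute)
  qed
  then have \<sigma>: "\<sigma> * \<sigma> = 1" by (simp add: \<sigma>_def sgn_if)
  interpret o: orthonormal_frame d "\<sigma> *\<^sub>R e0"
    by unfold_locales (use dd e0 \<sigma> in auto)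
  have "based_triangle d (\<sigma> *\<^sub>R e0) P Q R L ((R - P) \<bullet> d) \<bar>(R - P) \<bullet> e0\<bar>"
  proof
    have "(R - P) \<bullet> (\<sigma> *\<^sub>R e0) = \<bar>(R - P) \<bullet> e0\<bar>" by (simp add: \<sigma>_def sgn_if)
    then show "R = P + ((R - P) \<bullet> d) *\<^sub>R d + \<bar>(R - P) \<bullet> e0\<bar> *\<^sub>R \<sigma> *\<^sub>R e0"
      using o.expand[of "R - P"] by (simp add: algebra_simps)
  qed (use L Q ne in auto)
  then show ?thesis by blast
qed

subsection \<open>The gradient on the closed triangle\<close>

text \<open>Near \<open>x\<close> all values of \<open>g\<close> lie in a closed ball around
  \<open>G x\<close>, and so do their limits at nearby points of the closure.\<close>

lemma continuous_on_closure_limits: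
  fixes g G :: "'a::metric_space \<Rightarrow> 'b::metric_space"
  assumes lim: "\<And>x. x \<in> closure S \<Longrightarrow> (g \<longlongrightarrow> G x) (at x within S)"
    and nontriv: "\<And>x. x \<in> closure S \<Longrightarrow> at x within S \<noteq> bot"
  shows "continuous_on (closure S) G"
  unfolding continuous_on_iff
proof (intro ballI allI impI)
  fix x and \<epsilon> :: real assume x: "x \<in> closure S" and "\<epsilon> > 0"
  then have "\<forall>\<^sub>F y in at x within S. dist (g y) (G x) < \<epsilon> / 2"
    using lim[OF x] by (intro tendstoD) auto
  then obtain \<delta> where \<delta>: "\<delta> > 0" "\<And>y. y \<in> S \<Longrightarrow> y \<noteq> x \<Longrightarrow> dist y x < \<delta> \<Longrightarrow> dist (g y) (G x) < \<epsilon> / 2"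
    unfolding eventually_at by blast
  have "dist (G x') (G x) < \<epsilon>" if x': "x' \<in> closure S" "dist x' x < \<delta>" for x'
  proof (cases "x' = x")
    case True
    then show ?thesis using \<open>\<epsilon> > 0\<close> by simp
  next
    case False
    have "\<forall>\<^sub>F y in at x' within S. y \<in> ball x \<delta> - {x}"
      using x'(2) False by (intro topological_tendstoD[OF tendsto_ident_at]) (auto simp: dist_commute open_delete)
    moreover have "\<forall>\<^sub>F y in at x' within S. y \<in> S" by (simp add: eventually_at_filter)
    ultimately have "\<forall>\<^sub>F y in at x' within S. g y \<in> cball (G x) (\<epsilon> / 2)"
      by eventually_elim (use \<delta>(2) in \<open>force simp: dist_commute\<close>)
    then have "G x' \<in> cball (G x) (\<epsilon> / 2)"
      by (intro Lim_in_closed_set[OF closed_cball _ nontriv[OF x'(1)] lim[OF x'(1)]])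
    then show ?thesis using \<open>\<epsilon> > 0\<close> by (simp add: dist_commute)
  qed
  then show "\<exists>d>0. \<forall>x'\<in>closure S. dist x' x < d \<longrightarrow> dist (G x') (G x) < \<epsilon>"
    using \<delta>(1) by blast
qed

lemma open_triangle_rotate:
  "open_triangle Q R P = open_triangle P Q R" "open_triangle R P Q = open_triangle P Q R"
  by (simp_all add: open_triangle_def insert_commute)

lemma ex_torsion_triangle:
  assumes "\<not> collinear {P, Q, R}" "torsion_function (open_triangle P Q R) u"
  obtains d e L a h where "torsion_triangle d e P Q R L a h u"
  using ex_based_triangle[OF assms(1)] assms(2)
  by (auto simp: torsion_triangle_def torsion_triangle_axioms_def)

lemma grad_tendsto_vertex:
  assumes "\<not> collinear {P, Q, R}" "torsion_function (open_triangle P Q R) u"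
  shows "(grad u \<longlongrightarrow> 0) (at P within open_triangle P Q R)"
proof -
  obtain d e L a h where 1: "torsion_triangle d e P Q R L a h u"
    using ex_torsion_triangle[OF assms] .
  obtain d' e' L' a' h' where 2: "torsion_triangle d' e' P R Q L' a' h' u"
    by (rule ex_torsion_triangle[of P R Q u])
      (use assms in \<open>simp_all add: open_triangle_def insert_commute\<close>)
  show ?thesis by (rule grad_tendsto_0_vertex[OF 1 2])
qed

section \<open>The sides and the closure of the triangle as point sets\<close>

context based_triangle
begin

lemma base_segments:
  "open_segment P Q = (\<lambda>s. P + s *\<^sub>R d) ` {0<..<L}"
  "closed_segment P Q = (\<lambda>s. P + s *\<^sub>R d) ` {0..L}"
proof -
  have eq: "(1 - t) *\<^sub>R P + t *\<^sub>R Q = P + (t * L) *\<^sub>R d" for t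
    by (simp add: Q_eq algebra_simps)
  have PQ: "P \<noteq> Q" using Q_eq L_pos dd by auto
  show "closed_segment P Q = (\<lambda>s. P + s *\<^sub>R d) ` {0..L}"
  proof (intro equalityI subsetI)
    fix x assume "x \<in> closed_segment P Q"
    then obtain t where "0 \<le> t" "t \<le> 1" "x = P + (t * L) *\<^sub>R d"
      unfolding closed_segment_def eq by blast
    then show "x \<in> (\<lambda>s. P + s *\<^sub>R d) ` {0..L}" using L_pos by (auto intro!: image_eqI[of _ _ "t * L"] mult_left_le_one_le)
  next
    fix x assume "x \<in> (\<lambda>s. P + s *\<^sub>R d) ` {0..L}"
    then obtain s where s: "0 \<le> s" "s \<le> L" "x = P + (s / L * L) *\<^sub>R d" using L_pos by auto
    then show "x \<in> closed_segment P Q" unfolding closed_segment_def eq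
      using L_pos by (auto intro!: exI[of _ "s / L"])
  qed
  show "open_segment P Q = (\<lambda>s. P + s *\<^sub>R d) ` {0<..<L}"
  proof (intro equalityI subsetI)
    fix x assume "x \<in> open_segment P Q"
    then obtain t where "0 < t" "t < 1" "x = P + (t * L) *\<^sub>R d"
      unfolding in_segment eq by blast
    then show "x \<in> (\<lambda>s. P + s *\<^sub>R d) ` {0<..<L}" using L_pos by (auto intro!: image_eqI[of _ _ "t * L"])
  next
    fix x assume "x \<in> (\<lambda>s. P + s *\<^sub>R d) ` {0<..<L}"
    then obtain s where s: "0 < s" "s < L" "x = P + (s / L * L) *\<^sub>R d" using L_pos by auto
    then show "x \<in> open_segment P Q" unfolding in_segment eq
      using L_pos PQ by (auto intro!: exI[of _ "s / L"])
  qed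
qed

lemma T_of_real: "T (of_real s) = P + s *\<^sub>R d"
  by (simp add: frame_def)

lemma closure_triangle: "closure \<Omega> = convex hull {P, Q, R}"
proof -
  have "P + (1/3) *\<^sub>R (Q - P) + (1/3) *\<^sub>R (R - P) \<in> \<Omega>"
    unfolding mem_triangle_iff by (intro exI[of _ "1/3"] conjI refl) simp_all
  then have "\<Omega> \<noteq> {}" by blast
  then show ?thesis
    using convex_closure_interior[of "convex hull {P, Q, R}"]
    by (simp add: open_triangle_def closure_closed compact_imp_closed finite_imp_compact_convex_hull)
qed

lemma closure_triangle_cases:
  assumes "x \<in> closure \<Omega>"
  obtains "x \<in> \<Omega>" | "x \<in> {P, Q, R}" | "x \<in> open_segment P Q" | "x \<in> open_segment Q R" | "x \<in> open_segment R P"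
proof -
  have "x \<in> \<Omega> \<or> x \<in> frontier (convex hull {P, Q, R})"
    using assms unfolding closure_triangle
    by (auto simp: open_triangle_def frontier_def closure_closed compact_imp_closed finite_imp_compact_convex_hull)
  then show ?thesis
    using that by (auto simp: frontier_of_triangle open_segment_def)
qed

end

text \<open>The inner normal is described by inner products with the vertices instead of a frame, so
  that the statement can be transported to the other two sides and used in the frame of the
  base.\<close>

lemma grad_tendsto_side:
  assumes "\<not> collinear {P, Q, R}" "torsion_function (open_triangle P Q R) u" "x \<in> open_segment P Q"
  shows "\<exists>g e. g > 0 \<and> e \<bullet> (Q - P) = 0 \<and> e \<bullet> (R - P) > 0 \<and>
    (grad u \<longlongrightarrow> g *\<^sub>R e) (at x within open_triangle P Q R)"
proof -
  obtain d e L a h where "torsion_triangle d e P Q R L a h u"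
    using ex_torsion_triangle[OF assms(1,2)] .
  then interpret torsion_triangle d e P Q R L a h u .
  obtain c where c: "0 < c" "c < L" "x = P + c *\<^sub>R d"
    using assms(3) base_segments(1) by auto
  obtain r f where rf: "r > 0" "f holomorphic_on ball (of_real c) r"
    "\<And>z. z \<in> ball (of_real c) r \<Longrightarrow> Im z > 0 \<Longrightarrow> z \<in> S \<and> f z = \<Phi> z"
    "\<And>z. z \<in> ball (of_real c) r \<Longrightarrow> Im z = 0 \<Longrightarrow> Im (f z) = 0"
    "Re (f (of_real c)) > 0"
    "\<And>s. \<bar>s - c\<bar> < r \<Longrightarrow> (grad u \<longlongrightarrow> Re (f (of_real s)) *\<^sub>R e) (at (P + s *\<^sub>R d) within \<Omega>)"
    by (rule side_expansion_limit[OF c(1,2)]) (rule that; assumption)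
  have "(grad u \<longlongrightarrow> Re (f (of_real c)) *\<^sub>R e) (at x within \<Omega>)"
    using rf(6)[of c] rf(1) c(3) by simp
  moreover have "e \<bullet> (Q - P) = 0" using de by (simp add: Q_eq inner_commute)
  moreover have "e \<bullet> (R - P) > 0" using R_inner(2) h_pos by (simp add: inner_commute)
  ultimately show ?thesis using rf(5) by blast
qed

lemma closed_segment_open_segment_end:
  fixes x :: "'a::real_vector"
  assumes "x \<in> open_segment a b"
  shows "closed_segment x b \<subseteq> open_segment a b \<union> {b}"
proof
  fix w assume "w \<in> closed_segment x b"
  then obtain t where t: "0 \<le> t" "t \<le> 1" "w = (1 - t) *\<^sub>R x + t *\<^sub>R b"
    unfolding in_segment by blast
  obtain s where s: "a \<noteq> b" "0 < s" "s < 1" "x = (1 - s) *\<^sub>R a + s *\<^sub>R b"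
    using assms unfolding in_segment by blast
  show "w \<in> open_segment a b \<union> {b}"
  proof (cases "t = 1")
    case True
    then show ?thesis using t by simp
  next
    case False
    define k where "k = (1 - t) * (1 - s)"
    have k: "0 < k" "k < 1"
    proof -
      show "0 < k" using False t s by (simp add: k_def)
      have "k \<le> 1 * (1 - s)" unfolding k_def using t s by (intro mult_right_mono) auto
      then show "k < 1" using s by simp
    qed
    have "w = (1 - (1 - k)) *\<^sub>R a + (1 - k) *\<^sub>R b"
      unfolding t(3) s(4) k_def by (simp add: algebra_simps)
    then have "w \<in> open_segment a b"
      unfolding in_segment using k s(1) by (intro conjI exI[of _ "1 - k"]) auto
    then show ?thesis by simp
  qed
qed

section \<open>The continuous gradient on the closed triangle and the sign of its tangential
  part\<close>

context torsion_triangle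
begin

abbreviation "G \<equiv> grad_closure \<Omega> u"

lemma grad_closureI:
  assumes "(grad u \<longlongrightarrow> l) (at x within \<Omega>)" "x \<in> closure \<Omega>"
  shows "G x = l"
  unfolding grad_closure_def by (rule tendsto_Lim[OF in_closure_islimpt[OF assms(2)] assms(1)])

lemma torsion_rotated:
  "\<not> collinear {Q, R, P}" "torsion_function (open_triangle Q R P) u"
  "\<not> collinear {R, P, Q}" "torsion_function (open_triangle R P Q) u"
  using not_collinear torsion
  by (simp_all add: open_triangle_def insert_commute)

lemma grad_limit_inside: "x \<in> \<Omega> \<Longrightarrow> (grad u \<longlongrightarrow> grad u x) (at x within \<Omega>)"
  using continuous_grad by (simp add: continuous_on_def)

lemma grad_limit_PQ: "x \<in> open_segment P Q \<Longrightarrow>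
    \<exists>g e. g > 0 \<and> e \<bullet> (Q - P) = 0 \<and> e \<bullet> (R - P) > 0 \<and> (grad u \<longlongrightarrow> g *\<^sub>R e) (at x within \<Omega>)"
  using grad_tendsto_side[OF not_collinear torsion] .

lemma grad_limit_QR: "x \<in> open_segment Q R \<Longrightarrow>
    \<exists>g e. g > 0 \<and> e \<bullet> (R - Q) = 0 \<and> e \<bullet> (P - Q) > 0 \<and> (grad u \<longlongrightarrow> g *\<^sub>R e) (at x within \<Omega>)"
  using grad_tendsto_side[OF torsion_rotated(1,2)] unfolding open_triangle_rotate(1)[of Q R P] .

lemma grad_limit_RP: "x \<in> open_segment R P \<Longrightarrow>
    \<exists>g e. g > 0 \<and> e \<bullet> (P - R) = 0 \<and> e \<bullet> (Q - R) > 0 \<and> (grad u \<longlongrightarrow> g *\<^sub>R e) (at x within \<Omega>)"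
  using grad_tendsto_side[OF torsion_rotated(3,4)] unfolding open_triangle_rotate(2)[of R P Q] .

lemma grad_limit_vertex: "x \<in> {P, Q, R} \<Longrightarrow> (grad u \<longlongrightarrow> 0) (at x within \<Omega>)"
  using grad_tendsto_vertex[OF not_collinear torsion] grad_tendsto_vertex[OF torsion_rotated(1,2)]
    grad_tendsto_vertex[OF torsion_rotated(3,4)]
  unfolding open_triangle_rotate(1)[of Q R P] open_triangle_rotate(2)[of R P Q] by blast

lemma grad_closure_tendsto:
  assumes "x \<in> closure \<Omega>"
  shows "(grad u \<longlongrightarrow> G x) (at x within \<Omega>)"
proof -
  have "\<exists>l. (grad u \<longlongrightarrow> l) (at x within \<Omega>)"
    using assms
  proof (cases rule: closure_triangle_cases)
    case 1 then show ?thesis using grad_limit_inside by blast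
  next
    case 2 then show ?thesis using grad_limit_vertex by blast
  next
    case 3 then show ?thesis using grad_limit_PQ by blast
  next
    case 4 then show ?thesis using grad_limit_QR by blast
  next
    case 5 then show ?thesis using grad_limit_RP by blast
  qed
  then show ?thesis using grad_closureI[OF _ assms] by auto
qed

lemma G_continuous: "continuous_on (closure \<Omega>) G"
  by (rule continuous_on_closure_limits[OF grad_closure_tendsto in_closure_islimpt])

lemma G_inside: "x \<in> \<Omega> \<Longrightarrow> G x = grad u x"
  using grad_closureI[OF grad_limit_inside] closure_subset by blast

lemma vertices_sides_in_closure:
  "{P, Q, R} \<subseteq> closure \<Omega>" "closed_segment P Q \<subseteq> closure \<Omega>" "open_segment Q R \<subseteq> closure \<Omega>" "open_segment R P \<subseteq> closure \<Omega>"
proof -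
  have "closed_segment x y \<subseteq> closure \<Omega>" if "{x, y} \<subseteq> {P, Q, R}" for x y
    unfolding closure_triangle segment_convex_hull by (rule hull_mono[OF that])
  from this[of P Q] this[of Q R] this[of R P]
  have "closed_segment P Q \<subseteq> closure \<Omega>" "closed_segment Q R \<subseteq> closure \<Omega>" "closed_segment R P \<subseteq> closure \<Omega>"
    by simp_all
  then show "{P, Q, R} \<subseteq> closure \<Omega>" "closed_segment P Q \<subseteq> closure \<Omega>"
    "open_segment Q R \<subseteq> closure \<Omega>" "open_segment R P \<subseteq> closure \<Omega>"
    using ends_in_segment unfolding open_segment_def by blast+
qed

lemma G_vertex: "x \<in> {P, Q, R} \<Longrightarrow> G x = 0"
  using grad_closureI[OF grad_limit_vertex] vertices_sides_in_closure(1) by blast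

definition "H z = G (T z) \<bullet> d"

lemma H_continuous: "continuous_on (closure S) H"
  unfolding H_def
  by (intro continuous_intros continuous_on_compose2[OF G_continuous]) (auto simp: T_closure)

lemma H_inside: "z \<in> S \<Longrightarrow> H z = Im (\<Phi> z)"
  by (simp add: H_def \<Phi>_def G_inside S_def)

lemma H_lap: "z \<in> S \<Longrightarrow> has_lap H z 0"
  by (rule has_lap_cong[OF has_lap_Im[OF \<Phi>_holomorphic S_open]])
    (auto intro: eventually_mono[OF eventually_nhds_in_open[OF S_open]] simp: H_inside)

lemma H_base: "0 \<le> s \<Longrightarrow> s \<le> L \<Longrightarrow> H (of_real s) = 0"
proof -
  assume s: "0 \<le> s" "s \<le> L"
  define x where "x = P + s *\<^sub>R d"
  have x: "x \<in> closed_segment P Q" using s base_segments(2) by (auto simp: x_def)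
  have "G x \<bullet> d = 0"
  proof (cases "x \<in> open_segment P Q")
    case True
    then obtain g e' where *: "e' \<bullet> (Q - P) = 0" "(grad u \<longlongrightarrow> g *\<^sub>R e') (at x within \<Omega>)"
      using grad_limit_PQ by blast
    have "G x = g *\<^sub>R e'" using grad_closureI[OF *(2)] x vertices_sides_in_closure by blast
    moreover have "e' \<bullet> d = 0" using *(1) L_pos by (simp add: Q_eq)
    ultimately show ?thesis by simp
  next
    case False
    then have "x \<in> {P, Q, R}" using x by (auto simp: open_segment_def)
    then show ?thesis using G_vertex by simp
  qed
  then show ?thesis by (simp add: H_def T_of_real x_def)
qed

text \<open>The gradient is a positive multiple of the inner normal of \<open>R P\<close>. Its
  component along \<open>Q - P\<close> is positive because \<open>Q\<close> lies on the inner side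
  of the line through \<open>R\<close> and \<open>P\<close>; this holds even if the angle at
  \<open>P\<close> is obtuse.\<close>

lemma H_left:
  assumes "T z \<in> open_segment R P"
  shows "H z > 0"
proof -
  obtain g e' where *: "g > 0" "e' \<bullet> (P - R) = 0" "e' \<bullet> (Q - R) > 0" "(grad u \<longlongrightarrow> g *\<^sub>R e') (at (T z) within \<Omega>)"
    using grad_limit_RP[OF assms] by blast
  have "G (T z) = g *\<^sub>R e'" using grad_closureI[OF *(4)] assms vertices_sides_in_closure by blast
  moreover have "e' \<bullet> (Q - P) = e' \<bullet> (Q - R) - e' \<bullet> (P - R)" by (simp add: inner_diff_right)
  then have "L * (e' \<bullet> d) > 0" using * by (simp add: Q_eq)
  then have "e' \<bullet> d > 0" using L_pos by (simp add: zero_less_mult_iff)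
  ultimately show ?thesis using *(1) by (simp add: H_def)
qed

lemma H_right:
  assumes "T z \<in> open_segment Q R"
  shows "H z < 0"
proof -
  obtain g e' where *: "g > 0" "e' \<bullet> (R - Q) = 0" "e' \<bullet> (P - Q) > 0" "(grad u \<longlongrightarrow> g *\<^sub>R e') (at (T z) within \<Omega>)"
    using grad_limit_QR[OF assms] by blast
  have "G (T z) = g *\<^sub>R e'" using grad_closureI[OF *(4)] assms vertices_sides_in_closure by blast
  moreover have "L * (e' \<bullet> d) < 0" using *(3) by (simp add: Q_eq inner_diff_right)
  then have "e' \<bullet> d < 0" using L_pos by (simp add: mult_less_0_iff)
  ultimately show ?thesis using *(1) by (simp add: H_def mult_pos_neg)
qed

lemma T_segment: "T ` closed_segment z w = closed_segment (T z) (T w)"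
proof -
  have "T ((1 - t) *\<^sub>R z + t *\<^sub>R w) = (1 - t) *\<^sub>R T z + t *\<^sub>R T w" for t
    by (simp add: frame_def algebra_simps)
  then show ?thesis unfolding closed_segment_image_interval by (simp add: image_image)
qed

lemma T_inj: "T z = T w \<Longrightarrow> z = w"
  by (metis dist_frame dist_eq_0_iff)

lemma frontier_S_cases:
  assumes "z \<in> frontier S"
  obtains "H z = 0" | "T z \<in> open_segment Q R" | "T z \<in> open_segment R P"
proof -
  have zc: "T z \<in> closure \<Omega>" "z \<notin> S"
    using assms S_open T_closure by (auto simp: frontier_def interior_open)
  from zc(1) show ?thesis
  proof (cases rule: closure_triangle_cases)
    case 1
    then show ?thesis using zc(2) by (simp add: S_def)
  next
    case 2
    then show ?thesis using that(1) G_vertex by (simp add: H_def)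
  next
    case 3
    then obtain s where "0 < s" "s < L" "T z = T (of_real s)"
      using base_segments(1) T_of_real by auto
    then show ?thesis using that(1) H_base[of s] T_inj by auto
  qed (use that in auto)
qed

text \<open>Among the frontier points only those on the open side \<open>R P\<close> have
  \<open>H > 0\<close>, and from there the segment to \<open>0\<close> runs along this side down to
  \<open>P\<close>.\<close>

lemma H_left_segment:
  assumes "z \<in> frontier S" "H z > 0"
  shows "closed_segment z 0 \<subseteq> {w \<in> closure S. H w > 0} \<union> {0}"
proof
  fix w assume w: "w \<in> closed_segment z 0"
  have z: "T z \<in> open_segment R P"
    using assms H_right by (cases rule: frontier_S_cases) force+
  have "T w \<in> closed_segment (T z) P" using w T_segment[of z 0] frame_zero by auto
  moreover have "closed_segment (T z) P \<subseteq> open_segment R P \<union> {P}"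
    using z by (rule closed_segment_open_segment_end)
  ultimately consider "T w \<in> open_segment R P" | "T w = P" by blast
  then show "w \<in> {w \<in> closure S. H w > 0} \<union> {0}"
  proof cases
    case 1
    then show ?thesis using H_left vertices_sides_in_closure T_closure by blast
  next
    case 2
    then show ?thesis using T_inj[of w 0] frame_zero by simp
  qed
qed

lemma H_right_segment:
  assumes "z \<in> frontier S" "H z < 0"
  shows "closed_segment z (of_real L) \<subseteq> {w \<in> closure S. H w < 0} \<union> {of_real L}"
proof
  fix w assume w: "w \<in> closed_segment z (of_real L)"
  have TL: "T (of_real L) = Q" by (simp add: T_of_real Q_eq)
  have z: "T z \<in> open_segment Q R"
    using assms H_left by (cases rule: frontier_S_cases) force+
  have "T w \<in> closed_segment (T z) Q" using w T_segment[of z "of_real L"] TL by auto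
  moreover have "closed_segment (T z) Q \<subseteq> open_segment Q R \<union> {Q}"
    using z closed_segment_open_segment_end[of "T z" R Q] by (simp add: open_segment_commute)
  ultimately consider "T w \<in> open_segment Q R" | "T w = Q" by blast
  then show "w \<in> {w \<in> closure S. H w < 0} \<union> {of_real L}"
  proof cases
    case 1
    then show ?thesis using H_right vertices_sides_in_closure T_closure by blast
  next
    case 2
    then show ?thesis using T_inj[of w "of_real L"] TL by simp
  qed
qed

end

subsection \<open>Critical points on the base\<close>

text \<open>After one critical point the derivative is negative, before the next one it is positive,
  so a minimum would lie strictly between them. It would itself be critical, and the negative second
  derivative would produce smaller values next to it.\<close>

lemma unique_critical_point_of_profile:
  fixes \<gamma> :: "real \<Rightarrow> real"
  assumes "L > 0" and cont: "continuous_on {0..L} \<gamma>" and ends: "\<gamma> 0 = 0" "\<gamma> L = 0"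
    and D: "\<And>c. 0 < c \<Longrightarrow> c < L \<Longrightarrow> \<exists>p b. (\<forall>\<^sub>F s in nhds c. (\<gamma> has_real_derivative p s) (at s)) \<and>
      (p has_real_derivative b) (at c) \<and> (p c = 0 \<longrightarrow> b < 0)"
  shows "\<exists>!c. 0 < c \<and> c < L \<and> (\<gamma> has_real_derivative 0) (at c)"
proof -
  have d1: "(\<gamma> has_real_derivative deriv \<gamma> c) (at c)"
    and d2: "deriv \<gamma> c = 0 \<Longrightarrow> \<exists>b<0. (deriv \<gamma> has_real_derivative b) (at c)"
    if c: "0 < c" "c < L" for c
  proof -
    obtain p b where p: "\<forall>\<^sub>F s in nhds c. (\<gamma> has_real_derivative p s) (at s)"
      "(p has_real_derivative b) (at c)" "p c = 0 \<longrightarrow> b < 0"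
      using D[OF c] by blast
    have pc: "(\<gamma> has_real_derivative p c) (at c)" using p(1) by (rule eventually_nhds_x_imp_x)
    then have dc: "deriv \<gamma> c = p c" by (rule DERIV_imp_deriv)
    then show "(\<gamma> has_real_derivative deriv \<gamma> c) (at c)" using pc by simp
    have "\<forall>\<^sub>F s in nhds c. deriv \<gamma> s = p s"
      using p(1) by eventually_elim (rule DERIV_imp_deriv)
    then have "(deriv \<gamma> has_real_derivative b) (at c)"
      using p(2) by (simp add: DERIV_cong_ev)
    then show "\<exists>b<0. (deriv \<gamma> has_real_derivative b) (at c)" if "deriv \<gamma> c = 0"
      using p(3) dc that by auto
  qed
  obtain c where c: "0 < c" "c < L" "deriv \<gamma> c = 0"
  proof -
    have "\<exists>z. 0 < z \<and> z < L \<and> (\<gamma> has_real_derivative 0) (at z)"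
      using assms(1) cont ends d1 by (intro Rolle) (auto simp: real_differentiable_def)
    then show ?thesis using that DERIV_imp_deriv by blast
  qed
  have False if ab: "0 < a" "a < b" "b < L" "deriv \<gamma> a = 0" "deriv \<gamma> b = 0" for a b
  proof -
    obtain s1 where s1: "a < s1" "s1 < (a + b) / 2" "deriv \<gamma> s1 < 0"
    proof -
      obtain k where k: "k < 0" "(deriv \<gamma> has_real_derivative k) (at a)" using d2[of a] ab by auto
      obtain \<delta> where \<delta>: "\<delta> > 0" "\<And>h. 0 < h \<Longrightarrow> h < \<delta> \<Longrightarrow> deriv \<gamma> (a + h) < deriv \<gamma> a"
        using DERIV_neg_dec_right[OF k(2,1)] by blast
      obtain h where "0 < h" "h < \<delta>" "h < (b - a) / 2"
        using field_lbound_gt_zero[of \<delta> "(b - a) / 2"] \<delta>(1) ab by auto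
      then show ?thesis using \<delta>(2)[of h] ab by (intro that[of "a + h"]) (auto simp: field_simps)
    qed
    obtain s2 where s2: "(a + b) / 2 < s2" "s2 < b" "deriv \<gamma> s2 > 0"
    proof -
      obtain k where k: "k < 0" "(deriv \<gamma> has_real_derivative k) (at b)" using d2[of b] ab by auto
      obtain \<delta> where \<delta>: "\<delta> > 0" "\<And>h. 0 < h \<Longrightarrow> h < \<delta> \<Longrightarrow> deriv \<gamma> b < deriv \<gamma> (b - h)"
        using DERIV_neg_dec_left[OF k(2,1)] by blast
      obtain h where "0 < h" "h < \<delta>" "h < (b - a) / 2"
        using field_lbound_gt_zero[of \<delta> "(b - a) / 2"] \<delta>(1) ab by auto
      then show ?thesis using \<delta>(2)[of h] ab by (intro that[of "b - h"]) (auto simp: field_simps)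
    qed
    have s12: "s1 < s2" using s1 s2 by linarith
    have "continuous_on {s1..s2} \<gamma>" by (rule continuous_on_subset[OF cont]) (use s1 s2 ab in auto)
    then obtain m where m: "m \<in> {s1..s2}" "\<And>s. s \<in> {s1..s2} \<Longrightarrow> \<gamma> m \<le> \<gamma> s"
      using continuous_attains_inf[of "{s1..s2}" \<gamma>] s12 by auto
    have "m \<noteq> s1"
    proof
      assume "m = s1"
      obtain \<delta> where \<delta>: "\<delta> > 0" "\<And>h. 0 < h \<Longrightarrow> h < \<delta> \<Longrightarrow> \<gamma> (s1 + h) < \<gamma> s1"
        using DERIV_neg_dec_right[OF d1[of s1] s1(3)] s1 ab by auto
      obtain h where "0 < h" "h < \<delta>" "h < s2 - s1"
        using field_lbound_gt_zero[of \<delta> "s2 - s1"] \<delta>(1) s12 by auto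
      then show False using \<delta>(2)[of h] m(2)[of "s1 + h"] \<open>m = s1\<close> by auto
    qed
    moreover have "m \<noteq> s2"
    proof
      assume "m = s2"
      obtain \<delta> where \<delta>: "\<delta> > 0" "\<And>h. 0 < h \<Longrightarrow> h < \<delta> \<Longrightarrow> \<gamma> (s2 - h) < \<gamma> s2"
        using DERIV_pos_inc_left[OF d1[of s2] s2(3)] s2 ab by auto
      obtain h where "0 < h" "h < \<delta>" "h < s2 - s1"
        using field_lbound_gt_zero[of \<delta> "s2 - s1"] \<delta>(1) s12 by auto
      then show False using \<delta>(2)[of h] m(2)[of "s2 - h"] \<open>m = s2\<close> by auto
    qed
    ultimately have ms: "s1 < m" "m < s2" using m(1) by auto
    then have mL: "0 < m" "m < L" using s1 s2 ab by auto
    have "deriv \<gamma> m = 0"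
    proof (rule DERIV_local_min[OF d1[OF mL], of "min (m - s1) (s2 - m)"])
      show "\<forall>y. \<bar>m - y\<bar> < min (m - s1) (s2 - m) \<longrightarrow> \<gamma> m \<le> \<gamma> y"
        by (intro allI impI m(2)) (auto simp: abs_less_iff)
    qed (use ms in auto)
    then obtain k where k: "k < 0" "(deriv \<gamma> has_real_derivative k) (at m)" using d2[OF mL] by blast
    obtain \<delta> where \<delta>: "\<delta> > 0" "\<And>h. 0 < h \<Longrightarrow> h < \<delta> \<Longrightarrow> deriv \<gamma> (m + h) < deriv \<gamma> m"
      using DERIV_neg_dec_right[OF k(2,1)] by blast
    obtain h where h: "0 < h" "h < \<delta>" "h < s2 - m"
      using field_lbound_gt_zero[of \<delta> "s2 - m"] \<delta>(1) ms by auto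
    obtain z where z: "m < z" "z < m + h" "\<gamma> (m + h) - \<gamma> m = (m + h - m) * deriv \<gamma> z"
      using MVT2[of m "m + h" \<gamma> "deriv \<gamma>"] d1 h mL s2 ab by auto
    have "deriv \<gamma> z < 0" using \<delta>(2)[of "z - m"] z h \<open>deriv \<gamma> m = 0\<close> by auto
    then have "h * deriv \<gamma> z < 0" using h(1) by (simp add: mult_pos_neg)
    then have "\<gamma> (m + h) < \<gamma> m" using z(3) by simp
    then show False using m(2)[of "m + h"] ms h by auto
  qed
  note no_two = this
  show ?thesis
  proof (intro ex1I[of _ c] conjI)
    show "(\<gamma> has_real_derivative 0) (at c)" using d1[of c] c by simp
    fix c' assume c': "0 < c' \<and> c' < L \<and> (\<gamma> has_real_derivative 0) (at c')"
    then have "deriv \<gamma> c' = 0" using DERIV_imp_deriv by blast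
    then show "c' = c" using no_two[of c c'] no_two[of c' c] c c' by (metis linorder_neqE_linordered_idom)
  qed (use c in auto)
qed

section \<open>The normal derivative along the base, its critical points and the fail points\<close>

context torsion_triangle
begin

text \<open>By analytic continuation a real constant value would make \<open>H\<close> vanish on the
  whole closed triangle, against \<open>H > 0\<close> on the side \<open>R P\<close>.\<close>

lemma \<Phi>_not_constant:
  assumes "open A" "A \<noteq> {}" "A \<subseteq> S" "\<And>z. z \<in> A \<Longrightarrow> \<Phi> z = of_real k"
  shows False
proof -
  have eq: "\<Phi> z = of_real k" if "z \<in> S" for z
    by (rule analytic_continuation_open[OF assms(1) S_open assms(2) convex_connected[OF S_convex]
          assms(3) \<Phi>_holomorphic holomorphic_on_const assms(4) that])
  have H0: "H z = 0" if "z \<in> closure S" for z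
    using continuous_constant_on_closure[OF H_continuous _ that, of 0] eq H_inside by auto
  define x where "x = midpoint R P"
  have "P \<noteq> R" using R_inner(2) h_pos by auto
  then have x: "x \<in> open_segment R P" by (simp add: x_def)
  define z where "z = Complex ((x - P) \<bullet> d) ((x - P) \<bullet> e)"
  have "T z = x" by (simp add: z_def frame_inverse)
  then show False
    using H_left[of z] H0[of z] x vertices_sides_in_closure(4) T_closure[of z] by auto
qed

lemma critical_second_deriv_neg:
  assumes c: "0 < c" "c < L" and "r > 0" and f: "f holomorphic_on ball (of_real c) r"
    and upper: "\<And>z. z \<in> ball (of_real c) r \<Longrightarrow> Im z > 0 \<Longrightarrow> z \<in> S \<and> f z = \<Phi> z"
    and real: "\<And>z. z \<in> ball (of_real c) r \<Longrightarrow> Im z = 0 \<Longrightarrow> Im (f z) = 0"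
    and crit: "deriv f (of_real c) = 0"
  shows "Re (deriv (deriv f) (of_real c)) < 0"
proof (rule ccontr)
  assume "\<not> ?thesis"
  then have nonneg: "Re (deriv (deriv f) (of_real c)) \<ge> 0" by simp
  \<comment> \<open>This guarantees a finite order \<open>n\<close> at \<open>c\<close>, without
    which there are no nodal sectors.\<close>
  have nonconst: "\<not> f constant_on ball (of_real c) r"
  proof
    assume "f constant_on ball (of_real c) r"
    then obtain k where k: "\<And>z. z \<in> ball (of_real c) r \<Longrightarrow> f z = k" unfolding constant_on_def by blast
    have "Im k = 0" using real[of "of_real c"] k[of "of_real c"] \<open>r > 0\<close> by simp
    then have k': "k = of_real (Re k)" by (simp add: complex_eq_iff)
    let ?A = "{z \<in> ball (of_real c) r. Im z > 0}"
    have "open ?A"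
      by (intro open_Collect_conj open_Collect_less continuous_intros) (auto simp: open_ball[unfolded ball_def] ball_def)
    moreover have "of_real c + \<i> * of_real (r / 2) \<in> ?A"
      using \<open>r > 0\<close> by (simp add: dist_norm norm_mult)
    then have "?A \<noteq> {}" by blast
    moreover have "\<Phi> z = of_real (Re k)" if "z \<in> ?A" for z
      using upper[of z] k[of z] k' that by simp
    ultimately show False using \<Phi>_not_constant[of ?A "Re k"] upper by blast
  qed
  obtain \<theta>1 \<theta>2 \<rho> where \<theta>: "0 < \<theta>1" "\<theta>1 < \<theta>2" "\<theta>2 < pi" and \<rho>: "0 < \<rho>" "\<rho> < r"
    and rays: "\<And>t. 0 < t \<Longrightarrow> t \<le> \<rho> \<Longrightarrow> Im (f (of_real c + of_real t * cis \<theta>1)) > 0"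
      "\<And>t. 0 < t \<Longrightarrow> t \<le> \<rho> \<Longrightarrow> Im (f (of_real c + of_real t * cis \<theta>2)) < 0"
    using degenerate_critical_point_rays[OF f \<open>r > 0\<close> real crit nonconst nonneg] by metis
  have inS: "of_real c + of_real t * cis \<theta> \<in> S \<and>
      H (of_real c + of_real t * cis \<theta>) = Im (f (of_real c + of_real t * cis \<theta>))"
    if "0 < t" "t \<le> \<rho>" "0 < \<theta>" "\<theta> < pi" for t \<theta>
  proof -
    let ?z = "of_real c + of_real t * cis \<theta>"
    have "?z \<in> ball (of_real c) r" using that \<rho> by (simp add: dist_norm norm_mult)
    moreover have "Im ?z > 0" using that by (simp add: sin_gt_zero)
    ultimately show ?thesis using upper[of ?z] H_inside[of ?z] by simp
  qed
  show False
  proof (rule nodal_rays_impossible[OF S_bounded S_open S_convex H_continuous H_lap _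
        H_left_segment H_right_segment _ _ _ c \<theta> \<rho>(1)])
    show "H 0 = 0" "H (of_real L) = 0" "H (of_real c) = 0"
      using H_base[of 0] H_base[of L] H_base[of c] c L_pos by simp_all
    show "Im z > 0" if "z \<in> S" for z using that by (simp add: mem_S)
    show "of_real c + of_real t * cis \<theta>1 \<in> S \<and> H (of_real c + of_real t * cis \<theta>1) > 0"
      if "0 < t" "t \<le> \<rho>" for t using inS[OF that, of \<theta>1] rays(1)[OF that] \<theta> by simp
    show "of_real c + of_real t * cis \<theta>2 \<in> S \<and> H (of_real c + of_real t * cis \<theta>2) < 0"
      if "0 < t" "t \<le> \<rho>" for t using inS[OF that, of \<theta>2] rays(2)[OF that] \<theta> by simp
  qed
qed

text \<open>The inner normal derivative on the base. The gradient is normal there, so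
  \<open>\<bar>\<gamma>\<bar>\<close> is its length, and \<open>\<gamma>\<close> is positive between
  the vertices.\<close>

definition "\<gamma> s = G (P + s *\<^sub>R d) \<bullet> e"

lemma base_in_closure: "0 \<le> s \<Longrightarrow> s \<le> L \<Longrightarrow> P + s *\<^sub>R d \<in> closure \<Omega>"
  using vertices_sides_in_closure(2) unfolding base_segments(2) image_subset_iff by simp

lemma G_base: "0 \<le> s \<Longrightarrow> s \<le> L \<Longrightarrow> G (P + s *\<^sub>R d) = \<gamma> s *\<^sub>R e"
  using expand[of "G (P + s *\<^sub>R d)"] H_base[of s] by (simp add: \<gamma>_def H_def T_of_real)

lemma \<gamma>_continuous: "continuous_on {0..L} \<gamma>"
  unfolding \<gamma>_def
  by (intro continuous_intros continuous_on_compose2[OF G_continuous]) (auto intro: base_in_closure)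

lemma \<gamma>_ends: "\<gamma> 0 = 0" "\<gamma> L = 0"
  using G_vertex[of P] G_vertex[of Q] by (simp_all add: \<gamma>_def Q_eq[symmetric])

text \<open>On the base \<open>\<gamma>\<close> is \<open>Re f\<close>, with derivatives
  \<open>Re f'\<close> and \<open>Re f''\<close>. Because \<open>f\<close> is real on the axis, so
  is \<open>f'\<close> at \<open>c\<close>; thus vanishing of \<open>Re f'\<close> means a full zero
  of \<open>f'\<close>, as \<open>critical_second_deriv_neg\<close> requires.\<close>

lemma \<gamma>_local:
  assumes c: "0 < c" "c < L"
  shows "\<gamma> c > 0"
    and "\<exists>p b. (\<forall>\<^sub>F s in nhds c. (\<gamma> has_real_derivative p s) (at s)) \<and>
      (p has_real_derivative b) (at c) \<and> (p c = 0 \<longrightarrow> b < 0)"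
proof -
  obtain r f where rf: "r > 0" "f holomorphic_on ball (of_real c) r"
    "\<And>z. z \<in> ball (of_real c) r \<Longrightarrow> Im z > 0 \<Longrightarrow> z \<in> S \<and> f z = \<Phi> z"
    "\<And>z. z \<in> ball (of_real c) r \<Longrightarrow> Im z = 0 \<Longrightarrow> Im (f z) = 0"
    "Re (f (of_real c)) > 0"
    "\<And>s. \<bar>s - c\<bar> < r \<Longrightarrow> (grad u \<longlongrightarrow> Re (f (of_real s)) *\<^sub>R e) (at (P + s *\<^sub>R d) within \<Omega>)"
    by (rule side_expansion_limit[OF c]) (rule that; assumption)
  have eq: "\<gamma> s = Re (f (of_real s))" if "\<bar>s - c\<bar> < r" "0 < s" "s < L" for s
    using grad_closureI[OF rf(6)[OF that(1)] base_in_closure[of s]] that ee by (simp add: \<gamma>_def)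
  show "\<gamma> c > 0" using eq[of c] rf(1,5) c by simp
  have ball: "of_real s \<in> ball (of_real c :: complex) r" if "\<bar>s - c\<bar> < r" for s
    using that by (simp add: dist_of_real dist_real_def abs_minus_commute)
  have cb: "of_real c \<in> ball (of_real c :: complex) r" using rf(1) by simp
  have line: "((\<lambda>s. Re (g (of_real s))) has_real_derivative Re (deriv g (of_real s))) (at s)"
    if "g holomorphic_on ball (of_real c) r" "\<bar>s - c\<bar> < r" for g s
  proof -
    have "((\<lambda>s::real. of_real s :: complex) has_vector_derivative 1) (at s)"
      by (auto intro!: derivative_eq_intros simp: has_vector_derivative_def scaleR_conv_of_real)
    then have "((g \<circ> of_real) has_vector_derivative 1 * deriv g (of_real s)) (at s)"
      using holomorphic_derivI[OF that(1) open_ball ball[OF that(2)]]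
      by (intro field_vector_diff_chain_at) auto
    then show ?thesis by (auto dest: has_field_derivative_Re simp: o_def)
  qed
  have evr: "\<forall>\<^sub>F s in nhds c. \<bar>s - c\<bar> < r \<and> 0 < s \<and> s < L"
  proof -
    have "open ({c - r<..<c + r} \<inter> {0<..<L})" "c \<in> {c - r<..<c + r} \<inter> {0<..<L}" using rf(1) c by auto
    from eventually_nhds_in_open[OF this] show ?thesis by eventually_elim auto
  qed
  have 1: "\<forall>\<^sub>F s in nhds c. (\<gamma> has_real_derivative Re (deriv f (of_real s))) (at s)"
  proof -
    have "\<forall>\<^sub>F s in nhds c. \<forall>\<^sub>F t in nhds s. \<gamma> t = Re (f (of_real t))"
      using evr unfolding eventually_eventually by eventually_elim (simp add: eq)
    with evr show ?thesis
    proof eventually_elim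
      case (elim s)
      then show ?case using line[OF rf(2), of s] by (simp add: DERIV_cong_ev)
    qed
  qed
  have 2: "((\<lambda>s. Re (deriv f (of_real s))) has_real_derivative Re (deriv (deriv f) (of_real c))) (at c)"
    by (rule line[OF holomorphic_deriv[OF rf(2) open_ball]]) (use rf(1) in simp)
  have imd: "Im (deriv f (of_real c)) = 0"
  proof -
    have "\<forall>\<^sub>F s in nhds (0::real). of_real c + of_real s \<in> ball (of_real c :: complex) r"
      using cb by (intro topological_tendstoD[where S = "ball (of_real c) r"])
        (auto intro!: tendsto_eq_intros filterlim_ident)
    then have "\<forall>\<^sub>F s in nhds (0::real). Im (f (of_real c + 1 * of_real s)) = 0"
      by eventually_elim (simp add: rf(4))
    then have "((\<lambda>s. Im (f (of_real c + 1 * of_real s))) has_real_derivative 0) (at 0)"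
      by (subst DERIV_cong_ev[OF refl _ refl, where g = "\<lambda>_. 0"]) auto
    from DERIV_unique[OF this Im_holomorphic_line_deriv[OF rf(2) open_ball cb]] show ?thesis by simp
  qed
  have "Re (deriv (deriv f) (of_real c)) < 0" if "Re (deriv f (of_real c)) = 0"
    by (rule critical_second_deriv_neg[OF c rf(1-4)]) (use that imd in \<open>auto simp: complex_eq_iff\<close>)
  with 1 2 show "\<exists>p b. (\<forall>\<^sub>F s in nhds c. (\<gamma> has_real_derivative p s) (at s)) \<and>
      (p has_real_derivative b) (at c) \<and> (p c = 0 \<longrightarrow> b < 0)"
    by (intro exI[of _ "\<lambda>s. Re (deriv f (of_real s))"] exI[of _ "Re (deriv (deriv f) (of_real c))"]) auto
qed

abbreviation "F \<equiv> grad_norm_sq \<Omega> u"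

lemma along_base:
  assumes "0 < c" "c < L"
  shows "\<forall>\<^sub>F s in nhds 0. along (Q - P) (P + c *\<^sub>R d) F s = (\<gamma> (c + s * L))\<^sup>2"
proof -
  have "((\<lambda>s. c + s * L) \<longlongrightarrow> c) (nhds 0)" by (auto intro!: tendsto_eq_intros filterlim_ident)
  then have "\<forall>\<^sub>F s in nhds 0. c + s * L \<in> {0<..<L}"
    by (rule topological_tendstoD) (use assms in auto)
  then show ?thesis
  proof eventually_elim
    case (elim s)
    have pt: "P + c *\<^sub>R d + s *\<^sub>R (Q - P) = P + (c + s * L) *\<^sub>R d" by (simp add: Q_eq algebra_simps)
    show ?case using elim G_base[of "c + s * L"] unfolding along_def grad_norm_sq_def pt by simp
  qed
qed

text \<open>The chain rule for \<open>(\<gamma> (c + s * L))^2\<close>; the factor \<open>L\<close>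
  appears because \<open>along\<close> uses the direction \<open>Q - P\<close>, which has length
  \<open>L\<close>.\<close>

lemma along_base_deriv:
  assumes c: "0 < c" "c < L"
  obtains p b where "\<forall>\<^sub>F s in nhds 0. (along (Q - P) (P + c *\<^sub>R d) F has_real_derivative
      2 * L * \<gamma> (c + s * L) * p (c + s * L)) (at s)"
    "(\<gamma> has_real_derivative p c) (at c)" "(p has_real_derivative b) (at c)" "p c = 0 \<longrightarrow> b < 0"
proof -
  obtain p b where p: "\<forall>\<^sub>F s in nhds c. (\<gamma> has_real_derivative p s) (at s)"
    "(p has_real_derivative b) (at c)" "p c = 0 \<longrightarrow> b < 0"
    using \<gamma>_local(2)[OF c] by blast
  have "((\<lambda>s. c + s * L) \<longlongrightarrow> c) (nhds 0)" by (auto intro!: tendsto_eq_intros filterlim_ident)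
  with p(1) have "\<forall>\<^sub>F s in nhds 0. (\<gamma> has_real_derivative p (c + s * L)) (at (c + s * L))"
    by (rule eventually_compose_filterlim)
  moreover have "\<forall>\<^sub>F s in nhds 0. \<forall>\<^sub>F t in nhds s. along (Q - P) (P + c *\<^sub>R d) F t = (\<gamma> (c + t * L))\<^sup>2"
    unfolding eventually_eventually by (rule along_base[OF c])
  ultimately have "\<forall>\<^sub>F s in nhds 0. (along (Q - P) (P + c *\<^sub>R d) F has_real_derivative
      2 * L * \<gamma> (c + s * L) * p (c + s * L)) (at s)"
  proof eventually_elim
    case (elim s)
    have "((\<lambda>t. c + t * L) has_real_derivative L) (at s)" by (auto intro!: derivative_eq_intros)
    from DERIV_chain2[OF elim(1) this]
    have "((\<lambda>t. \<gamma> (c + t * L)) has_real_derivative p (c + s * L) * L) (at s)" .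
    then have "((\<lambda>t. (\<gamma> (c + t * L))\<^sup>2) has_real_derivative 2 * L * \<gamma> (c + s * L) * p (c + s * L)) (at s)"
      by (auto intro!: derivative_eq_intros)
    then show ?case using DERIV_cong_ev[OF refl elim(2) refl] by blast
  qed
  then show ?thesis using that p eventually_nhds_x_imp_x[OF p(1)] by blast
qed

text \<open>Since \<open>\<gamma> > 0\<close> inside the base, the derivative of
  \<open>\<gamma>^2\<close> vanishes exactly where that of \<open>\<gamma>\<close> does.\<close>

lemma side_critical_point_iff:
  "side_critical_point F P Q x \<longleftrightarrow> (\<exists>c. 0 < c \<and> c < L \<and> x = P + c *\<^sub>R d \<and> (\<gamma> has_real_derivative 0) (at c))"
proof -
  have "(along (Q - P) (P + c *\<^sub>R d) F has_real_derivative 0) (at 0) \<longleftrightarrow> (\<gamma> has_real_derivative 0) (at c)"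
    if c: "0 < c" "c < L" for c
  proof -
    obtain p b where p: "\<forall>\<^sub>F s in nhds 0. (along (Q - P) (P + c *\<^sub>R d) F has_real_derivative
      2 * L * \<gamma> (c + s * L) * p (c + s * L)) (at s)" "(\<gamma> has_real_derivative p c) (at c)"
      by (rule along_base_deriv[OF c])
    have "(along (Q - P) (P + c *\<^sub>R d) F has_real_derivative 2 * L * \<gamma> c * p c) (at 0)"
      using eventually_nhds_x_imp_x[OF p(1)] by simp
    then have "(along (Q - P) (P + c *\<^sub>R d) F has_real_derivative 0) (at 0) \<longleftrightarrow> 2 * L * \<gamma> c * p c = 0"
      by (metis DERIV_unique)
    also have "\<dots> \<longleftrightarrow> p c = 0" using L_pos \<gamma>_local(1)[OF c] by simp
    also have "\<dots> \<longleftrightarrow> (\<gamma> has_real_derivative 0) (at c)" using p(2) by (metis DERIV_unique)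
    finally show ?thesis .
  qed
  then show ?thesis unfolding side_critical_point_def base_segments(1) by auto
qed

lemma unique_side_critical_point: "\<exists>!x. side_critical_point F P Q x"
proof -
  have ex1: "\<exists>!c. 0 < c \<and> c < L \<and> (\<gamma> has_real_derivative 0) (at c)"
    by (rule unique_critical_point_of_profile[OF L_pos \<gamma>_continuous \<gamma>_ends \<gamma>_local(2)])
  then show ?thesis unfolding side_critical_point_iff by (auto 4 4)
qed

lemma side_critical_point_nondegenerate:
  assumes "side_critical_point F P Q x"
  shows "side_nondegenerate F P Q x"
proof -
  obtain c where c: "0 < c" "c < L" "x = P + c *\<^sub>R d" "(\<gamma> has_real_derivative 0) (at c)"
    using assms side_critical_point_iff by blast
  obtain p b where p: "\<forall>\<^sub>F s in nhds 0. (along (Q - P) x F has_real_derivative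
      2 * L * \<gamma> (c + s * L) * p (c + s * L)) (at s)" "(\<gamma> has_real_derivative p c) (at c)"
      "(p has_real_derivative b) (at c)" "p c = 0 \<longrightarrow> b < 0"
    unfolding c(3) by (rule along_base_deriv[OF c(1,2)])
  have pc: "p c = 0" using DERIV_unique[OF p(2) c(4)] .
  have lin: "((\<lambda>t. c + t * L) has_real_derivative L) (at 0)" by (auto intro!: derivative_eq_intros)
  \<comment> \<open>As \<open>p c = 0\<close>, the product rule leaves only the term with the
    derivative of \<open>p\<close>, which is nonzero because \<open>b < 0\<close> and
    \<open>\<gamma> c > 0\<close>.\<close>
  have "((\<lambda>s. 2 * L * \<gamma> (c + s * L) * p (c + s * L)) has_real_derivative 2 * L * \<gamma> c * (b * L)) (at 0)"
    using DERIV_chain2[of \<gamma> "p c" _ 0, OF _ lin] DERIV_chain2[of p b _ 0, OF _ lin] p(2,3) pc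
    by (auto intro!: derivative_eq_intros)
  moreover have "\<forall>\<^sub>F s in nhds 0. deriv (along (Q - P) x F) s = 2 * L * \<gamma> (c + s * L) * p (c + s * L)"
    using p(1) by eventually_elim (rule DERIV_imp_deriv)
  ultimately have "(deriv (along (Q - P) x F) has_real_derivative 2 * L * \<gamma> c * (b * L)) (at 0)"
    by (simp add: DERIV_cong_ev)
  moreover have "2 * L * \<gamma> c * (b * L) \<noteq> 0" using L_pos \<gamma>_local(1)[OF c(1,2)] p(4) pc by auto
  moreover have "\<forall>\<^sub>F s in nhds 0. along (Q - P) x F field_differentiable at s"
    using p(1) by eventually_elim (auto simp: field_differentiable_def)
  ultimately show ?thesis unfolding side_nondegenerate_def by blast
qed

text \<open>The gradient vanishes at the ends of the base and not at its midpoint, so a fail point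
  on the closed base is an inner point of it, where a maximum over the triangle is also a maximum
  along the side.\<close>

lemma fail_point_is_critical:
  assumes "x \<in> closed_segment P Q" "fail_point \<Omega> u x"
  shows "side_critical_point F P Q x"
proof -
  have max: "norm (G y) \<le> norm (G x)" if "y \<in> closure \<Omega>" for y
    using assms(2) that by (simp add: fail_point_def)
  obtain c where c: "0 \<le> c" "c \<le> L" "x = P + c *\<^sub>R d" using assms(1) base_segments(2) by auto
  have "norm (G (P + (L / 2) *\<^sub>R d)) > 0" using G_base[of "L / 2"] \<gamma>_local(1)[of "L / 2"] L_pos by simp
  then have "G x \<noteq> 0" using max[OF base_in_closure[of "L / 2"]] L_pos by auto
  then have "\<gamma> c \<noteq> 0" using G_base[OF c(1,2)] c(3) by auto
  then have c': "0 < c" "c < L" using c \<gamma>_ends by (auto simp: less_le)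
  obtain p b where p: "\<forall>\<^sub>F s in nhds 0. (along (Q - P) x F has_real_derivative
      2 * L * \<gamma> (c + s * L) * p (c + s * L)) (at s)"
    unfolding c(3) by (rule along_base_deriv[OF c'])
  then have D: "(along (Q - P) x F has_real_derivative 2 * L * \<gamma> c * p c) (at 0)"
    using eventually_nhds_x_imp_x[OF p] by simp
  have "((\<lambda>s. c + s * L) \<longlongrightarrow> c) (nhds 0)" by (auto intro!: tendsto_eq_intros filterlim_ident)
  then have "\<forall>\<^sub>F s in nhds 0. c + s * L \<in> {0<..<L}"
    by (rule topological_tendstoD) (use c' in auto)
  then have "\<forall>\<^sub>F s in nhds 0. along (Q - P) x F s \<le> along (Q - P) x F 0"
  proof eventually_elim
    case (elim s)
    have pt: "x + s *\<^sub>R (Q - P) = P + (c + s * L) *\<^sub>R d" by (simp add: c(3) Q_eq algebra_simps)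
    have "norm (G (x + s *\<^sub>R (Q - P))) \<le> norm (G x)"
      unfolding pt using elim by (intro max base_in_closure) auto
    then show ?case by (simp add: along_def grad_norm_sq_def power_mono)
  qed
  then obtain \<delta> where "\<delta> > 0" "\<And>s. \<bar>s\<bar> < \<delta> \<Longrightarrow> along (Q - P) x F s \<le> along (Q - P) x F 0"
    unfolding eventually_nhds_metric by (auto simp: dist_real_def)
  then have "2 * L * \<gamma> c * p c = 0" by (intro DERIV_local_max[OF D, of \<delta>]) auto
  with D have "(along (Q - P) x F has_real_derivative 0) (at 0)" by simp
  moreover have "x \<in> open_segment P Q" using c' c(3) base_segments(1) by auto
  ultimately show ?thesis by (simp add: side_critical_point_def)
qed

end

section \<open>From one distinguished base to all three sides\<close>

lemma torsion_side:
  fixes P Q R :: "real^2"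
  assumes "\<not> collinear {P, Q, R}" "torsion_function (open_triangle P Q R) u"
  shows "(\<exists>!x. side_critical_point (grad_norm_sq (open_triangle P Q R) u) P Q x) \<and>
    (\<forall>x. side_critical_point (grad_norm_sq (open_triangle P Q R) u) P Q x \<longrightarrow>
         side_nondegenerate (grad_norm_sq (open_triangle P Q R) u) P Q x) \<and>
    (\<exists>\<^sub>\<le>\<^sub>1x. x \<in> closed_segment P Q \<and> fail_point (open_triangle P Q R) u x)"
proof -
  obtain d e L a h where "torsion_triangle d e P Q R L a h u"
    using ex_torsion_triangle[OF assms] .
  then interpret torsion_triangle d e P Q R L a h u .
  show ?thesis
    using unique_side_critical_point side_critical_point_nondegenerate fail_point_is_critical
    unfolding Uniq_def by blast
qed

theorem theorem1p4:
  fixes A B C :: "real^2" and u :: "real^2 \<Rightarrow> real"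
  assumes "\<not> collinear {A, B, C}"
    and "torsion_function (open_triangle A B C) u"
  shows "\<forall>(P, Q) \<in> {(A, B), (B, C), (C, A)}.
    (\<exists>!x. side_critical_point (grad_norm_sq (open_triangle A B C) u) P Q x) \<and>
    (\<forall>x. side_critical_point (grad_norm_sq (open_triangle A B C) u) P Q x \<longrightarrow>
         side_nondegenerate (grad_norm_sq (open_triangle A B C) u) P Q x) \<and>
    (\<exists>\<^sub>\<le>\<^sub>1x. x \<in> closed_segment P Q \<and> fail_point (open_triangle A B C) u x)"
proof -
  have perm: "open_triangle B C A = open_triangle A B C" "open_triangle C A B = open_triangle A B C"
    by (rule open_triangle_rotate)+
  have nc: "\<not> collinear {B, C, A}" "\<not> collinear {C, A, B}"
    using assms(1) by (simp_all add: insert_commute)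
  show ?thesis
    using torsion_side[OF assms] torsion_side[OF nc(1), unfolded perm, OF assms(2)]
      torsion_side[OF nc(2), unfolded perm, OF assms(2)]
    by simp
qed

end
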